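(* Let $(\delta,\sigma;u,v)\in(\mathbb Z/2\mathbb Z)^3\times\mathbb C^3$ with $\delta\in(\mathbb Z/2\mathbb Z)^2$, $\sigma\in\mathbb Z/2\mathbb Z$, $u\in\mathbb C^2$, $v\in\mathbb C$. The following conditions are equivalent: (i) $\mathrm{Diff}_{G'_{SL,3}}(I(\delta,u)_{SL},J(\sigma,v)_{SL})\neq\{0\}$; (ii) $(\delta,\sigma;u,v)\in\mathrm{Supp}_{SL,3}(\mathbb D)$, i.e. $(u_1+u_2)-v\in-\mathbb N$ and $(\delta_1+\delta_2)+\sigma\equiv(u_1+u_2)-v\bmod2$. Moreover, for $(\delta,\sigma;u,v)\in\mathrm{Supp}_{SL,3}(\mathbb D)$ with $j=-(u_1+u_2-v)\in\mathbb N$, $$\dim_{\mathbb C}\mathrm{Diff}_{G'_{SL,3}}(I(\delta,u)_{SL},J(\sigma,v)_{SL})\geq j+1.$$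
   Context: $\mathbb N=\{0,1,2,\dots\}$. $G_{SL}=SL(3,\mathbb R)$, $G'_{SL}=SL(2,\mathbb R)$. $P_{SL}=M_{SL}A_{SL}N_+$ is the upper triangular subgroup of $G_{SL}$, where $M_{SL}=\{\mathrm{diag}(m_1,m_2,m_3):m_j=\pm1,\ m_1m_2m_3=1\}$ and $A_{SL}=\{\exp(t_1(E_{11}-E_{22})+t_2(E_{22}-E_{33}))\}$. For $\delta\in(\mathbb Z/2\mathbb Z)^2$, $u\in\mathbb C^2$, let $\mathbb C_\delta$ be the character $\mathrm{diag}(m_1,m_2,m_3)\mapsto m_1^{\delta_1}m_3^{\delta_2}$ of $M_{SL}$, $\mathbb C_u$ the character $\exp(t_1(E_{11}-E_{22})+t_2(E_{22}-E_{33}))\mapsto e^{u_1t_1+u_2t_2}$ of $A_{SL}$, and $I(\delta,u)_{SL}=\mathrm{Ind}_{P_{SL}}^{G_{SL}}(\mathbb C_\delta\boxtimes\mathbb C_u)$ the unnormalized smooth principal series (functions with $f(gp)=\chi(p)^{-1}f(g)$, left translation). Similarly for $\sigma\in\mathbb Z/2\mathbb Z$, $v\in\mathbb C$, $J(\sigma,v)_{SL}$ is the unnormalized principal series of $SL(2,\mathbb R)$ induced from the character of the upper triangular subgroup $P'_{SL}=M'_{SL}A'_{SL}N'_+$ given by $mI\mapsto m^\sigma$ ($m=\pm1$), $\exp(t(E_{11}-E_{22}))\mapsto e^{vt}$, trivial on $N_+'$. Let $\iota_3\begin{pmatrix}a&b\\c&d\end{pmatrix}=\begin{pmatrix}a&0&b\\0&1&0\\c&0&d\end{pmatrix}$,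 $G'_{SL,3}=\iota_3(SL(2,\mathbb R))$, and regard $J(\sigma,v)_{SL}$ as a representation of $G'_{SL,3}$. $\mathrm{Diff}_{G'_{SL,3}}(I(\delta,u)_{SL},J(\sigma,v)_{SL})$ is the space of $G'_{SL,3}$-intertwining differential operators $I(\delta,u)_{SL}\to J(\sigma,v)_{SL}$ with respect to the natural map $G'_{SL,3}/\iota_3(P'_{SL})\to G_{SL}/P_{SL}$. *)

theory Defs
  imports
    "HOL-Analysis.Analysis"
    "HOL-Library.Z2"
    "HOL-Library.Function_Algebras"
    "HOL-Library.Extended_Nat"
begin

section \<open>Smooth functions\<close>

text \<open>\<open>Ck_on k U f\<close> is only meant for open \<open>U\<close>.\<close>

primrec Ck_on ::
  "nat \<Rightarrow> 'a::euclidean_space set \<Rightarrow> ('a \<Rightarrow> 'b::real_normed_vector) \<Rightarrow> bool" where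
  "Ck_on 0 U f \<longleftrightarrow> continuous_on U f"
| "Ck_on (Suc k) U f \<longleftrightarrow>
     (\<forall>x\<in>U. f differentiable (at x)) \<and>
     (\<forall>v. Ck_on k U (\<lambda>x. frechet_derivative f (at x) v))"

text \<open>
  For an arbitrary subset \<open>S\<close> of a Euclidean space, smoothness means that locally there is a
  smooth extension to an open set of the ambient space. For an open subset of an embedded
  submanifold, such as the special linear group inside the space of all matrices, this is
  smoothness with respect to the manifold structure.
\<close>

definition smooth_on :: "'a::euclidean_space set \<Rightarrow> ('a \<Rightarrow> 'b::real_normed_vector) \<Rightarrow> bool" where
  "smooth_on S f \<longleftrightarrow>
     (\<forall>x\<in>S. \<exists>U F. open U \<and> x \<in> U \<and> (\<forall>k. Ck_on k U F) \<and> (\<forall>y\<in>U \<inter> S. F y = f y))"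

section \<open>Groups and characters\<close>

definition SL :: "(real^'n^'n) set" where
  "SL = {g. det g = 1}"

definition mat_exp :: "real^'n^'n \<Rightarrow> real^'n^'n" where
  "mat_exp X = (\<Sum>k. (1 / fact k) *\<^sub>R (((**) X ^^ k) (mat 1)))"

definition diag2 :: "real \<Rightarrow> real \<Rightarrow> real^2^2" where
  "diag2 a b = vector [vector [a, 0], vector [0, b]]"

definition diag3 :: "real \<Rightarrow> real \<Rightarrow> real \<Rightarrow> real^3^3" where
  "diag3 a b c = vector [vector [a, 0, 0], vector [0, b, 0], vector [0, 0, c]]"

definition upper2 :: "real \<Rightarrow> real^2^2" where
  "upper2 x = vector [vector [1, x], vector [0, 1]]"

definition upper3 :: "real \<Rightarrow> real \<Rightarrow> real \<Rightarrow> real^3^3" where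
  "upper3 x y z = vector [vector [1, x, y], vector [0, 1, z], vector [0, 0, 1]]"

definition iota3 :: "real^2^2 \<Rightarrow> real^3^3" where
  "iota3 g = vector [vector [g $ 1 $ 1, 0, g $ 1 $ 2],
                     vector [0, 1, 0],
                     vector [g $ 2 $ 1, 0, g $ 2 $ 2]]"

text \<open>The integers modulo 2 are the type \<^typ>\<open>bit\<close>; this is \<open>m\<^sup>d\<close> for \<open>m = 1\<close> or \<open>m = -1\<close>.\<close>

definition sign_pow :: "real \<Rightarrow> bit \<Rightarrow> complex" where
  "sign_pow m d = (if d = 0 then 1 else complex_of_real m)"

text \<open>
  The inducing characters are given by their graphs, that is, as sets of pairs \<open>(p, \<psi> p)\<close>,
  where \<open>p = m a n\<close> runs through the upper triangular subgroup. In the first one,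
  \<open>a = exp (t1 (E11 - E22) + t2 (E22 - E33)) = diag (exp t1, exp (t2 - t1), exp (- t2))\<close>; in the
  second one, \<open>a = exp (t (E11 - E22))\<close>.
\<close>

definition char_SL3 :: "bit \<times> bit \<Rightarrow> complex \<times> complex \<Rightarrow> ((real^3^3) \<times> complex) set" where
  "char_SL3 \<delta> u =
     {(diag3 m1 m2 m3 ** diag3 (exp t1) (exp (t2 - t1)) (exp (- t2)) ** upper3 x y z,
       sign_pow m1 (fst \<delta>) * sign_pow m3 (snd \<delta>)
         * exp (fst u * complex_of_real t1 + snd u * complex_of_real t2))
      | m1 m2 m3 t1 t2 x y z.
        m1 \<in> {1, -1} \<and> m2 \<in> {1, -1} \<and> m3 \<in> {1, -1} \<and> m1 * m2 * m3 = 1}"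

definition char_SL2 :: "bit \<Rightarrow> complex \<Rightarrow> ((real^2^2) \<times> complex) set" where
  "char_SL2 \<sigma> v =
     {(diag2 m m ** diag2 (exp t) (exp (- t)) ** upper2 x,
       sign_pow m \<sigma> * exp (v * complex_of_real t))
      | m t x. m \<in> {1, -1}}"

section \<open>Principal series\<close>

text \<open>
  A function on the group is represented by a function on all matrices that vanishes outside
  the group, so that equality of functions on the group is equality in HOL.
\<close>

definition smooth_Ind :: "((real^'n^'n) \<times> complex) set \<Rightarrow> (real^'n^'n \<Rightarrow> complex) set" where
  "smooth_Ind \<psi> =
     {f. smooth_on SL f \<and> (\<forall>g. g \<notin> SL \<longrightarrow> f g = 0) \<and>
         (\<forall>g\<in>SL. \<forall>(p, c)\<in>\<psi>. f (g ** p) = inverse c * f g)}"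

definition I_SL :: "bit \<times> bit \<Rightarrow> complex \<times> complex \<Rightarrow> (real^3^3 \<Rightarrow> complex) set" where
  "I_SL \<delta> u = smooth_Ind (char_SL3 \<delta> u)"

definition J_SL :: "bit \<Rightarrow> complex \<Rightarrow> (real^2^2 \<Rightarrow> complex) set" where
  "J_SL \<sigma> v = smooth_Ind (char_SL2 \<sigma> v)"

definition left_translate ::
  "real^'n^'n \<Rightarrow> (real^'n^'n \<Rightarrow> complex) \<Rightarrow> (real^'n^'n \<Rightarrow> complex)" where
  "left_translate h f = (\<lambda>x. f (matrix_inv h ** x))"

section \<open>Intertwining differential operators\<close>

text \<open>The derivative along the left-invariant vector field of a trace-free matrix \<open>X\<close>.\<close>

definition right_deriv ::
  "real^'n^'n \<Rightarrow> (real^'n^'n \<Rightarrow> complex) \<Rightarrow> (real^'n^'n \<Rightarrow> complex)" where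
  "right_deriv X f = (\<lambda>g. vector_derivative (\<lambda>t. f (g ** mat_exp (t *\<^sub>R X))) (at 0))"

text \<open>
  Sections of the line bundles over the two flag manifolds are equivariant functions on the two
  groups. An operator is differential with respect to the map induced by \<^const>\<open>iota3\<close> if locally
  in \<open>y\<close> the value \<open>D f y\<close> is a finite linear combination, with coefficients smooth in \<open>y\<close>, of
  iterated derivatives of \<open>f\<close> at \<open>iota3 y\<close>. Left-invariant vector fields form a global frame, so
  the derivatives can be taken along them; their projections span every tangent space of the
  flag manifold.
\<close>

definition differential_operator_on ::
  "(real^3^3 \<Rightarrow> complex) set \<Rightarrow> ((real^3^3 \<Rightarrow> complex) \<Rightarrow> (real^2^2 \<Rightarrow> complex)) \<Rightarrow> bool" where
  "differential_operator_on V D \<longleftrightarrow>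
     (\<forall>y0\<in>SL. \<exists>U (W :: (real^3^3) list set) a.
        open U \<and> y0 \<in> U \<and> finite W \<and> (\<forall>Xs\<in>W. \<forall>X\<in>set Xs. trace X = 0) \<and>
        (\<forall>Xs\<in>W. smooth_on (U \<inter> SL) (a Xs)) \<and>
        (\<forall>f\<in>V. \<forall>y\<in>U \<inter> SL. D f y = (\<Sum>Xs\<in>W. a Xs y * foldr right_deriv Xs f (iota3 y))))"

text \<open>Operators are set to zero outside their domain, so that distinct elements of the following
  set are distinct as operators on the principal series.\<close>

definition Diff_SL3 ::
  "bit \<times> bit \<Rightarrow> complex \<times> complex \<Rightarrow> bit \<Rightarrow> complex \<Rightarrow>
     ((real^3^3 \<Rightarrow> complex) \<Rightarrow> (real^2^2 \<Rightarrow> complex)) set" where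
  "Diff_SL3 \<delta> u \<sigma> v =
     {D. (\<forall>f. f \<notin> I_SL \<delta> u \<longrightarrow> D f = 0) \<and>
         (\<forall>f\<in>I_SL \<delta> u. D f \<in> J_SL \<sigma> v) \<and>
         (\<forall>f\<in>I_SL \<delta> u. \<forall>g\<in>I_SL \<delta> u. D (f + g) = D f + D g) \<and>
         (\<forall>c. \<forall>f\<in>I_SL \<delta> u. D (\<lambda>x. c * f x) = (\<lambda>y. c * D f y)) \<and>
         differential_operator_on (I_SL \<delta> u) D \<and>
         (\<forall>h\<in>SL. \<forall>f\<in>I_SL \<delta> u.
            D (left_translate (iota3 h) f) = left_translate h (D f))}"

section \<open>Complex dimension\<close>

interpretation op_space: vector_space
  "\<lambda>c (T :: ('a \<Rightarrow> complex) \<Rightarrow> ('b \<Rightarrow> complex)) f y. c * T f y"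
  by unfold_locales (auto simp: fun_eq_iff algebra_simps)

text \<open>Unlike \<^const>\<open>vector_space.dim\<close>, this is infinite for infinite-dimensional subspaces.\<close>

definition op_dim :: "(('a \<Rightarrow> complex) \<Rightarrow> ('b \<Rightarrow> complex)) set \<Rightarrow> enat" where
  "op_dim V = Sup {enat (card B) | B. B \<subseteq> V \<and> finite B \<and> op_space.independent B}"

section \<open>The support\<close>

definition Supp_SL3 :: "((bit \<times> bit) \<times> bit \<times> (complex \<times> complex) \<times> complex) set" where
  "Supp_SL3 =
     {(\<delta>, \<sigma>, u, v). \<exists>k::int. k \<le> 0 \<and> (fst u + snd u) - v = of_int k \<and>
        (fst \<delta> + snd \<delta>) + \<sigma> = of_int k}"

end

theory Submission
  imports Defs
begin

text \<open>
  By equivariance an intertwining operator is a functional on jets at the identity, and in the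
  coordinates \<open>lower3 x y z\<close> of the big cell the torus of \<open>SL(2)\<close> acts on \<open>x\<close>, \<open>y\<close>, \<open>z\<close> with weights
  1, 1, 2. Necessity: letting \<open>diag (1/r, 1, r)\<close> act on a function with nonzero image yields, up to a
  nonzero constant, \<open>\<bar>r\<bar>\<close> to the power \<open>v - (u1 + u2)\<close> times a sign for \<open>r < 0\<close>, and this function
  extends smoothly to \<open>r = 0\<close> because the action contracts the cell. So it is a power with exponent
  in the natural numbers, and the sign is the parity condition. Sufficiency: a combination of Taylor
  coefficients of weight \<open>j\<close> is invariant under the unipotent subgroup iff it annihilates the image of
  a first-order operator from weight \<open>j - 2\<close> to weight \<open>j\<close>. The monomials of weight \<open>j\<close> fall into
  \<open>j + 1\<close> chains that this operator respects, with one relation fewer than monomials on each chain,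
  so each chain carries a nonzero solution; disjointness of the chains gives independence.
\<close>

section \<open>Calculus of smooth functions\<close>

text \<open>At \<open>iota3 (diag2 s (1 / s))\<close> both numbers on which the inducing character
  depends, the upper left entry and the leading 2 by 2 minor, equal s; hence only u1 + u2 and
  \<delta>1 + \<delta>2 enter the answer. A differential operator may use arbitrary words in
  trace-free matrices, so necessity handles each word as a whole: it is applied on the product of
  the parameter line with an open set of matrices, where everything is smooth across r = 0. For
  existence only the words E21^a E31^c E32^b occur, which at the base point are partial derivatives
  in the cell coordinates. The first-order operator is - z (E + u1 + u2) + x y (y d/dy + u2) with E
  the Euler operator in x, y, z. Each summand is a monomial times an operator that is diagonal on
  monomials, whence the chains and the two-term relations. These are solvable whichever coefficients
  vanish, so no u is exceptional; where both coefficients of a relation vanish, the solution space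
  of the chain grows, so the count is a lower bound. Independence needs globally defined functions
  of prescribed parity, and polynomials on the cell do not extend by themselves: parity and growth
  have to be corrected.\<close>

lemma Ck_on_subset: "Ck_on k U f \<Longrightarrow> V \<subseteq> U \<Longrightarrow> Ck_on k V f"
  by (induction k arbitrary: f) (auto intro: continuous_on_subset)

lemma frechet_derivative_cong_open:
  assumes "open U" "x \<in> U" "\<And>y. y \<in> U \<Longrightarrow> f y = g y"
  shows "frechet_derivative f (at x) = frechet_derivative g (at x)"
proof -
  have "(f has_derivative D) (at x) = (g has_derivative D) (at x)" for D
    using assms by (metis has_derivative_transform_within_open)
  then show ?thesis unfolding frechet_derivative_def by simp
qed

lemma Ck_on_cong:
  assumes "open U" "\<And>x. x \<in> U \<Longrightarrow> f x = g x" "Ck_on k U f"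
  shows "Ck_on k U g"
  using assms(2,3)
proof (induction k arbitrary: f g)
  case 0
  then show ?case using continuous_on_cong by fastforce
next
  case (Suc k)
  have "g differentiable (at x)" if "x \<in> U" for x
    using Suc.prems that assms(1) unfolding differentiable_def
    by (metis Ck_on.simps(2) differentiable_def has_derivative_transform_within_open)
  moreover have "Ck_on k U (\<lambda>x. frechet_derivative g (at x) v)" for v
  proof (rule Suc.IH)
    show "Ck_on k U (\<lambda>x. frechet_derivative f (at x) v)" using Suc.prems by simp
    show "frechet_derivative f (at x) v = frechet_derivative g (at x) v" if "x \<in> U" for x
      using frechet_derivative_cong_open[OF assms(1) that] Suc.prems(1) by metis
  qed
  ultimately show ?case by simp
qed

lemma Ck_on_SucD: "Ck_on (Suc k) U f \<Longrightarrow> Ck_on k U f"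
proof (induction k arbitrary: f)
  case 0
  then show ?case
    by (auto intro!: continuous_at_imp_continuous_on differentiable_imp_continuous_within)
next
  case (Suc k)
  then show ?case by (metis Ck_on.simps(2))
qed

lemma Ck_on_SucI:
  assumes "open U" "\<And>x. x \<in> U \<Longrightarrow> (f has_derivative f' x) (at x)"
    "\<And>v. Ck_on k U (\<lambda>x. f' x v)"
  shows "Ck_on (Suc k) U f"
proof -
  have "f' x v = frechet_derivative f (at x) v" if "x \<in> U" for x v
    using frechet_derivative_at[OF assms(2)[OF that]] by simp
  then have "Ck_on k U (\<lambda>x. frechet_derivative f (at x) v)" for v
    using Ck_on_cong[OF assms(1) _ assms(3)[of v]] by simp
  then show ?thesis using assms(2) by (auto simp: differentiable_def)
qed

lemma Ck_on_SucE:
  assumes "Ck_on (Suc k) U f" "x \<in> U"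
  shows "(f has_derivative frechet_derivative f (at x)) (at x)"
  using assms by (simp add: frechet_derivative_works)

lemma Ck_on_local:
  assumes "\<And>x. x \<in> U \<Longrightarrow> \<exists>V. open V \<and> x \<in> V \<and> Ck_on k V f"
  shows "Ck_on k U f"
  using assms
proof (induction k arbitrary: f)
  case 0
  then show ?case
    by (simp, metis continuous_at_imp_continuous_on continuous_on_eq_continuous_at)
next
  case (Suc k)
  have "f differentiable (at x)" if "x \<in> U" for x
    using Suc.prems[OF that] by auto
  moreover have "Ck_on k U (\<lambda>x. frechet_derivative f (at x) v)" for v
    by (rule Suc.IH) (use Suc.prems in \<open>force\<close>)
  ultimately show ?case by simp
qed

lemma Ck_on_const: "Ck_on k U (\<lambda>x. c)"
proof (induction k arbitrary: c)
  case (Suc k)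
  have "frechet_derivative (\<lambda>x. c) (at x) = (\<lambda>_. 0)" for x :: 'a
    by (rule frechet_derivative_const)
  then show ?case using Suc by simp
qed simp

lemma Ck_on_linear:
  assumes "bounded_linear L"
  shows "Ck_on k U L"
proof (cases k)
  case 0
  then show ?thesis using assms by (simp add: linear_continuous_on)
next
  case (Suc k')
  have "frechet_derivative L (at x) = L" for x
    using assms bounded_linear_imp_has_derivative frechet_derivative_at by metis
  then show ?thesis
    using assms Suc bounded_linear_imp_differentiable by (auto simp: Ck_on_const)
qed

lemma Ck_on_add:
  assumes "open U" "Ck_on k U f" "Ck_on k U g"
  shows "Ck_on k U (\<lambda>x. f x + g x)"
  using assms(2,3)
proof (induction k arbitrary: f g)
  case 0
  then show ?case by (simp add: continuous_on_add)
next
  case (Suc k)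
  show ?case
  proof (rule Ck_on_SucI[OF assms(1)])
    show "((\<lambda>x. f x + g x) has_derivative
      (\<lambda>v. frechet_derivative f (at x) v + frechet_derivative g (at x) v)) (at x)" if "x \<in> U" for x
      by (intro has_derivative_add Ck_on_SucE[OF Suc.prems(1) that] Ck_on_SucE[OF Suc.prems(2) that])
    show "Ck_on k U (\<lambda>x. frechet_derivative f (at x) v + frechet_derivative g (at x) v)" for v
      using Suc by simp
  qed
qed

lemma Ck_on_bilinear:
  assumes "bounded_bilinear B" "open U" "Ck_on k U f" "Ck_on k U g"
  shows "Ck_on k U (\<lambda>x. B (f x) (g x))"
  using assms(3,4)
proof (induction k arbitrary: f g)
  case 0
  then show ?case using bounded_bilinear.continuous_on[OF assms(1)] by simp
next
  case (Suc k)
  show ?case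
  proof (rule Ck_on_SucI[OF assms(2)])
    show "((\<lambda>x. B (f x) (g x)) has_derivative
      (\<lambda>v. B (f x) (frechet_derivative g (at x) v) + B (frechet_derivative f (at x) v) (g x))) (at x)"
      if "x \<in> U" for x
      using bounded_bilinear.FDERIV[OF assms(1)] Ck_on_SucE[OF Suc.prems(1) that]
        Ck_on_SucE[OF Suc.prems(2) that] by blast
    show "Ck_on k U
      (\<lambda>x. B (f x) (frechet_derivative g (at x) v) + B (frechet_derivative f (at x) v) (g x))" for v
      using Suc.prems Suc.prems[THEN Ck_on_SucD] by (intro Ck_on_add[OF assms(2)] Suc.IH) auto
  qed
qed

lemma Ck_on_sum:
  assumes "open U" "finite A" "\<And>a. a \<in> A \<Longrightarrow> Ck_on k U (f a)"
  shows "Ck_on k U (\<lambda>x. \<Sum>a\<in>A. f a x)"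
  using assms(2,3)
  by (induction A rule: finite_induct) (auto simp: Ck_on_const intro: Ck_on_add[OF assms(1)])

lemma linear_Basis_expand:
  fixes L :: "'a::euclidean_space \<Rightarrow> 'b::real_normed_vector"
  assumes "linear L"
  shows "L v = (\<Sum>b\<in>Basis. (v \<bullet> b) *\<^sub>R L b)"
proof -
  have "L v = L (\<Sum>b\<in>Basis. (v \<bullet> b) *\<^sub>R b)" by (simp add: euclidean_representation)
  also have "\<dots> = (\<Sum>b\<in>Basis. (v \<bullet> b) *\<^sub>R L b)"
    using assms by (simp add: linear_sum linear_scale)
  finally show ?thesis .
qed

lemma Ck_on_compose:
  assumes "open U" "open V" "Ck_on k U f" "Ck_on k V g" "f ` U \<subseteq> V"
  shows "Ck_on k U (\<lambda>x. g (f x))"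
  using assms(3,4)
proof (induction k arbitrary: g)
  case 0
  then show ?case using assms(5) by (auto intro: continuous_on_compose2)
next
  case (Suc k)
  \<comment> \<open>The chain rule feeds a direction depending on x into the derivative of g, while
    \<open>Ck_on\<close> only controls fixed directions. Expansion in a basis turns this into a sum
    of products.\<close>
  let ?F = "\<lambda>x v. \<Sum>b\<in>Basis. (frechet_derivative f (at x) v \<bullet> b) *\<^sub>R frechet_derivative g (at (f x)) b"
  show ?case
  proof (rule Ck_on_SucI[OF assms(1)])
    show "((\<lambda>x. g (f x)) has_derivative ?F x) (at x)" if "x \<in> U" for x
    proof -
      have f: "(f has_derivative frechet_derivative f (at x)) (at x)"
        using Ck_on_SucE[OF Suc.prems(1) that] .
      have g: "(g has_derivative frechet_derivative g (at (f x))) (at (f x))"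
        using Ck_on_SucE[OF Suc.prems(2)] that assms(5) by blast
      have "?F x = (\<lambda>v. frechet_derivative g (at (f x)) (frechet_derivative f (at x) v))"
        by (rule ext) (rule linear_Basis_expand[OF has_derivative_linear[OF g], symmetric])
      then show ?thesis using has_derivative_compose[OF f g] by simp
    qed
    show "Ck_on k U (\<lambda>x. ?F x v)" for v
    proof (intro Ck_on_sum assms(1) Ck_on_bilinear[OF bounded_bilinear_scaleR] finite_Basis)
      fix b :: 'b
      have "Ck_on k U (\<lambda>x. frechet_derivative f (at x) v)" using Suc.prems by simp
      then show "Ck_on k U (\<lambda>x. frechet_derivative f (at x) v \<bullet> b)"
        by (rule Ck_on_bilinear[OF bounded_bilinear_inner assms(1) _ Ck_on_const])
      show "Ck_on k U (\<lambda>x. frechet_derivative g (at (f x)) b)"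
        using Suc.IH[of "\<lambda>y. frechet_derivative g (at y) b"] Suc.prems Ck_on_SucD by auto
    qed
  qed
qed

text \<open>Unlike \<open>smooth_on\<close>, this concerns the given function itself on an open set,
  so that its Frechet derivatives are meaningful.\<close>

definition C_inf :: "'a::euclidean_space set \<Rightarrow> ('a \<Rightarrow> 'b::real_normed_vector) \<Rightarrow> bool" where
  "C_inf U f \<longleftrightarrow> (\<forall>k. Ck_on k U f)"

lemma C_inf_subset: "C_inf U f \<Longrightarrow> V \<subseteq> U \<Longrightarrow> C_inf V f"
  by (auto simp: C_inf_def intro: Ck_on_subset)

lemma C_inf_cong: "open U \<Longrightarrow> (\<And>x. x \<in> U \<Longrightarrow> f x = g x) \<Longrightarrow> C_inf U f \<Longrightarrow> C_inf U g"
  using Ck_on_cong unfolding C_inf_def by metis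

lemma C_inf_local:
  "(\<And>x. x \<in> U \<Longrightarrow> \<exists>V. open V \<and> x \<in> V \<and> C_inf V f) \<Longrightarrow> C_inf U f"
  unfolding C_inf_def by (metis Ck_on_local)

lemma C_inf_const: "C_inf U (\<lambda>x. c)"
  by (simp add: C_inf_def Ck_on_const)

lemma C_inf_linear: "bounded_linear L \<Longrightarrow> C_inf U L"
  by (simp add: C_inf_def Ck_on_linear)

lemma C_inf_add: "open U \<Longrightarrow> C_inf U f \<Longrightarrow> C_inf U g \<Longrightarrow> C_inf U (\<lambda>x. f x + g x)"
  by (simp add: C_inf_def Ck_on_add)

lemma C_inf_sum:
  "open U \<Longrightarrow> finite A \<Longrightarrow> (\<And>a. a \<in> A \<Longrightarrow> C_inf U (f a)) \<Longrightarrow> C_inf U (\<lambda>x. \<Sum>a\<in>A. f a x)"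
  by (simp add: C_inf_def Ck_on_sum)

lemma C_inf_bilinear:
  "bounded_bilinear B \<Longrightarrow> open U \<Longrightarrow> C_inf U f \<Longrightarrow> C_inf U g \<Longrightarrow> C_inf U (\<lambda>x. B (f x) (g x))"
  by (simp add: C_inf_def Ck_on_bilinear)

lemmas C_inf_scaleR = C_inf_bilinear[OF bounded_bilinear_scaleR]
lemmas C_inf_inner = C_inf_bilinear[OF bounded_bilinear_inner]

lemma C_inf_mult:
  fixes f g :: "'a::euclidean_space \<Rightarrow> 'b::real_normed_algebra"
  shows "open U \<Longrightarrow> C_inf U f \<Longrightarrow> C_inf U g \<Longrightarrow> C_inf U (\<lambda>x. f x * g x)"
  by (rule C_inf_bilinear[OF bounded_bilinear_mult])

lemma C_inf_compose:
  "open U \<Longrightarrow> open V \<Longrightarrow> C_inf U f \<Longrightarrow> C_inf V g \<Longrightarrow> f ` U \<subseteq> V \<Longrightarrow> C_inf U (\<lambda>x. g (f x))"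
  unfolding C_inf_def using Ck_on_compose by metis

lemma C_inf_compose_linear:
  fixes L :: "'b::euclidean_space \<Rightarrow> 'c::real_normed_vector"
  assumes "bounded_linear L" "open U" "C_inf U f"
  shows "C_inf U (\<lambda>x. L (f x))"
  using C_inf_compose[OF assms(2) open_UNIV assms(3) C_inf_linear[OF assms(1)]] by simp

lemma C_inf_diff:
  fixes f g :: "'a::euclidean_space \<Rightarrow> 'b::euclidean_space"
  shows "open U \<Longrightarrow> C_inf U f \<Longrightarrow> C_inf U g \<Longrightarrow> C_inf U (\<lambda>x. f x - g x)"
  using C_inf_add[of U f "\<lambda>x. - g x"] C_inf_compose_linear[OF bounded_linear_minus[OF bounded_linear_ident], of U g]
  by simp

lemma C_inf_power:
  fixes f :: "'a::euclidean_space \<Rightarrow> 'b::real_normed_field"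
  shows "open U \<Longrightarrow> C_inf U f \<Longrightarrow> C_inf U (\<lambda>x. f x ^ n)"
  by (induction n) (auto simp: C_inf_const intro: C_inf_mult)

lemma C_inf_has_derivative:
  "C_inf U f \<Longrightarrow> x \<in> U \<Longrightarrow> (f has_derivative frechet_derivative f (at x)) (at x)"
  unfolding C_inf_def by (metis Ck_on_SucE)

lemma C_inf_frechet_derivative:
  "C_inf U f \<Longrightarrow> C_inf U (\<lambda>x. frechet_derivative f (at x) v)"
  unfolding C_inf_def by (metis Ck_on.simps(2))

lemma C_inf_continuous_on: "C_inf U f \<Longrightarrow> continuous_on U f"
  unfolding C_inf_def by (metis Ck_on.simps(1))

text \<open>Left-invariant fields have the direction g X at g, which varies with the point.\<close>

lemma C_inf_frechet_derivative_field:
  assumes "open U" "C_inf U f" "C_inf U w"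
  shows "C_inf U (\<lambda>x. frechet_derivative f (at x) (w x))"
proof (rule C_inf_cong[OF assms(1)])
  show "C_inf U (\<lambda>x. \<Sum>b\<in>Basis. (w x \<bullet> b) *\<^sub>R frechet_derivative f (at x) b)"
    by (intro C_inf_sum C_inf_scaleR C_inf_inner assms C_inf_const C_inf_frechet_derivative finite_Basis)
  show "(\<Sum>b\<in>Basis. (w x \<bullet> b) *\<^sub>R frechet_derivative f (at x) b) = frechet_derivative f (at x) (w x)"
    if "x \<in> U" for x
    by (rule linear_Basis_expand[OF has_derivative_linear[OF C_inf_has_derivative[OF assms(2) that]], symmetric])
qed

text \<open>Only meant for positive \<open>x\<close>.\<close>

definition cpow :: "complex \<Rightarrow> real \<Rightarrow> complex" where
  "cpow s x = exp (s * of_real (ln x))"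

lemma has_vector_derivative_cpow:
  assumes "x > 0"
  shows "(cpow s has_vector_derivative s * cpow (s - 1) x) (at x)"
proof -
  have "((\<lambda>x. s * complex_of_real (ln x)) has_vector_derivative s * of_real (1 / x)) (at x)"
    using assms by (auto intro!: derivative_eq_intros has_vector_derivative_of_real simp: field_simps)
  then have "((\<lambda>x. exp (s * complex_of_real (ln x))) has_vector_derivative
      (s * of_real (1 / x)) * exp (s * of_real (ln x))) (at x)"
    using field_vector_diff_chain_at[OF _ DERIV_exp] unfolding o_def by blast
  moreover have "(s * of_real (1 / x)) * exp (s * of_real (ln x)) = s * cpow (s - 1) x"
  proof -
    have "complex_of_real (1 / x) = exp (of_real (- ln x))"
      using assms by (simp add: exp_of_real exp_minus field_simps)
    then show ?thesis by (simp add: cpow_def exp_add[symmetric] algebra_simps del: of_real_divide)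
  qed
  ultimately show ?thesis unfolding cpow_def by (simp only:)
qed

lemma C_inf_cpow: "C_inf {0<..} (cpow s)"
proof -
  have "Ck_on k {0<..} (cpow s)" for k
  proof (induction k arbitrary: s)
    case 0
    then show ?case
      by (auto simp: cpow_def intro!: continuous_intros)
  next
    case (Suc k)
    show ?case
    proof (rule Ck_on_SucI)
      show "(cpow s has_derivative (\<lambda>v. v *\<^sub>R (s * cpow (s - 1) x))) (at x)" if "x \<in> {0<..}" for x
        using has_vector_derivative_cpow that unfolding has_vector_derivative_def by simp
      show "Ck_on k {0<..} (\<lambda>x. v *\<^sub>R (s * cpow (s - 1) x))" for v :: real
        by (intro Ck_on_bilinear[OF bounded_bilinear_scaleR] Ck_on_bilinear[OF bounded_bilinear_mult]
            Ck_on_const Suc.IH open_greaterThan)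
    qed simp
  qed
  then show ?thesis by (simp add: C_inf_def)
qed

lemma cpow_add: "cpow (s + t) x = cpow s x * cpow t x"
  by (simp add: cpow_def distrib_right exp_add)

lemma cpow_mult: "x > 0 \<Longrightarrow> y > 0 \<Longrightarrow> cpow s (x * y) = cpow s x * cpow s y"
  by (simp add: cpow_def ln_mult distrib_left exp_add)

lemma cpow_exp: "cpow s (exp t) = exp (s * of_real t)"
  by (simp add: cpow_def)

lemma cpow_nonzero [simp]: "cpow s x \<noteq> 0"
  by (simp add: cpow_def)

lemma cpow_1 [simp]: "cpow s 1 = 1"
  by (simp add: cpow_def)

lemma cpow_0 [simp]: "cpow 0 x = 1"
  by (simp add: cpow_def)

lemma cpow_minus: "cpow (- s) x = inverse (cpow s x)"
  by (simp add: cpow_def exp_minus)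

lemma cpow_of_nat: "x > 0 \<Longrightarrow> cpow (of_nat n) x = of_real x ^ n"
  by (simp add: cpow_def exp_of_nat_mult exp_of_real)

lemma C_inf_cpow_compose:
  "open U \<Longrightarrow> C_inf U f \<Longrightarrow> (\<And>x. x \<in> U \<Longrightarrow> f x > 0) \<Longrightarrow> C_inf U (\<lambda>x. cpow s (f x))"
  by (rule C_inf_compose[OF _ _ _ C_inf_cpow]) auto

lemma C_inf_divide:
  fixes f g :: "'a::euclidean_space \<Rightarrow> real"
  assumes "open U" "C_inf U f" "C_inf U g" "\<And>x. x \<in> U \<Longrightarrow> g x > 0"
  shows "C_inf U (\<lambda>x. f x / g x)"
proof (rule C_inf_cong[OF assms(1)])
  \<comment> \<open>The reciprocal of a positive function is the real part of its complex power with
    exponent -1.\<close>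
  show "C_inf U (\<lambda>x. f x * Re (cpow (-1) (g x)))"
    by (intro C_inf_mult C_inf_compose_linear[OF bounded_linear_Re] C_inf_cpow_compose assms)
  show "f x * Re (cpow (-1) (g x)) = f x / g x" if "x \<in> U" for x
    using assms(4)[OF that] cpow_minus[of 1 "g x"] cpow_of_nat[of "g x" 1]
    by (simp add: divide_inverse flip: of_real_inverse)
qed

section \<open>Directional derivatives\<close>

definition dird :: "'a::real_normed_vector \<Rightarrow> ('a \<Rightarrow> 'b::real_normed_vector) \<Rightarrow> 'a \<Rightarrow> 'b" where
  "dird v f = (\<lambda>x. frechet_derivative f (at x) v)"

lemma C_inf_dird: "C_inf U f \<Longrightarrow> C_inf U (dird v f)"
  unfolding dird_def by (rule C_inf_frechet_derivative)

lemma dird_eq: "(f has_derivative f') (at x) \<Longrightarrow> dird v f x = f' v"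
  unfolding dird_def using frechet_derivative_at by metis

lemma has_vector_derivative_along_line:
  assumes "C_inf UNIV f"
  shows "((\<lambda>t. f (x + t *\<^sub>R v)) has_vector_derivative dird v f (x + t *\<^sub>R v)) (at t)"
proof -
  have "((\<lambda>t. x + t *\<^sub>R v) has_derivative (\<lambda>s. s *\<^sub>R v)) (at t)"
    by (auto intro!: derivative_eq_intros)
  from has_derivative_compose[OF this C_inf_has_derivative[OF assms UNIV_I]]
  have "((\<lambda>t. f (x + t *\<^sub>R v)) has_derivative
      (\<lambda>s. frechet_derivative f (at (x + t *\<^sub>R v)) (s *\<^sub>R v))) (at t)" .
  moreover have "frechet_derivative f (at (x + t *\<^sub>R v)) (s *\<^sub>R v) = s *\<^sub>R dird v f (x + t *\<^sub>R v)" for s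
    unfolding dird_def
    by (simp add: linear_scale has_derivative_linear[OF C_inf_has_derivative[OF assms UNIV_I]])
  ultimately show ?thesis unfolding has_vector_derivative_def by simp
qed

text \<open>Two applications of the mean value theorem, first along v, then along w. The left side
  is symmetric in v and w, which yields the symmetry of second derivatives.\<close>

lemma second_difference_mean_value:
  fixes f :: "'a::euclidean_space \<Rightarrow> real"
  assumes f: "C_inf UNIV f" and h: "h > 0"
  shows "\<exists>s t. 0 \<le> s \<and> s \<le> h \<and> 0 \<le> t \<and> t \<le> h \<and>
    f (x + h *\<^sub>R v + h *\<^sub>R w) - f (x + h *\<^sub>R v) - f (x + h *\<^sub>R w) + f x
      = h * h * dird w (dird v f) (x + s *\<^sub>R v + t *\<^sub>R w)"
proof -
  have D: "((\<lambda>s. g (y + s *\<^sub>R z)) has_field_derivative dird z g (y + s *\<^sub>R z)) (at s)"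
    if "C_inf UNIV g" for g :: "'a \<Rightarrow> real" and y z s
    using has_vector_derivative_along_line[OF that]
    by (simp add: has_real_derivative_iff_has_vector_derivative)
  let ?k = "\<lambda>s. f ((x + h *\<^sub>R w) + s *\<^sub>R v) - f (x + s *\<^sub>R v)"
  have "\<exists>s>0. s < h \<and> ?k h - ?k 0 = (h - 0) *
      (dird v f ((x + h *\<^sub>R w) + s *\<^sub>R v) - dird v f (x + s *\<^sub>R v))"
    by (rule MVT2[OF h]) (intro DERIV_diff D f)
  then obtain s where s: "0 < s" "s < h" "?k h - ?k 0 = h *
      (dird v f ((x + h *\<^sub>R w) + s *\<^sub>R v) - dird v f (x + s *\<^sub>R v))"
    by auto
  let ?l = "\<lambda>t. dird v f ((x + s *\<^sub>R v) + t *\<^sub>R w)"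
  have "\<exists>t>0. t < h \<and> ?l h - ?l 0 = (h - 0) * dird w (dird v f) ((x + s *\<^sub>R v) + t *\<^sub>R w)"
    by (rule MVT2[OF h]) (intro D C_inf_dird f)
  then obtain t where t: "0 < t" "t < h"
    "?l h - ?l 0 = h * dird w (dird v f) ((x + s *\<^sub>R v) + t *\<^sub>R w)"
    by auto
  have "?l h - ?l 0 = dird v f ((x + h *\<^sub>R w) + s *\<^sub>R v) - dird v f (x + s *\<^sub>R v)"
    by (simp add: algebra_simps)
  then have "?k h - ?k 0 = h * h * dird w (dird v f) (x + s *\<^sub>R v + t *\<^sub>R w)"
    using s(3) t(3) by simp
  then show ?thesis using s t by (intro exI[of _ s] exI[of _ t]) (simp add: algebra_simps)
qed

lemma dird_commute_real:
  fixes f :: "'a::euclidean_space \<Rightarrow> real"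
  assumes f: "C_inf UNIV f"
  shows "dird v (dird w f) x = dird w (dird v f) x"
proof -
  define h where "h n = inverse (real (Suc n))" for n
  have h0: "h n > 0" for n by (simp add: h_def)
  have hlim: "h \<longlonglongrightarrow> 0" unfolding h_def by (rule LIMSEQ_inverse_real_of_nat)
  have lim: "(\<lambda>n. dird w (dird v f) (x + s n *\<^sub>R v + t n *\<^sub>R w)) \<longlonglongrightarrow> dird w (dird v f) x"
    if "\<And>n. 0 \<le> s n" "\<And>n. s n \<le> h n" "\<And>n. 0 \<le> t n" "\<And>n. t n \<le> h n" for v w s t
  proof -
    have "s \<longlonglongrightarrow> 0" "t \<longlonglongrightarrow> 0"
      using that by (auto intro: tendsto_sandwich[OF _ _ tendsto_const hlim])
    then have "(\<lambda>n. x + s n *\<^sub>R v + t n *\<^sub>R w) \<longlonglongrightarrow> x + 0 *\<^sub>R v + 0 *\<^sub>R w"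
      by (intro tendsto_intros)
    moreover have "isCont (dird w (dird v f)) x"
      using C_inf_continuous_on[OF C_inf_dird[OF C_inf_dird[OF f]], of w v]
      by (simp add: continuous_on_eq_continuous_at)
    ultimately show ?thesis using isCont_tendsto_compose by fastforce
  qed
  obtain s t where st: "\<And>n. 0 \<le> s n" "\<And>n. s n \<le> h n" "\<And>n. 0 \<le> t n" "\<And>n. t n \<le> h n"
    "\<And>n. f (x + h n *\<^sub>R v + h n *\<^sub>R w) - f (x + h n *\<^sub>R v) - f (x + h n *\<^sub>R w) + f x
      = h n * h n * dird w (dird v f) (x + s n *\<^sub>R v + t n *\<^sub>R w)"
    using second_difference_mean_value[OF f h0, where x = x and v = v and w = w] by metis
  obtain s' t' where st': "\<And>n. 0 \<le> s' n" "\<And>n. s' n \<le> h n" "\<And>n. 0 \<le> t' n" "\<And>n. t' n \<le> h n"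
    "\<And>n. f (x + h n *\<^sub>R w + h n *\<^sub>R v) - f (x + h n *\<^sub>R w) - f (x + h n *\<^sub>R v) + f x
      = h n * h n * dird v (dird w f) (x + s' n *\<^sub>R w + t' n *\<^sub>R v)"
    using second_difference_mean_value[OF f h0, where x = x and v = w and w = v] by metis
  \<comment> \<open>Both sides represent the same second difference divided by h^2; by continuity
    they tend to the two mixed derivatives at x.\<close>
  have eq: "dird w (dird v f) (x + s n *\<^sub>R v + t n *\<^sub>R w) = dird v (dird w f) (x + s' n *\<^sub>R w + t' n *\<^sub>R v)" for n
  proof -
    have "h n * h n * dird w (dird v f) (x + s n *\<^sub>R v + t n *\<^sub>R w)
        = h n * h n * dird v (dird w f) (x + s' n *\<^sub>R w + t' n *\<^sub>R v)"
      unfolding st(5)[symmetric] st'(5)[symmetric] by (simp add: algebra_simps)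
    then show ?thesis using h0[of n] by simp
  qed
  have "(\<lambda>n. dird w (dird v f) (x + s n *\<^sub>R v + t n *\<^sub>R w)) \<longlonglongrightarrow> dird w (dird v f) x"
    by (rule lim[OF st(1-4)])
  moreover have "(\<lambda>n. dird w (dird v f) (x + s n *\<^sub>R v + t n *\<^sub>R w)) \<longlonglongrightarrow> dird v (dird w f) x"
    unfolding eq by (rule lim[OF st'(1-4)])
  ultimately show ?thesis by (rule LIMSEQ_unique[symmetric])
qed

text \<open>Reduces vector values to real ones, for which the mean value theorem holds.\<close>

lemma dird_inner:
  assumes "C_inf UNIV f"
  shows "dird v (\<lambda>x. f x \<bullet> b) x = dird v f x \<bullet> b"
  using dird_eq[OF has_derivative_inner_left[OF C_inf_has_derivative[OF assms UNIV_I]]]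
  by (simp add: dird_def)

lemma dird_commute:
  fixes f :: "'a::euclidean_space \<Rightarrow> 'b::euclidean_space"
  assumes f: "C_inf UNIV f"
  shows "dird v (dird w f) = dird w (dird v f)"
proof (rule ext, rule euclidean_eqI)
  fix x and b :: 'b
  have c: "C_inf UNIV (\<lambda>x. f x \<bullet> b)" by (intro C_inf_inner f C_inf_const open_UNIV)
  have "dird v (dird w f) x \<bullet> b = dird v (dird w (\<lambda>x. f x \<bullet> b)) x" for v w
    unfolding dird_inner[OF f, of w b, abs_def] dird_inner[OF C_inf_dird[OF f]] ..
  then show "dird v (dird w f) x \<bullet> b = dird w (dird v f) x \<bullet> b"
    using dird_commute_real[OF c] by simp
qed

section \<open>The matrix exponential and left-invariant derivatives\<close>

lemma matrix_mult_scaleR_right: "A ** (k *\<^sub>R B) = k *\<^sub>R (A ** B)"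
  and matrix_mult_scaleR_left: "(k *\<^sub>R A) ** B = k *\<^sub>R (A ** B)"
  for A :: "real^'n^'m" and B :: "real^'p^'n"
  by (simp_all add: matrix_scalar_ac scalar_matrix_assoc)

definition mat_pow :: "real^'n^'n \<Rightarrow> nat \<Rightarrow> real^'n^'n" where
  "mat_pow X k = ((**) X ^^ k) (mat 1)"

lemma mat_pow_0 [simp]: "mat_pow X 0 = mat 1"
  and mat_pow_Suc [simp]: "mat_pow X (Suc k) = X ** mat_pow X k"
  by (simp_all add: mat_pow_def)

text \<open>A bound independent of the row closes the induction and majorizes every entry by an
  exponential series.\<close>

lemma mat_pow_entry_bound:
  "\<bar>mat_pow X k $ i $ j\<bar> \<le> (\<Sum>i\<in>UNIV. \<Sum>l\<in>UNIV. \<bar>X $ i $ l\<bar>) ^ k"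
proof (induction k arbitrary: i)
  case 0
  then show ?case by (simp add: mat_def)
next
  case (Suc k)
  let ?C = "\<Sum>i\<in>UNIV. \<Sum>l\<in>UNIV. \<bar>X $ i $ l\<bar>"
  have "\<bar>mat_pow X (Suc k) $ i $ j\<bar> \<le> (\<Sum>l\<in>UNIV. \<bar>X $ i $ l\<bar> * \<bar>mat_pow X k $ l $ j\<bar>)"
    unfolding mat_pow_Suc matrix_matrix_mult_def
    by (simp add: abs_mult[symmetric])
  also have "\<dots> \<le> (\<Sum>l\<in>UNIV. \<bar>X $ i $ l\<bar> * ?C ^ k)"
    by (intro sum_mono mult_left_mono Suc.IH) auto
  also have "\<dots> = (\<Sum>l\<in>UNIV. \<bar>X $ i $ l\<bar>) * ?C ^ k"
    by (simp add: sum_distrib_right)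
  also have "\<dots> \<le> ?C * ?C ^ k"
  proof (rule mult_right_mono)
    show "(\<Sum>l\<in>UNIV. \<bar>X $ i $ l\<bar>) \<le> ?C"
      by (rule member_le_sum[of i UNIV "\<lambda>i. \<Sum>l\<in>UNIV. \<bar>X $ i $ l\<bar>"]) (auto intro: sum_nonneg)
  qed (auto intro!: zero_le_power sum_nonneg)
  finally show ?case by simp
qed

lemma mat_pow_scaleR: "mat_pow (t *\<^sub>R X) k = t ^ k *\<^sub>R mat_pow X k"
  by (induction k) (auto simp: matrix_mult_scaleR_right matrix_mult_scaleR_left mult.commute)

lemma summable_mat_exp_entry: "summable (\<lambda>k. (mat_pow X k $ i $ j / fact k) * (t::real) ^ k)"
proof (rule summable_comparison_test')
  let ?C = "\<Sum>i\<in>UNIV. \<Sum>l\<in>UNIV. \<bar>X $ i $ l\<bar>"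
  show "summable (\<lambda>k. inverse (fact k) * (?C * \<bar>t\<bar>) ^ k)" by (rule summable_exp)
  show "norm ((mat_pow X k $ i $ j / fact k) * t ^ k) \<le> inverse (fact k) * (?C * \<bar>t\<bar>) ^ k" for k
    using mult_right_mono[OF mat_pow_entry_bound[of X k i j], of "\<bar>t\<bar> ^ k / fact k"]
    by (simp add: abs_mult power_abs power_mult_distrib field_simps)
qed

text \<open>Makes each entry a scalar power series in t, which may be differentiated
  termwise.\<close>

lemma mat_exp_entry: "mat_exp (t *\<^sub>R X) $ i $ j = (\<Sum>k. (mat_pow X k $ i $ j / fact k) * t ^ k)"
proof -
  let ?S = "\<chi> i j. \<Sum>k. (mat_pow X k $ i $ j / fact k) * t ^ k"
  have "(\<lambda>k. (1 / fact k) *\<^sub>R mat_pow (t *\<^sub>R X) k) sums ?S"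
    unfolding sums_def
  proof (rule vec_tendstoI, rule vec_tendstoI)
    fix i j
    have "(\<lambda>n. \<Sum>k<n. (mat_pow X k $ i $ j / fact k) * t ^ k) \<longlonglongrightarrow> ?S $ i $ j"
      using summable_LIMSEQ[OF summable_mat_exp_entry[of X i j t]] by simp
    then show "(\<lambda>n. (\<Sum>k<n. (1 / fact k) *\<^sub>R mat_pow (t *\<^sub>R X) k) $ i $ j) \<longlonglongrightarrow> ?S $ i $ j"
      by (simp add: mat_pow_scaleR mult.commute)
  qed
  then have "mat_exp (t *\<^sub>R X) = ?S"
    unfolding mat_exp_def mat_pow_def by (rule sums_unique[symmetric])
  then show ?thesis by simp
qed

lemma mat_exp_square_zero:
  fixes X :: "real^'n^'n"
  assumes "X ** X = 0"
  shows "mat_exp X = mat 1 + X"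
proof -
  have z: "mat_pow X k = 0" if "k \<ge> 2" for k
  proof -
    obtain l where "k = Suc (Suc l)" using \<open>k \<ge> 2\<close> by (metis add_2_eq_Suc le_Suc_ex)
    then show ?thesis using assms by (simp add: matrix_mul_assoc)
  qed
  have "mat_exp X = (\<Sum>k\<in>{0,1}. (1 / fact k) *\<^sub>R mat_pow X k)"
    unfolding mat_exp_def mat_pow_def[symmetric]
    by (rule suminf_finite) (auto simp: z)
  then show ?thesis by simp
qed

lemma mat_exp_zero [simp]: "mat_exp 0 = (mat 1 :: real^'n^'n)"
  using mat_exp_square_zero[of "0 :: real^'n^'n"] by (simp add: matrix_matrix_mult_def zero_vec_def)

lemma DERIV_mat_exp_entry:
  "((\<lambda>t. mat_exp (t *\<^sub>R X) $ i $ j) has_field_derivative (X ** mat_exp (t *\<^sub>R X)) $ i $ j) (at t)"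
proof -
  let ?c = "\<lambda>i k. mat_pow X k $ i $ j / fact k"
  have "diffs (?c i) n * t ^ n = (\<Sum>l\<in>UNIV. X $ i $ l * (?c l n * t ^ n))" for n
  proof -
    have "diffs (?c i) n = mat_pow X (Suc n) $ i $ j / fact n"
      unfolding diffs_def by (simp del: mat_pow_Suc of_nat_Suc add: fact_Suc)
    then show ?thesis
      by (simp add: matrix_matrix_mult_def sum_distrib_right sum_divide_distrib mult.assoc)
  qed
  then have "(\<Sum>n. diffs (?c i) n * t ^ n) = (\<Sum>l\<in>UNIV. \<Sum>n. X $ i $ l * (?c l n * t ^ n))"
    by (simp only:) (rule suminf_sum, rule summable_mult[OF summable_mat_exp_entry])
  also have "\<dots> = (X ** mat_exp (t *\<^sub>R X)) $ i $ j"
    unfolding suminf_mult[OF summable_mat_exp_entry] by (simp add: matrix_matrix_mult_def mat_exp_entry)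
  finally show ?thesis
    using termdiffs_strong_converges_everywhere[OF summable_mat_exp_entry, of X i j t]
    by (simp add: mat_exp_entry)
qed

lemma has_vector_derivative_mat_exp:
  fixes X :: "real^'n^'n"
  shows "((\<lambda>t. mat_exp (t *\<^sub>R X)) has_vector_derivative X ** mat_exp (t *\<^sub>R X)) (at t)"
  unfolding has_vector_derivative_def
proof (subst has_derivative_componentwise_within, rule ballI)
  fix b :: "real^'n^'n" assume "b \<in> Basis"
  then obtain i j where b: "b = axis i (axis j 1)" by (auto simp: Basis_vec_def)
  show "((\<lambda>t. mat_exp (t *\<^sub>R X) \<bullet> b) has_derivative (\<lambda>s. (s *\<^sub>R (X ** mat_exp (t *\<^sub>R X))) \<bullet> b)) (at t)"
    using DERIV_mat_exp_entry[of X i j t] unfolding b has_field_derivative_def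
    by (simp add: inner_axis mult.commute[of _ "(X ** mat_exp (t *\<^sub>R X)) $ i $ j"])
qed

text \<open>Jacobi's formula, checked by expanding the 3 by 3 determinant: det (exp (t X)) has
  logarithmic derivative trace X = 0, so it keeps its value 1 at t = 0.\<close>

lemma mat_exp_in_SL:
  fixes X :: "real^3^3"
  assumes "trace X = 0"
  shows "mat_exp (t *\<^sub>R X) \<in> SL"
proof -
  let ?E = "\<lambda>t. mat_exp (t *\<^sub>R X)"
  have "((\<lambda>t. det (?E t)) has_field_derivative trace X * det (?E t)) (at t)" for t
    unfolding det_3 trace_def
    by (rule derivative_eq_intros DERIV_mat_exp_entry refl)+
      (simp add: matrix_matrix_mult_def sum_3, algebra)
  then have "det (?E t) = det (?E 0)"
    using assms by (intro DERIV_isconst_all) auto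
  then show ?thesis by (simp add: SL_def)
qed

section \<open>Left-invariant derivatives on the special linear group\<close>

lemma SL_mult: "g \<in> SL \<Longrightarrow> h \<in> SL \<Longrightarrow> g ** h \<in> SL"
  by (simp add: SL_def det_mul)

lemma SL_invertible: "g \<in> SL \<Longrightarrow> invertible g"
  by (simp add: SL_def invertible_det_nz)

lemma SL_matrix_inv:
  fixes g :: "real^'n^'n"
  assumes "g \<in> SL"
  shows "matrix_inv g \<in> SL" "g ** matrix_inv g = mat 1" "matrix_inv g ** g = mat 1"
proof -
  have "\<exists>h. g ** h = mat 1 \<and> h ** g = mat 1"
    using assms by (metis SL_invertible invertible_def)
  then have "g ** matrix_inv g = mat 1 \<and> matrix_inv g ** g = mat 1"
    unfolding matrix_inv_def by (rule someI_ex)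
  then show "g ** matrix_inv g = mat 1" "matrix_inv g ** g = mat 1" by auto
  then have "det g * det (matrix_inv g) = 1" by (metis det_I det_mul)
  then show "matrix_inv g \<in> SL" using assms by (simp add: SL_def)
qed

lemma bounded_linear_matrix_mult: "bounded_linear ((**) g)"
  for g :: "real^'n^'n"
  by (simp add: linear_conv_bounded_linear[symmetric] linear_iff matrix_add_ldistrib
      matrix_mult_scaleR_right)

text \<open>The curve g exp (t X) stays in the group, so any differentiable extension \<Phi> from
  the group to a neighbourhood computes the derivative.\<close>

lemma right_deriv_eq:
  fixes \<psi> :: "real^3^3 \<Rightarrow> complex"
  assumes X: "trace X = 0" and U: "open U" and g: "g \<in> U" "g \<in> SL"
    and \<Phi>: "(\<Phi> has_derivative \<Phi>') (at g)" and eq: "\<And>y. y \<in> U \<Longrightarrow> y \<in> SL \<Longrightarrow> \<psi> y = \<Phi> y"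
  shows "right_deriv X \<psi> g = \<Phi>' (g ** X)"
proof -
  let ?p = "\<lambda>t. g ** mat_exp (t *\<^sub>R X)"
  have p: "(?p has_derivative (\<lambda>s. s *\<^sub>R (g ** X))) (at 0)"
    using bounded_linear.has_derivative[OF bounded_linear_matrix_mult
        has_vector_derivative_mat_exp[of X 0, unfolded has_vector_derivative_def], of g]
    by (simp add: matrix_mult_scaleR_right)
  have "\<forall>\<^sub>F t in at 0. ?p t \<in> U"
    using has_derivative_continuous[OF p] topological_tendstoD[of ?p _ "at 0" U] U g(1)
    by (auto simp: isCont_def)
  then have "\<forall>\<^sub>F t in nhds 0. ?p t \<in> U"
    using g(1) by (auto simp: eventually_nhds_conv_at)
  then have ev: "\<forall>\<^sub>F t in nhds 0. \<Phi> (?p t) = \<psi> (?p t)"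
    by eventually_elim (simp add: eq SL_mult g mat_exp_in_SL X)
  have "((\<lambda>t. \<Phi> (?p t)) has_derivative (\<lambda>s. \<Phi>' (s *\<^sub>R (g ** X)))) (at 0)"
    using has_derivative_compose[OF p, of \<Phi> \<Phi>'] \<Phi> by simp
  then have "((\<lambda>t. \<Phi> (?p t)) has_vector_derivative \<Phi>' (g ** X)) (at 0)"
    unfolding has_vector_derivative_def using linear_scale[OF has_derivative_linear[OF \<Phi>]] by simp
  then have "((\<lambda>t. \<psi> (?p t)) has_vector_derivative \<Phi>' (g ** X)) (at 0)"
    unfolding has_vector_derivative_def
    by (rule has_derivative_transform_eventually) (use ev in \<open>auto simp: eventually_nhds_conv_at\<close>)
  then show ?thesis unfolding right_deriv_def by (rule vector_derivative_at)
qed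

section \<open>Closure properties of smoothness on subsets\<close>

lemma C_inf_vec:
  fixes F :: "'a::euclidean_space \<Rightarrow> 'b::euclidean_space^'n"
  assumes "open U" "\<And>i. C_inf U (\<lambda>x. F x $ i)"
  shows "C_inf U F"
proof (rule C_inf_cong[OF assms(1)])
  show "C_inf U (\<lambda>x. \<Sum>b\<in>Basis. (F x \<bullet> b) *\<^sub>R b)"
  proof (intro C_inf_sum C_inf_scaleR C_inf_const assms(1) finite_Basis)
    fix b :: "'b^'n" assume "b \<in> Basis"
    then obtain i c where b: "b = axis i c" by (auto simp: Basis_vec_def)
    show "C_inf U (\<lambda>x. F x \<bullet> b)"
      unfolding b inner_axis by (intro C_inf_inner C_inf_const assms)
  qed
  show "(\<Sum>b\<in>Basis. (F x \<bullet> b) *\<^sub>R b) = F x" for x by (rule euclidean_representation)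
qed

lemma C_inf_nth: "open U \<Longrightarrow> C_inf U F \<Longrightarrow> C_inf U (\<lambda>x. F x $ i)"
  for F :: "'a::euclidean_space \<Rightarrow> 'b::euclidean_space^'n"
  by (rule C_inf_compose_linear[OF bounded_linear_vec_nth])

lemma smooth_on_of_C_inf:
  "open U \<Longrightarrow> C_inf U F \<Longrightarrow> S \<subseteq> U \<Longrightarrow> (\<And>x. x \<in> S \<Longrightarrow> F x = f x) \<Longrightarrow> smooth_on S f"
  unfolding smooth_on_def C_inf_def by blast

lemma smooth_onE:
  assumes "smooth_on S f" "x \<in> S"
  obtains U F where "open U" "x \<in> U" "C_inf U F" "\<And>y. y \<in> U \<Longrightarrow> y \<in> S \<Longrightarrow> F y = f y"
proof -
  obtain U F where "open U" "x \<in> U" "\<forall>k. Ck_on k U F" "\<forall>y\<in>U \<inter> S. F y = f y"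
    using assms unfolding smooth_on_def by meson
  then show thesis using that[of U F] by (simp add: C_inf_def)
qed

lemma smooth_onI:
  assumes "\<And>x. x \<in> S \<Longrightarrow> \<exists>U F. open U \<and> x \<in> U \<and> C_inf U F \<and> (\<forall>y\<in>U \<inter> S. F y = f y)"
  shows "smooth_on S f"
  unfolding smooth_on_def using assms[unfolded C_inf_def] by simp

text \<open>A smooth parametrization of points of S by an open set turns smoothness by local
  extensions into ordinary smoothness.\<close>

lemma C_inf_smooth_on_compose:
  assumes f: "smooth_on S f" and U: "open U" and p: "C_inf U p" "p ` U \<subseteq> S"
  shows "C_inf U (\<lambda>x. f (p x))"
proof (rule C_inf_local)
  fix x assume x: "x \<in> U"
  then obtain V F where V: "open V" "p x \<in> V" "C_inf V F" "\<And>y. y \<in> V \<Longrightarrow> y \<in> S \<Longrightarrow> F y = f y"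
    using smooth_onE[OF f, of "p x"] p(2) by blast
  have o: "open (U \<inter> p -` V)"
    using continuous_open_preimage[OF C_inf_continuous_on[OF p(1)] U V(1)] .
  have "C_inf (U \<inter> p -` V) (\<lambda>x. f (p x))"
  proof (rule C_inf_cong[OF o])
    show "C_inf (U \<inter> p -` V) (\<lambda>x. F (p x))"
      by (rule C_inf_compose[OF o V(1) C_inf_subset[OF p(1)] V(3)]) auto
  qed (use V p in auto)
  then show "\<exists>V. open V \<and> x \<in> V \<and> C_inf V (\<lambda>x. f (p x))"
    using o x V(2) by blast
qed

lemma smooth_on_compose:
  assumes f: "smooth_on S f" and p: "C_inf UNIV p" "p ` T \<subseteq> S"
  shows "smooth_on T (\<lambda>x. f (p x))"
proof (rule smooth_onI)
  fix x assume x: "x \<in> T"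
  then obtain V F where V: "open V" "p x \<in> V" "C_inf V F" "\<And>y. y \<in> V \<Longrightarrow> y \<in> S \<Longrightarrow> F y = f y"
    using smooth_onE[OF f, of "p x"] p(2) by blast
  have o: "open (p -` V)"
    using continuous_open_preimage[OF C_inf_continuous_on[OF p(1)] open_UNIV V(1)] by simp
  have "C_inf (p -` V) (\<lambda>x. F (p x))"
    by (rule C_inf_compose[OF o V(1) C_inf_subset[OF p(1)] V(3)]) auto
  then show "\<exists>U F. open U \<and> x \<in> U \<and> C_inf U F \<and> (\<forall>y\<in>U \<inter> T. F y = f (p y))"
    using o V p(2) x by (intro exI[of _ "p -` V"] exI[of _ "\<lambda>x. F (p x)"]) auto
qed

lemma smooth_on_const: "smooth_on S (\<lambda>x. c)"
  by (rule smooth_on_of_C_inf[OF open_UNIV C_inf_const]) auto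

lemma smooth_on_add:
  assumes f: "smooth_on S f" and g: "smooth_on S g"
  shows "smooth_on S (\<lambda>x. f x + g x)"
proof (rule smooth_onI)
  fix x assume x: "x \<in> S"
  obtain U F where U: "open U" "x \<in> U" "C_inf U F" "\<And>y. y \<in> U \<Longrightarrow> y \<in> S \<Longrightarrow> F y = f y"
    using smooth_onE[OF f x] by blast
  obtain V G where V: "open V" "x \<in> V" "C_inf V G" "\<And>y. y \<in> V \<Longrightarrow> y \<in> S \<Longrightarrow> G y = g y"
    using smooth_onE[OF g x] by blast
  have "C_inf (U \<inter> V) (\<lambda>x. F x + G x)"
    using U V by (intro C_inf_add) (auto intro: C_inf_subset)
  then show "\<exists>U F. open U \<and> x \<in> U \<and> C_inf U F \<and> (\<forall>y\<in>U \<inter> S. F y = f y + g y)"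
    using U V by (intro exI[of _ "U \<inter> V"] exI[of _ "\<lambda>x. F x + G x"]) auto
qed

lemma smooth_on_mult_const:
  fixes f :: "'a::euclidean_space \<Rightarrow> complex"
  assumes f: "smooth_on S f"
  shows "smooth_on S (\<lambda>x. c * f x)"
proof (rule smooth_onI)
  fix x assume x: "x \<in> S"
  obtain U F where U: "open U" "x \<in> U" "C_inf U F" "\<And>y. y \<in> U \<Longrightarrow> y \<in> S \<Longrightarrow> F y = f y"
    using smooth_onE[OF f x] by blast
  then show "\<exists>U F. open U \<and> x \<in> U \<and> C_inf U F \<and> (\<forall>y\<in>U \<inter> S. F y = c * f y)"
    by (intro exI[of _ U] exI[of _ "\<lambda>x. c * F x"]) (auto intro: C_inf_mult C_inf_const)
qed

lemma smooth_on_sum: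
  "finite A \<Longrightarrow> (\<And>a. a \<in> A \<Longrightarrow> smooth_on S (f a)) \<Longrightarrow> smooth_on S (\<lambda>x. \<Sum>a\<in>A. f a x)"
  by (induction A rule: finite_induct) (auto intro: smooth_on_const smooth_on_add)

lemma matrix_mult_entry: "(A ** B) $ i $ j = (\<Sum>k\<in>UNIV. A $ i $ k * B $ k $ j)"
  by (simp add: matrix_matrix_mult_def)

lemma C_inf_matrix_mult:
  fixes F :: "'a::euclidean_space \<Rightarrow> real^'n^'n"
  assumes "open U" "C_inf U F" "C_inf U G"
  shows "C_inf U (\<lambda>x. F x ** G x)"
proof (intro C_inf_vec assms(1))
  fix i j
  show "C_inf U (\<lambda>x. (F x ** G x) $ i $ j)"
    unfolding matrix_mult_entry by (intro C_inf_sum C_inf_mult C_inf_nth assms finite)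
qed

lemma C_inf_ident: "C_inf U (\<lambda>x. x)"
  by (rule C_inf_linear[OF bounded_linear_ident])

lemma smooth_on_right_deriv:
  fixes f :: "real^3^3 \<Rightarrow> complex"
  assumes f: "smooth_on SL f" and X: "trace X = 0"
  shows "smooth_on SL (right_deriv X f)"
proof (rule smooth_onI)
  fix g :: "real^3^3" assume g: "g \<in> SL"
  obtain U F where U: "open U" "g \<in> U" "C_inf U F" "\<And>y. y \<in> U \<Longrightarrow> y \<in> SL \<Longrightarrow> F y = f y"
    using smooth_onE[OF f g] by blast
  have "C_inf U (\<lambda>x. frechet_derivative F (at x) (x ** X))"
    by (intro C_inf_frechet_derivative_field C_inf_matrix_mult C_inf_ident C_inf_const U)
  moreover have "\<forall>y\<in>U \<inter> SL. frechet_derivative F (at y) (y ** X) = right_deriv X f y"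
    using right_deriv_eq[OF X U(1) _ _ C_inf_has_derivative[OF U(3)]] U(4) by auto
  ultimately show "\<exists>U F. open U \<and> g \<in> U \<and> C_inf U F \<and> (\<forall>y\<in>U \<inter> SL. F y = right_deriv X f y)"
    using U by blast
qed

lemma smooth_on_foldr_right_deriv:
  fixes f :: "real^3^3 \<Rightarrow> complex"
  shows "smooth_on SL f \<Longrightarrow> \<forall>X\<in>set Xs. trace X = 0 \<Longrightarrow> smooth_on SL (foldr right_deriv Xs f)"
  by (induction Xs) (auto intro: smooth_on_right_deriv)

section \<open>Principal series on the big cell\<close>

definition lower3 :: "real \<Rightarrow> real \<Rightarrow> real \<Rightarrow> real^3^3" where
  "lower3 x y z = vector [vector [1, 0, 0], vector [x, 1, 0], vector [z, y, 1]]"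

text \<open>The 2 by 2 minors of the first two columns, named by their rows. Right multiplication by
  an upper triangular p scales the first column by \<open>p $ 1 $ 1\<close> and all three minors by
  \<open>minor12 p\<close>. So column and minors are homogeneous coordinates on the flag
  manifold.\<close>

definition minor12 :: "real^3^3 \<Rightarrow> real" where
  "minor12 g = g $ 1 $ 1 * g $ 2 $ 2 - g $ 1 $ 2 * g $ 2 $ 1"

definition minor13 :: "real^3^3 \<Rightarrow> real" where
  "minor13 g = g $ 1 $ 1 * g $ 3 $ 2 - g $ 1 $ 2 * g $ 3 $ 1"

definition minor23 :: "real^3^3 \<Rightarrow> real" where
  "minor23 g = g $ 2 $ 1 * g $ 3 $ 2 - g $ 2 $ 2 * g $ 3 $ 1"

lemmas minor_defs = minor12_def minor13_def minor23_def

text \<open>For p = m a n, \<open>p $ 1 $ 1\<close> is m1 exp t1 and \<open>minor12 p\<close> is m1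
  m2 exp t2 = m3 exp t2, because m1 m2 m3 = 1. At these two numbers \<open>chi\<close> is the
  inducing character.\<close>

definition chi :: "bit \<times> bit \<Rightarrow> complex \<times> complex \<Rightarrow> real \<Rightarrow> real \<Rightarrow> complex" where
  "chi \<delta> u a b = sign_pow (sgn a) (fst \<delta>) * sign_pow (sgn b) (snd \<delta>)
     * (cpow (fst u) \<bar>a\<bar> * cpow (snd u) \<bar>b\<bar>)"

lemmas mat3_simps = vec_eq_iff forall_3 matrix_matrix_mult_def sum_3 det_3
lemmas mat2_simps = vec_eq_iff forall_2 matrix_matrix_mult_def sum_2 det_2

lemma char_SL3_iff:
  "(p, c) \<in> char_SL3 \<delta> u \<longleftrightarrow>
     p $ 2 $ 1 = 0 \<and> p $ 3 $ 1 = 0 \<and> p $ 3 $ 2 = 0 \<and> p \<in> SL \<and> c = chi \<delta> u (p $ 1 $ 1) (minor12 p)"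
  (is "?L \<longleftrightarrow> ?R")
proof
  assume ?L
  then obtain m1 m2 m3 t1 t2 x y z where
    p: "p = diag3 m1 m2 m3 ** diag3 (exp t1) (exp (t2 - t1)) (exp (- t2)) ** upper3 x y z"
    and c: "c = sign_pow m1 (fst \<delta>) * sign_pow m3 (snd \<delta>)
         * exp (fst u * complex_of_real t1 + snd u * complex_of_real t2)"
    and m: "m1 \<in> {1, -1}" "m2 \<in> {1, -1}" "m3 \<in> {1, -1}" "m1 * m2 * m3 = 1"
    unfolding char_SL3_def by blast
  have e: "exp t1 * exp (t2 - t1) = exp t2" "exp t2 * exp (- t2) = (1::real)"
    by (simp_all flip: exp_add)
  have entries: "p $ 1 $ 1 = m1 * exp t1" "p $ 2 $ 2 = m2 * exp (t2 - t1)" "p $ 3 $ 3 = m3 * exp (- t2)"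
    "p $ 2 $ 1 = 0" "p $ 3 $ 1 = 0" "p $ 3 $ 2 = 0"
    unfolding p by (simp_all add: diag3_def upper3_def mat3_simps)
  have m3: "m1 * m2 = m3" using m by auto
  have minor: "minor12 p = m3 * exp t2"
    unfolding minor12_def entries by (simp add: m3[symmetric] e(1)[symmetric])
  have "det p = (m1 * m2 * m3) * (exp t1 * exp (t2 - t1) * exp (- t2))"
    unfolding det_3 entries by simp
  then have "p \<in> SL" unfolding SL_def e using m(4) e by simp
  moreover have "c = chi \<delta> u (p $ 1 $ 1) (minor12 p)"
    unfolding c chi_def minor entries using m
    by (auto simp: sgn_mult abs_mult cpow_exp exp_add)
  ultimately show ?R using entries by simp
next
  assume R: ?R
  define a b where "a = p $ 1 $ 1" and "b = minor12 p"
  have d: "a * p $ 2 $ 2 * p $ 3 $ 3 = 1" "b = a * p $ 2 $ 2"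
    using R by (auto simp: SL_def det_3 a_def b_def minor12_def)
  then have nz: "a \<noteq> 0" "b \<noteq> 0" by auto
  have p22: "p $ 2 $ 2 = b / a" and p33: "p $ 3 $ 3 = 1 / b"
    using d nz by (auto simp: field_simps)
  \<comment> \<open>From a = m1 exp t1 and b = m3 exp t2 one reads off m1, m3, t1 and t2; the middle
    sign is forced by m1 m2 m3 = 1.\<close>
  have "p = diag3 (sgn a) (sgn a * sgn b) (sgn b)
      ** diag3 (exp (ln \<bar>a\<bar>)) (exp (ln \<bar>b\<bar> - ln \<bar>a\<bar>)) (exp (- ln \<bar>b\<bar>))
      ** upper3 (p $ 1 $ 2 / a) (p $ 1 $ 3 / a) (p $ 2 $ 3 / (b / a))"
    using nz R p22 p33
    by (auto simp: mat3_simps diag3_def upper3_def exp_diff exp_minus a_def[symmetric] sgn_if field_simps)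
  moreover have "c = sign_pow (sgn a) (fst \<delta>) * sign_pow (sgn b) (snd \<delta>)
         * exp (fst u * complex_of_real (ln \<bar>a\<bar>) + snd u * complex_of_real (ln \<bar>b\<bar>))"
    using R by (simp add: chi_def a_def b_def cpow_def exp_add)
  moreover have "sgn a \<in> {1, -1}" "sgn a * sgn b \<in> {1, -1}" "sgn b \<in> {1, -1}"
      "sgn a * (sgn a * sgn b) * sgn b = 1"
    using nz by (auto simp: sgn_if)
  ultimately show ?L unfolding char_SL3_def by blast
qed

lemma char_SL2_iff:
  "(p, c) \<in> char_SL2 \<sigma> v \<longleftrightarrow>
     p $ 2 $ 1 = 0 \<and> p \<in> SL \<and> c = sign_pow (sgn (p $ 1 $ 1)) \<sigma> * cpow v \<bar>p $ 1 $ 1\<bar>"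
  (is "?L \<longleftrightarrow> ?R")
proof
  assume ?L
  then obtain m t x where p: "p = diag2 m m ** diag2 (exp t) (exp (- t)) ** upper2 x"
    and c: "c = sign_pow m \<sigma> * exp (v * complex_of_real t)" and m: "m \<in> {1, -1}"
    unfolding char_SL2_def by blast
  have entries: "p $ 1 $ 1 = m * exp t" "p $ 2 $ 2 = m * exp (- t)" "p $ 2 $ 1 = 0"
    unfolding p by (simp_all add: diag2_def upper2_def mat2_simps)
  have "det p = 1"
    unfolding det_2 entries using m by (auto simp: exp_minus)
  then show ?R
    unfolding c SL_def entries using m by (auto simp: sgn_mult abs_mult cpow_exp entries)
next
  assume R: ?R
  define a where "a = p $ 1 $ 1"
  have d: "a * p $ 2 $ 2 = 1" using R by (auto simp: SL_def det_2 a_def)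
  then have nz: "a \<noteq> 0" by auto
  then have p22: "p $ 2 $ 2 = 1 / a" using d by (simp add: nonzero_eq_divide_eq mult.commute)
  have "p = diag2 (sgn a) (sgn a) ** diag2 (exp (ln \<bar>a\<bar>)) (exp (- ln \<bar>a\<bar>)) ** upper2 (p $ 1 $ 2 / a)"
    using nz R p22
    by (auto simp: mat2_simps diag2_def upper2_def exp_minus a_def[symmetric] sgn_if field_simps)
  moreover have "c = sign_pow (sgn a) \<sigma> * exp (v * complex_of_real (ln \<bar>a\<bar>))"
    using R by (simp add: a_def cpow_def)
  moreover have "sgn a \<in> {1, -1}" using nz by (auto simp: sgn_if)
  ultimately show ?L unfolding char_SL2_def by blast
qed

lemma I_SL_D:
  assumes "f \<in> I_SL \<delta> u"
  shows "smooth_on SL f" "g \<notin> SL \<Longrightarrow> f g = 0"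
    "g \<in> SL \<Longrightarrow> p \<in> SL \<Longrightarrow> p $ 2 $ 1 = 0 \<Longrightarrow> p $ 3 $ 1 = 0 \<Longrightarrow> p $ 3 $ 2 = 0 \<Longrightarrow>
      f (g ** p) = inverse (chi \<delta> u (p $ 1 $ 1) (minor12 p)) * f g"
proof -
  show "smooth_on SL f" "g \<notin> SL \<Longrightarrow> f g = 0"
    using assms by (auto simp: I_SL_def smooth_Ind_def)
  assume "g \<in> SL" "p \<in> SL" "p $ 2 $ 1 = 0" "p $ 3 $ 1 = 0" "p $ 3 $ 2 = 0"
  then have "(p, chi \<delta> u (p $ 1 $ 1) (minor12 p)) \<in> char_SL3 \<delta> u"
    by (simp add: char_SL3_iff)
  then show "f (g ** p) = inverse (chi \<delta> u (p $ 1 $ 1) (minor12 p)) * f g"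
    using assms \<open>g \<in> SL\<close> unfolding I_SL_def smooth_Ind_def by blast
qed

lemma I_SL_I:
  assumes "smooth_on SL f" "\<And>g. g \<notin> SL \<Longrightarrow> f g = 0"
    "\<And>g p. g \<in> SL \<Longrightarrow> p \<in> SL \<Longrightarrow> p $ 2 $ 1 = 0 \<Longrightarrow> p $ 3 $ 1 = 0 \<Longrightarrow> p $ 3 $ 2 = 0 \<Longrightarrow>
      f (g ** p) = inverse (chi \<delta> u (p $ 1 $ 1) (minor12 p)) * f g"
  shows "f \<in> I_SL \<delta> u"
  unfolding I_SL_def smooth_Ind_def using assms by (auto simp: char_SL3_iff)

lemma I_SL_add: "f \<in> I_SL \<delta> u \<Longrightarrow> g \<in> I_SL \<delta> u \<Longrightarrow> f + g \<in> I_SL \<delta> u"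
  by (auto intro!: I_SL_I smooth_on_add simp: plus_fun_def I_SL_D algebra_simps)

lemma I_SL_scale: "f \<in> I_SL \<delta> u \<Longrightarrow> (\<lambda>x. c * f x) \<in> I_SL \<delta> u"
  by (auto intro!: I_SL_I smooth_on_mult_const simp: I_SL_D)

lemma SL_mult_iff: "a \<in> SL \<Longrightarrow> a ** g \<in> SL \<longleftrightarrow> g \<in> SL"
  by (simp add: SL_def det_mul)

lemma I_SL_translate:
  assumes f: "f \<in> I_SL \<delta> u" and a: "a \<in> SL"
  shows "(\<lambda>g. f (a ** g)) \<in> I_SL \<delta> u"
proof (rule I_SL_I)
  show "smooth_on SL (\<lambda>g. f (a ** g))"
    by (rule smooth_on_compose[OF I_SL_D(1)[OF f] C_inf_linear[OF bounded_linear_matrix_mult]])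
      (auto simp: SL_mult a)
qed (auto simp: I_SL_D[OF f] SL_mult_iff a matrix_mul_assoc)

section \<open>The embedded subgroup and the big cell\<close>

lemma matrix_inv_unique:
  fixes A :: "real^'n^'n"
  assumes "A \<in> SL" "A ** B = mat 1"
  shows "matrix_inv A = B"
  using SL_matrix_inv(3)[OF assms(1)] assms(2)
  by (metis matrix_mul_assoc matrix_mul_lid matrix_mul_rid)

lemma iota3_mult: "iota3 (g ** h) = iota3 g ** iota3 h"
  by (simp add: iota3_def mat3_simps sum_2)

lemma iota3_1: "iota3 (mat 1) = mat 1"
  by (simp add: iota3_def mat3_simps mat_def)

lemma iota3_in_SL: "g \<in> SL \<Longrightarrow> iota3 g \<in> SL"
  by (simp add: iota3_def SL_def det_2 det_3)

lemma iota3_matrix_inv: "h \<in> SL \<Longrightarrow> matrix_inv (iota3 h) = iota3 (matrix_inv h)"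
  by (rule matrix_inv_unique) (simp_all add: iota3_in_SL iota3_1 SL_matrix_inv flip: iota3_mult)

lemma upper2_add: "upper2 (a + b) = upper2 a ** upper2 b"
  by (simp add: upper2_def mat2_simps)

lemma upper2_0: "upper2 0 = mat 1"
  by (simp add: upper2_def mat2_simps mat_def)

lemma upper2_in_SL: "upper2 b \<in> SL"
  by (simp add: upper2_def SL_def det_2)

lemma lower3_in_SL: "lower3 x y z \<in> SL"
  by (simp add: lower3_def SL_def det_3)

lemma lower3_0: "lower3 0 0 0 = mat 1"
  by (simp add: lower3_def mat3_simps mat_def)

text \<open>LU factorization g = n p with pivots a, d / a and 1 / d, where a is the first entry and
  d the leading minor; equivariance then removes p.\<close>

lemma I_SL_big_cell:
  assumes f: "f \<in> I_SL \<delta> u" and g: "g \<in> SL" and nz: "g $ 1 $ 1 \<noteq> 0" "minor12 g \<noteq> 0"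
  shows "f g = inverse (chi \<delta> u (g $ 1 $ 1) (minor12 g))
    * f (lower3 (g $ 2 $ 1 / g $ 1 $ 1) (minor13 g / minor12 g) (g $ 3 $ 1 / g $ 1 $ 1))"
proof -
  define a where "a = g $ 1 $ 1"
  define d where "d = minor12 g"
  have nz: "a \<noteq> 0" "d \<noteq> 0" using nz by (auto simp: a_def d_def)
  let ?n = "lower3 (g $ 2 $ 1 / a) (minor13 g / d) (g $ 3 $ 1 / a)"
  let ?p = "vector [vector [a, g $ 1 $ 2, g $ 1 $ 3],
    vector [0, d / a, (a * g $ 2 $ 3 - g $ 1 $ 3 * g $ 2 $ 1) / a], vector [0, 0, 1 / d]] :: real^3^3"
  have p: "?p $ 2 $ 1 = 0" "?p $ 3 $ 1 = 0" "?p $ 3 $ 2 = 0" "?p \<in> SL" "?p $ 1 $ 1 = a" "minor12 ?p = d"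
    using nz by (auto simp: SL_def det_3 minor12_def)
  have det: "a * g $ 2 $ 2 * g $ 3 $ 3 + g $ 1 $ 2 * g $ 2 $ 3 * g $ 3 $ 1 + g $ 1 $ 3 * g $ 2 $ 1 * g $ 3 $ 2
     - a * g $ 2 $ 3 * g $ 3 $ 2 - g $ 1 $ 2 * g $ 2 $ 1 * g $ 3 $ 3 - g $ 1 $ 3 * g $ 2 $ 2 * g $ 3 $ 1 = 1"
    using g by (simp add: SL_def det_3 a_def)
  have d: "d = a * g $ 2 $ 2 - g $ 1 $ 2 * g $ 2 $ 1" by (simp add: d_def minor12_def a_def)
  have m: "minor13 g = a * g $ 3 $ 2 - g $ 1 $ 2 * g $ 3 $ 1" by (simp add: minor13_def a_def)
  \<comment> \<open>The (3,3) entry of n p is the one whose verification uses det g = 1.\<close>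
  have "g $ 3 $ 1 * g $ 1 $ 3 * d + minor13 g * (a * g $ 2 $ 3 - g $ 1 $ 3 * g $ 2 $ 1) + a
      = g $ 3 $ 3 * a * d"
    unfolding m d using det by algebra
  then have e33: "g $ 3 $ 1 / a * g $ 1 $ 3
      + minor13 g / d * ((a * g $ 2 $ 3 - g $ 1 $ 3 * g $ 2 $ 1) / a) + 1 / d = g $ 3 $ 3"
    using nz by (simp add: field_simps)
  have e22: "g $ 2 $ 1 / a * g $ 1 $ 2 + d / a = g $ 2 $ 2"
    using nz(1) by (simp add: d field_simps)
  have e32: "g $ 3 $ 1 / a * g $ 1 $ 2 + minor13 g / d * (d / a) = g $ 3 $ 2"
    using nz by (simp add: m field_simps)
  have e23: "g $ 2 $ 1 / a * g $ 1 $ 3 + (a * g $ 2 $ 3 - g $ 1 $ 3 * g $ 2 $ 1) / a = g $ 2 $ 3"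
    using nz by (simp add: field_simps)
  have e1: "g $ k $ 1 / a * a = g $ k $ 1" for k
    using nz(1) by simp
  have "g = ?n ** ?p"
    using nz(1) by (simp add: mat3_simps lower3_def a_def[symmetric] e1 e22 e23 e32 e33 del: times_divide_eq_left times_divide_eq_right)
  then have "f g = f (?n ** ?p)" by simp
  also have "\<dots> = inverse (chi \<delta> u a d) * f ?n"
    using I_SL_D(3)[OF f lower3_in_SL p(4,1,2,3)] p by simp
  finally show ?thesis by (simp add: a_def d_def)
qed

section \<open>The unipotent subgroup of SL(2) in cell coordinates\<close>

type_synonym V = "real \<times> real \<times> real \<times> real"

text \<open>The first variable of \<open>Kfun f g\<close> is the parameter of the unipotent subgroup of \<open>SL(2)\<close>, so that
  invariance under this subgroup becomes constancy in that variable.\<close>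

definition Kfun :: "(real^3^3 \<Rightarrow> complex) \<Rightarrow> real^3^3 \<Rightarrow> V \<Rightarrow> complex" where
  "Kfun f g = (\<lambda>(b, x, y, z). f (g ** iota3 (upper2 b) ** lower3 x y z))"

abbreviation "e\<^sub>b \<equiv> (1, 0, 0, 0) :: V"
abbreviation "e\<^sub>x \<equiv> (0, 1, 0, 0) :: V"
abbreviation "e\<^sub>y \<equiv> (0, 0, 1, 0) :: V"
abbreviation "e\<^sub>z \<equiv> (0, 0, 0, 1) :: V"

definition cx :: "V \<Rightarrow> real" where "cx p = fst (snd p)"
definition cy :: "V \<Rightarrow> real" where "cy p = fst (snd (snd p))"
definition cz :: "V \<Rightarrow> real" where "cz p = snd (snd (snd p))"

lemma bounded_linear_coords: "bounded_linear cx" "bounded_linear cy" "bounded_linear cz" "bounded_linear (fst :: V \<Rightarrow> real)"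
  unfolding cx_def[abs_def] cy_def[abs_def] cz_def[abs_def]
  by (intro bounded_linear_fst bounded_linear_fst_comp bounded_linear_snd_comp bounded_linear_ident)+

lemma C_inf_coords: "C_inf U cx" "C_inf U cy" "C_inf U cz" "C_inf U (fst :: V \<Rightarrow> real)"
  by (intro C_inf_linear bounded_linear_coords)+

lemma C_inf_matrix3:
  fixes F :: "'a::euclidean_space \<Rightarrow> real^3^3"
  assumes "open U" and "\<And>i j. C_inf U (\<lambda>x. F x $ i $ j)"
  shows "C_inf U F"
  by (intro C_inf_vec assms)

lemma C_inf_lower3:
  assumes "open U" "C_inf U x" "C_inf U y" "C_inf U z"
  shows "C_inf U (\<lambda>p. lower3 (x p) (y p) (z p))"
proof (rule C_inf_matrix3[OF assms(1)])
  have "\<forall>i j. C_inf U (\<lambda>p. lower3 (x p) (y p) (z p) $ i $ j)"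
    unfolding forall_3 using assms by (simp add: lower3_def C_inf_const)
  then show "C_inf U (\<lambda>p. lower3 (x p) (y p) (z p) $ i $ j)" for i j by blast
qed

lemma C_inf_iota3_upper2:
  assumes "open U" "C_inf U b"
  shows "C_inf U (\<lambda>p. iota3 (upper2 (b p)))"
proof (rule C_inf_matrix3[OF assms(1)])
  have "\<forall>i j. C_inf U (\<lambda>p. iota3 (upper2 (b p)) $ i $ j)"
    unfolding forall_3 using assms by (simp add: iota3_def upper2_def C_inf_const)
  then show "C_inf U (\<lambda>p. iota3 (upper2 (b p)) $ i $ j)" for i j by blast
qed

lemma C_inf_Kfun:
  assumes f: "smooth_on SL f" and g: "g \<in> SL"
  shows "C_inf UNIV (Kfun f g)"
proof -
  have "C_inf UNIV (\<lambda>p. f (g ** iota3 (upper2 (fst p)) ** lower3 (cx p) (cy p) (cz p)))"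
    by (rule C_inf_smooth_on_compose[OF f])
      (auto intro!: C_inf_matrix_mult C_inf_const C_inf_iota3_upper2 C_inf_lower3 C_inf_coords
        SL_mult iota3_in_SL upper2_in_SL lower3_in_SL g)
  then show ?thesis unfolding Kfun_def cx_def cy_def cz_def by (simp add: case_prod_unfold)
qed

text \<open>The translated cell point has first entry 1 + h z and leading minor 1 + h (z - x y), and
  \<open>I_SL_big_cell\<close> brings it back to the cell. Positivity removes the signs from the
  character.\<close>

lemma Kfun_shift:
  assumes f: "f \<in> I_SL \<delta> u" and g: "g \<in> SL"
    and pos: "1 + h * z > 0" "1 + h * (z - x * y) > 0"
  shows "Kfun f g (b + h, x, y, z) = cpow (- fst u) (1 + h * z) * cpow (- snd u) (1 + h * (z - x * y))
    * Kfun f g (b, x / (1 + h * z), y / (1 + h * (z - x * y)), z / (1 + h * z))"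
proof -
  let ?a = "g ** iota3 (upper2 b)"
  let ?M = "iota3 (upper2 h) ** lower3 x y z"
  have a: "?a \<in> SL" by (simp add: SL_mult g iota3_in_SL upper2_in_SL)
  have M: "?M \<in> SL" by (simp add: SL_mult iota3_in_SL upper2_in_SL lower3_in_SL)
  have entries: "?M $ 1 $ 1 = 1 + h * z" "?M $ 2 $ 1 = x" "?M $ 3 $ 1 = z" "minor13 ?M = y"
    "minor12 ?M = 1 + h * (z - x * y)"
    by (simp_all add: minor_defs matrix_matrix_mult_def sum_3 iota3_def upper2_def lower3_def algebra_simps)
  have "Kfun f g (b + h, x, y, z) = f (?a ** ?M)"
    by (simp add: Kfun_def upper2_add iota3_mult matrix_mul_assoc)
  also have "\<dots> = inverse (chi \<delta> u (1 + h * z) (1 + h * (z - x * y)))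
    * f (?a ** lower3 (x / (1 + h * z)) (y / (1 + h * (z - x * y))) (z / (1 + h * z)))"
    using I_SL_big_cell[OF I_SL_translate[OF f a] M] pos unfolding entries by simp
  also have "inverse (chi \<delta> u (1 + h * z) (1 + h * (z - x * y)))
      = cpow (- fst u) (1 + h * z) * cpow (- snd u) (1 + h * (z - x * y))"
    using pos by (simp add: chi_def sign_pow_def cpow_minus)
  finally show ?thesis by (simp add: Kfun_def)
qed

lemma coords_units [simp]:
  "cx e\<^sub>x = 1" "cx e\<^sub>y = 0" "cx e\<^sub>z = 0" "cy e\<^sub>x = 0" "cy e\<^sub>y = 1" "cy e\<^sub>z = 0"
  "cz e\<^sub>x = 0" "cz e\<^sub>y = 0" "cz e\<^sub>z = 1"
  "cx (\<beta>, x, y, z) = x" "cy (\<beta>, x, y, z) = y" "cz (\<beta>, x, y, z) = z"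
  by (simp_all add: cx_def cy_def cz_def)

text \<open>The derivative of \<open>Kfun_shift\<close> at h = 0, regrouped so that each summand
  acts on Taylor coefficients by a scalar and an index shift.\<close>

lemma Kfun_pde:
  assumes f: "f \<in> I_SL \<delta> u" and g: "g \<in> SL"
  defines "K \<equiv> Kfun f g"
  shows "dird e\<^sub>b K p =
    - (cz p *\<^sub>R (cx p *\<^sub>R dird e\<^sub>x K p + cy p *\<^sub>R dird e\<^sub>y K p + cz p *\<^sub>R dird e\<^sub>z K p
        + (fst u + snd u) * K p))
    + cx p *\<^sub>R (cy p *\<^sub>R (cy p *\<^sub>R dird e\<^sub>y K p + snd u * K p))"
proof -
  obtain b x y z where p: "p = (b, x, y, z)" by (metis prod.exhaust)
  have K: "C_inf UNIV K" unfolding K_def by (rule C_inf_Kfun[OF I_SL_D(1)[OF f] g])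
  let ?\<gamma> = "\<lambda>h. (b, x / (1 + h * z), y / (1 + h * (z - x * y)), z / (1 + h * z))"
  let ?R = "\<lambda>h. cpow (- fst u) (1 + h * z) * cpow (- snd u) (1 + h * (z - x * y)) * K (?\<gamma> h)"
  have aff: "((\<lambda>h. 1 + h * c) has_vector_derivative c) (at 0)" for c :: real
    by (auto intro!: derivative_eq_intros)
  have pw: "((\<lambda>h. cpow s (1 + h * c)) has_vector_derivative of_real c * s) (at 0)" for s c
    using vector_diff_chain_at[OF aff, of "cpow s" "s * cpow (s - 1) 1" c] has_vector_derivative_cpow[of 1 s]
    by (simp add: o_def scaleR_conv_of_real)
  have quot: "((\<lambda>h. a / (1 + h * c)) has_vector_derivative - (a * c)) (at 0)" for a c :: real
    by (auto intro!: derivative_eq_intros simp: has_real_derivative_iff_has_vector_derivative[symmetric])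
  have "(?\<gamma> has_vector_derivative (0, - (x * z), - (y * (z - x * y)), - (z * z))) (at 0)"
    by (intro has_vector_derivative_Pair quot has_vector_derivative_const)
  then have "((\<lambda>h. K (?\<gamma> h)) has_derivative
      (\<lambda>s. frechet_derivative K (at p) (s *\<^sub>R (0, - (x * z), - (y * (z - x * y)), - (z * z))))) (at 0)"
    unfolding has_vector_derivative_def
    using has_derivative_compose[of ?\<gamma> _ 0 UNIV K] C_inf_has_derivative[OF K, of p] p by simp
  moreover have lin: "linear (frechet_derivative K (at p))"
    by (rule has_derivative_linear[OF C_inf_has_derivative[OF K UNIV_I]])
  ultimately have "((\<lambda>h. K (?\<gamma> h)) has_vector_derivative
      frechet_derivative K (at p) (0, - (x * z), - (y * (z - x * y)), - (z * z))) (at 0)"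
    unfolding has_vector_derivative_def by (simp only: linear_scale)
  moreover have "(0, - (x * z), - (y * (z - x * y)), - (z * z)) =
      (- (x * z)) *\<^sub>R e\<^sub>x + (- (y * (z - x * y))) *\<^sub>R e\<^sub>y + (- (z * z)) *\<^sub>R e\<^sub>z"
    by simp
  ultimately have Kd: "((\<lambda>h. K (?\<gamma> h)) has_vector_derivative
      (- (x * z)) *\<^sub>R dird e\<^sub>x K p + (- (y * (z - x * y))) *\<^sub>R dird e\<^sub>y K p
        + (- (z * z)) *\<^sub>R dird e\<^sub>z K p) (at 0)"
    unfolding dird_def by (simp only: linear_add[OF lin] linear_scale[OF lin])
  define D where "D = (- (x * z)) *\<^sub>R dird e\<^sub>x K p + (- (y * (z - x * y))) *\<^sub>R dird e\<^sub>y K p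
        + (- (z * z)) *\<^sub>R dird e\<^sub>z K p - of_real z * fst u * K p - of_real (z - x * y) * snd u * K p"
  have "(?R has_vector_derivative
      (cpow (- fst u) (1 + 0 * z) * cpow (- snd u) (1 + 0 * (z - x * y))) *
        ((- (x * z)) *\<^sub>R dird e\<^sub>x K p + (- (y * (z - x * y))) *\<^sub>R dird e\<^sub>y K p
        + (- (z * z)) *\<^sub>R dird e\<^sub>z K p)
      + (cpow (- fst u) (1 + 0 * z) * (of_real (z - x * y) * (- snd u))
         + of_real z * (- fst u) * cpow (- snd u) (1 + 0 * (z - x * y))) * K (?\<gamma> 0)) (at 0)"
    by (rule has_vector_derivative_mult[OF has_vector_derivative_mult[OF pw pw] Kd])
  then have R: "(?R has_vector_derivative D) (at 0)"
    by (rule has_vector_derivative_eq_rhs) (simp add: D_def p algebra_simps)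
  have "((\<lambda>h. K (b + h, x, y, z)) has_vector_derivative dird e\<^sub>b K p) (at 0)"
    using has_vector_derivative_along_line[OF K, of p e\<^sub>b 0] by (simp add: p)
  moreover have "((\<lambda>h. K (b + h, x, y, z)) has_vector_derivative D) (at 0)"
  proof -
    \<comment> \<open>The positivity required by \<open>Kfun_shift\<close> holds near h = 0, which
      suffices for a derivative there.\<close>
    have c: "\<forall>\<^sub>F h in nhds 0. 1 + h * c > 0" for c :: real
    proof (rule order_tendstoD(1))
      show "((\<lambda>h. 1 + h * c) \<longlongrightarrow> 1 + 0 * c) (nhds 0)"
        by (intro tendsto_intros filterlim_ident)
    qed simp
    have "\<forall>\<^sub>F h in nhds 0. ?R h = K (b + h, x, y, z)"
      using c[of z] c[of "z - x * y"]
      by eventually_elim (simp add: K_def Kfun_shift[OF f g])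
    then have ev: "\<forall>\<^sub>F h in at 0. ?R h = K (b + h, x, y, z)" and "?R 0 = K (b + 0, x, y, z)"
      unfolding eventually_nhds_conv_at by blast+
    then show ?thesis
      using has_derivative_transform_eventually[OF R[unfolded has_vector_derivative_def] ev]
      unfolding has_vector_derivative_def by blast
  qed
  ultimately have "dird e\<^sub>b K p = D" by (rule vector_derivative_unique_at)
  then show ?thesis
    by (simp only:) (simp add: D_def p scaleR_conv_of_real, simp add: algebra_simps)
qed

section \<open>Taylor coefficients\<close>

lemma C_inf_dird_funpow: "C_inf U F \<Longrightarrow> C_inf U ((dird v ^^ n) F)"
  by (induction n) (auto intro: C_inf_dird)

lemma dird_add:
  assumes "C_inf UNIV F" "C_inf UNIV G"
  shows "dird v (\<lambda>p. F p + G p) = (\<lambda>p. dird v F p + dird v G p)"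
proof
  fix p
  show "dird v (\<lambda>p. F p + G p) p = dird v F p + dird v G p"
    using dird_eq[OF has_derivative_add[OF C_inf_has_derivative[OF assms(1) UNIV_I]
          C_inf_has_derivative[OF assms(2) UNIV_I]]] by (simp add: dird_def)
qed

lemma dird_mult_const:
  fixes F :: "'a::euclidean_space \<Rightarrow> complex"
  assumes "C_inf UNIV F"
  shows "dird v (\<lambda>p. c * F p) = (\<lambda>p. c * dird v F p)"
proof
  fix p
  show "dird v (\<lambda>p. c * F p) p = c * dird v F p"
    using dird_eq[OF has_derivative_mult_right[OF C_inf_has_derivative[OF assms UNIV_I]]]
    by (simp add: dird_def)
qed

lemma dird_linear_mult:
  fixes F :: "'a::euclidean_space \<Rightarrow> complex"
  assumes "C_inf UNIV F" "bounded_linear L"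
  shows "dird v (\<lambda>p. L p *\<^sub>R F p) = (\<lambda>p. L p *\<^sub>R dird v F p + L v *\<^sub>R F p)"
proof
  fix p
  show "dird v (\<lambda>p. L p *\<^sub>R F p) p = L p *\<^sub>R dird v F p + L v *\<^sub>R F p"
    using dird_eq[OF has_derivative_scaleR[OF bounded_linear_imp_has_derivative[OF assms(2)]
          C_inf_has_derivative[OF assms(1) UNIV_I]]]
    by (simp add: dird_def)
qed

lemma dird_funpow_add:
  assumes "C_inf UNIV F" "C_inf UNIV G"
  shows "(dird v ^^ n) (\<lambda>p. F p + G p) = (\<lambda>p. (dird v ^^ n) F p + (dird v ^^ n) G p)"
  by (induction n) (simp_all add: dird_add C_inf_dird_funpow assms)

lemma dird_funpow_mult_const:
  fixes F :: "'a::euclidean_space \<Rightarrow> complex"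
  assumes "C_inf UNIV F"
  shows "(dird v ^^ n) (\<lambda>p. c * F p) = (\<lambda>p. c * (dird v ^^ n) F p)"
  by (induction n) (simp_all add: dird_mult_const C_inf_dird_funpow assms)

text \<open>Leibniz rule for a factor with constant derivative L v. For n = 0 the truncated n - 1 is
  harmless, as the factor n vanishes.\<close>

lemma dird_funpow_linear_mult:
  fixes F :: "'a::euclidean_space \<Rightarrow> complex"
  assumes F: "C_inf UNIV F" and L: "bounded_linear L"
  shows "(dird v ^^ n) (\<lambda>p. L p *\<^sub>R F p)
    = (\<lambda>p. L p *\<^sub>R (dird v ^^ n) F p + complex_of_real (real n * L v) * (dird v ^^ (n - 1)) F p)"
proof (induction n)
  case 0
  then show ?case by simp
next
  case (Suc n)
  have "(dird v ^^ Suc n) (\<lambda>p. L p *\<^sub>R F p) = dird v (\<lambda>p. L p *\<^sub>R (dird v ^^ n) F p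
      + complex_of_real (real n * L v) * (dird v ^^ (n - 1)) F p)"
    by (simp add: Suc)
  also have "\<dots> = (\<lambda>p. (L p *\<^sub>R (dird v ^^ Suc n) F p + L v *\<^sub>R (dird v ^^ n) F p)
      + complex_of_real (real n * L v) * dird v ((dird v ^^ (n - 1)) F) p)"
    by (subst dird_add)
      (auto intro!: C_inf_scaleR C_inf_mult C_inf_const C_inf_linear[OF L] C_inf_dird_funpow F
        simp: dird_linear_mult dird_mult_const L C_inf_dird_funpow F)
  also have "\<dots> = (\<lambda>p. L p *\<^sub>R (dird v ^^ Suc n) F p
      + complex_of_real (real (Suc n) * L v) * (dird v ^^ (Suc n - 1)) F p)"
    by (cases n) (auto simp: scaleR_conv_of_real algebra_simps)
  finally show ?case .
qed

lemma dird_funpow_commute: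
  fixes F :: "'a::euclidean_space \<Rightarrow> complex"
  assumes "C_inf UNIV F"
  shows "(dird v ^^ n) (dird w F) = dird w ((dird v ^^ n) F)"
  by (induction n) (simp_all add: dird_commute[where v = v and w = w] C_inf_dird_funpow assms)

text \<open>The nesting x, z, y differs from the order of the arguments; it is that of
  \<open>word\<close>, so that \<open>coef_eq_taylor\<close> can match one derivative at a
  time.\<close>

definition pderivs :: "nat \<Rightarrow> nat \<Rightarrow> nat \<Rightarrow> (V \<Rightarrow> complex) \<Rightarrow> V \<Rightarrow> complex" where
  "pderivs a b c F = (dird e\<^sub>x ^^ a) ((dird e\<^sub>z ^^ c) ((dird e\<^sub>y ^^ b) F))"

definition taylor :: "nat \<Rightarrow> nat \<Rightarrow> nat \<Rightarrow> (V \<Rightarrow> complex) \<Rightarrow> real \<Rightarrow> complex" where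
  "taylor a b c F \<beta> = pderivs a b c F (\<beta>, 0, 0, 0) / (fact a * fact b * fact c)"

lemma pderivs_add:
  "C_inf UNIV F \<Longrightarrow> C_inf UNIV G \<Longrightarrow>
    pderivs a b c (\<lambda>p. F p + G p) = (\<lambda>p. pderivs a b c F p + pderivs a b c G p)"
  by (simp add: pderivs_def dird_funpow_add C_inf_dird_funpow)

lemma pderivs_mult_const:
  "C_inf UNIV F \<Longrightarrow> pderivs a b c (\<lambda>p. k * F p) = (\<lambda>p. k * pderivs a b c F p)"
  by (simp add: pderivs_def dird_funpow_mult_const C_inf_dird_funpow)

lemma pderivs_dird:
  assumes "C_inf UNIV F"
  shows "pderivs a b c (dird w F) = dird w (pderivs a b c F)"
  by (simp add: pderivs_def dird_funpow_commute C_inf_dird_funpow assms)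

lemma C_inf_pderivs: "C_inf UNIV F \<Longrightarrow> C_inf UNIV (pderivs a b c F)"
  by (simp add: pderivs_def C_inf_dird_funpow)

lemma taylor_add:
  "C_inf UNIV F \<Longrightarrow> C_inf UNIV G \<Longrightarrow>
    taylor a b c (\<lambda>p. F p + G p) \<beta> = taylor a b c F \<beta> + taylor a b c G \<beta>"
  by (simp add: taylor_def pderivs_add add_divide_distrib)

lemma taylor_mult_const:
  "C_inf UNIV F \<Longrightarrow> taylor a b c (\<lambda>p. k * F p) \<beta> = k * taylor a b c F \<beta>"
  by (simp add: taylor_def pderivs_mult_const)

lemma taylor_minus:
  "C_inf UNIV F \<Longrightarrow> taylor a b c (\<lambda>p. - F p) \<beta> = - taylor a b c F \<beta>"
  using taylor_mult_const[of F a b c "-1" \<beta>] by simp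

lemma C_inf_linear_mult:
  fixes F :: "'a::euclidean_space \<Rightarrow> complex"
  shows "C_inf UNIV F \<Longrightarrow> bounded_linear L \<Longrightarrow> C_inf UNIV (\<lambda>p. L p *\<^sub>R F p)"
  by (rule C_inf_scaleR[OF open_UNIV C_inf_linear])

lemmas C_inf_coord_mult = C_inf_linear_mult[OF _ bounded_linear_coords(1)]
  C_inf_linear_mult[OF _ bounded_linear_coords(2)] C_inf_linear_mult[OF _ bounded_linear_coords(3)]

lemmas dird_funpow_coord_mult = dird_funpow_linear_mult[OF _ bounded_linear_coords(1)]
  dird_funpow_linear_mult[OF _ bounded_linear_coords(2)] dird_funpow_linear_mult[OF _ bounded_linear_coords(3)]

lemma C_inf_mult_const: "C_inf UNIV F \<Longrightarrow> C_inf UNIV (\<lambda>p. k * F p)"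
  for F :: "'a::euclidean_space \<Rightarrow> complex"
  by (intro C_inf_mult C_inf_const open_UNIV)

text \<open>With the factorials divided out, multiplication by a coordinate is a pure index
  shift.\<close>

lemma taylor_x_mult:
  assumes "C_inf UNIV F"
  shows "taylor a b c (\<lambda>p. cx p *\<^sub>R F p) \<beta> = (if a = 0 then 0 else taylor (a - 1) b c F \<beta>)"
  by (cases a) (simp_all add: taylor_def pderivs_def dird_funpow_coord_mult C_inf_dird_funpow assms divide_simps
      del: of_nat_Suc funpow.simps(2))

lemma taylor_z_mult:
  assumes "C_inf UNIV F"
  shows "taylor a b c (\<lambda>p. cz p *\<^sub>R F p) \<beta> = (if c = 0 then 0 else taylor a b (c - 1) F \<beta>)"
  by (cases c) (simp_all add: taylor_def pderivs_def dird_funpow_coord_mult C_inf_dird_funpow assms divide_simps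
      dird_funpow_add C_inf_coord_mult C_inf_mult_const dird_funpow_mult_const del: of_nat_Suc funpow.simps(2))

lemma taylor_y_mult:
  assumes "C_inf UNIV F"
  shows "taylor a b c (\<lambda>p. cy p *\<^sub>R F p) \<beta> = (if b = 0 then 0 else taylor a (b - 1) c F \<beta>)"
  by (cases b) (simp_all add: taylor_def pderivs_def dird_funpow_coord_mult C_inf_dird_funpow assms divide_simps
      dird_funpow_add C_inf_coord_mult C_inf_mult_const dird_funpow_mult_const del: of_nat_Suc funpow.simps(2))

lemma taylor_x_power_mult:
  "C_inf UNIV F \<Longrightarrow> taylor a b c (\<lambda>p. cx p ^ n *\<^sub>R F p) \<beta> = (if a < n then 0 else taylor (a - n) b c F \<beta>)"
  and taylor_y_power_mult:
  "C_inf UNIV F \<Longrightarrow> taylor a b c (\<lambda>p. cy p ^ n *\<^sub>R F p) \<beta> = (if b < n then 0 else taylor a (b - n) c F \<beta>)"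
  and taylor_z_power_mult:
  "C_inf UNIV F \<Longrightarrow> taylor a b c (\<lambda>p. cz p ^ n *\<^sub>R F p) \<beta> = (if c < n then 0 else taylor a b (c - n) F \<beta>)"
proof -
  assume F: "C_inf UNIV F"
  have S: "C_inf UNIV (\<lambda>p. L p ^ n *\<^sub>R F p)" if "bounded_linear L" for L :: "V \<Rightarrow> real" and n
    by (intro C_inf_scaleR C_inf_power C_inf_linear that F open_UNIV)
  show "taylor a b c (\<lambda>p. cx p ^ n *\<^sub>R F p) \<beta> = (if a < n then 0 else taylor (a - n) b c F \<beta>)"
  proof (induction n arbitrary: a)
    case (Suc n)
    have "taylor a b c (\<lambda>p. cx p ^ Suc n *\<^sub>R F p) \<beta> = taylor a b c (\<lambda>p. cx p *\<^sub>R (cx p ^ n *\<^sub>R F p)) \<beta>"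
      by simp
    also have "\<dots> = (if a < Suc n then 0 else taylor (a - Suc n) b c F \<beta>)"
      unfolding taylor_x_mult[OF S[OF bounded_linear_coords(1)]] Suc by auto
    finally show ?case .
  qed simp
  show "taylor a b c (\<lambda>p. cy p ^ n *\<^sub>R F p) \<beta> = (if b < n then 0 else taylor a (b - n) c F \<beta>)"
  proof (induction n arbitrary: b)
    case (Suc n)
    have "taylor a b c (\<lambda>p. cy p ^ Suc n *\<^sub>R F p) \<beta> = taylor a b c (\<lambda>p. cy p *\<^sub>R (cy p ^ n *\<^sub>R F p)) \<beta>"
      by simp
    also have "\<dots> = (if b < Suc n then 0 else taylor a (b - Suc n) c F \<beta>)"
      unfolding taylor_y_mult[OF S[OF bounded_linear_coords(2)]] Suc by auto
    finally show ?case .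
  qed simp
  show "taylor a b c (\<lambda>p. cz p ^ n *\<^sub>R F p) \<beta> = (if c < n then 0 else taylor a b (c - n) F \<beta>)"
  proof (induction n arbitrary: c)
    case (Suc n)
    have "taylor a b c (\<lambda>p. cz p ^ Suc n *\<^sub>R F p) \<beta> = taylor a b c (\<lambda>p. cz p *\<^sub>R (cz p ^ n *\<^sub>R F p)) \<beta>"
      by simp
    also have "\<dots> = (if c < Suc n then 0 else taylor a b (c - Suc n) F \<beta>)"
      unfolding taylor_z_mult[OF S[OF bounded_linear_coords(3)]] Suc by auto
    finally show ?case .
  qed simp
qed

text \<open>Monomials are eigenvectors of x d/dx, y d/dy and z d/dz.\<close>

lemma taylor_euler:
  assumes F: "C_inf UNIV F"
  shows "taylor a b c (\<lambda>p. cx p *\<^sub>R dird e\<^sub>x F p) \<beta> = of_nat a * taylor a b c F \<beta>"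
    and "taylor a b c (\<lambda>p. cy p *\<^sub>R dird e\<^sub>y F p) \<beta> = of_nat b * taylor a b c F \<beta>"
    and "taylor a b c (\<lambda>p. cz p *\<^sub>R dird e\<^sub>z F p) \<beta> = of_nat c * taylor a b c F \<beta>"
proof -
  have "pderivs a b c (dird e\<^sub>x F) = pderivs (Suc a) b c F" for a
    unfolding pderivs_dird[OF F] by (simp add: pderivs_def)
  then show "taylor a b c (\<lambda>p. cx p *\<^sub>R dird e\<^sub>x F p) \<beta> = of_nat a * taylor a b c F \<beta>"
    unfolding taylor_x_mult[OF C_inf_dird[OF F]]
    by (cases a) (auto simp: taylor_def divide_simps simp del: of_nat_Suc)
  have "pderivs a b c (dird e\<^sub>y F) = pderivs a (Suc b) c F" for b
    by (simp add: pderivs_def funpow_swap1)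
  then show "taylor a b c (\<lambda>p. cy p *\<^sub>R dird e\<^sub>y F p) \<beta> = of_nat b * taylor a b c F \<beta>"
    unfolding taylor_y_mult[OF C_inf_dird[OF F]]
    by (cases b) (auto simp: taylor_def divide_simps simp del: of_nat_Suc)
  have "pderivs a b c (dird e\<^sub>z F) = pderivs a b (Suc c) F" for c
    by (simp add: pderivs_def dird_funpow_commute F C_inf_dird_funpow)
  then show "taylor a b c (\<lambda>p. cz p *\<^sub>R dird e\<^sub>z F p) \<beta> = of_nat c * taylor a b c F \<beta>"
    unfolding taylor_z_mult[OF C_inf_dird[OF F]]
    by (cases c) (auto simp: taylor_def divide_simps simp del: of_nat_Suc)
qed

text \<open>Used with s = u1 + u2 and t = u2. The diagonal operators act before multiplication by z
  or x y, so their eigenvalues are taken at the shifted exponents (a, b, c - 1) and (a - 1, b - 1,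
  c).\<close>

lemma taylor_pde:
  assumes K: "C_inf UNIV K"
  shows "taylor a b c (\<lambda>p. - (cz p *\<^sub>R (cx p *\<^sub>R dird e\<^sub>x K p + cy p *\<^sub>R dird e\<^sub>y K p
        + cz p *\<^sub>R dird e\<^sub>z K p + s * K p))
      + cx p *\<^sub>R (cy p *\<^sub>R (cy p *\<^sub>R dird e\<^sub>y K p + t * K p))) \<beta>
    = - (if c = 0 then 0 else (of_nat (a + b + (c - 1)) + s) * taylor a b (c - 1) K \<beta>)
      + (if a = 0 \<or> b = 0 then 0 else (of_nat (b - 1) + t) * taylor (a - 1) (b - 1) c K \<beta>)"
proof -
  have S: "C_inf UNIV (\<lambda>p. cx p *\<^sub>R dird e\<^sub>x K p)" "C_inf UNIV (\<lambda>p. cy p *\<^sub>R dird e\<^sub>y K p)"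
    "C_inf UNIV (\<lambda>p. cz p *\<^sub>R dird e\<^sub>z K p)" "\<And>k. C_inf UNIV (\<lambda>p. k * K p)"
    by (intro C_inf_coord_mult C_inf_mult_const C_inf_dird K)+
  have S2: "C_inf UNIV (\<lambda>p. cx p *\<^sub>R dird e\<^sub>x K p + cy p *\<^sub>R dird e\<^sub>y K p)"
    "C_inf UNIV (\<lambda>p. cx p *\<^sub>R dird e\<^sub>x K p + cy p *\<^sub>R dird e\<^sub>y K p + cz p *\<^sub>R dird e\<^sub>z K p)"
    "C_inf UNIV (\<lambda>p. cx p *\<^sub>R dird e\<^sub>x K p + cy p *\<^sub>R dird e\<^sub>y K p + cz p *\<^sub>R dird e\<^sub>z K p + s * K p)"
    "C_inf UNIV (\<lambda>p. cy p *\<^sub>R dird e\<^sub>y K p + t * K p)"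
    by (intro C_inf_add S open_UNIV)+
  have S3: "C_inf UNIV (\<lambda>p. cz p *\<^sub>R (cx p *\<^sub>R dird e\<^sub>x K p + cy p *\<^sub>R dird e\<^sub>y K p
        + cz p *\<^sub>R dird e\<^sub>z K p + s * K p))"
    "C_inf UNIV (\<lambda>p. cy p *\<^sub>R (cy p *\<^sub>R dird e\<^sub>y K p + t * K p))"
    "C_inf UNIV (\<lambda>p. cx p *\<^sub>R (cy p *\<^sub>R (cy p *\<^sub>R dird e\<^sub>y K p + t * K p)))"
    by (intro C_inf_coord_mult S2)+
  have S4: "C_inf UNIV (\<lambda>p. - (cz p *\<^sub>R (cx p *\<^sub>R dird e\<^sub>x K p + cy p *\<^sub>R dird e\<^sub>y K p
        + cz p *\<^sub>R dird e\<^sub>z K p + s * K p)))"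
    by (rule C_inf_compose_linear[OF bounded_linear_minus[OF bounded_linear_ident] open_UNIV S3(1)])
  show ?thesis
    unfolding taylor_add[OF S4 S3(3)] taylor_minus[OF S3(1)] taylor_z_mult[OF S2(3)]
      taylor_x_mult[OF S3(2)] taylor_y_mult[OF S2(4)] taylor_add[OF S2(2) S(4)] taylor_add[OF S2(1) S(3)]
      taylor_add[OF S(1) S(2)] taylor_add[OF S(2) S(4)] taylor_euler[OF K] taylor_mult_const[OF K]
    by (simp add: algebra_simps)
qed

section \<open>Operators from chains of monomials\<close>

text \<open>There is one unknown more than there are relations. The two-term shape lets a solution
  be extended one index at a time.\<close>

lemma first_order_recurrence_solution:
  fixes A B :: "nat \<Rightarrow> complex"
  shows "\<exists>l. (\<exists>c\<le>L. l c \<noteq> 0) \<and> (\<forall>c<L. A c * l (Suc c) = B c * l c)"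
proof (induction L)
  case 0
  show ?case by (intro exI[of _ "\<lambda>_. 1"]) simp
next
  case (Suc L)
  then obtain l where l: "\<exists>c\<le>L. l c \<noteq> 0" "\<forall>c<L. A c * l (Suc c) = B c * l c" by blast
  show ?case
  proof (cases "A L = 0")
    case True
    \<comment> \<open>The last relation now only constrains \<open>l L\<close>. The vector supported
      at the new index satisfies it and all earlier ones.\<close>
    then show ?thesis by (intro exI[of _ "\<lambda>c. if c = Suc L then 1 else 0"]) auto
  next
    case False
    let ?l = "l(Suc L := B L / A L * l L)"
    have "\<forall>c<Suc L. A c * ?l (Suc c) = B c * ?l c"
      using l(2) False by (auto simp: less_Suc_eq)
    moreover have "\<exists>c\<le>Suc L. ?l c \<noteq> 0"
      using l(1) by (metis fun_upd_apply le_SucI not_less_eq_eq)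
    ultimately show ?thesis by blast
  qed
qed

text \<open>The right-hand side of the equation in \<open>Kfun_pde\<close> connects the monomial
  \<open>x^(i-1-c) y^(j-i-1-c) z^c\<close> only with \<open>x^(i-1-c) y^(j-i-1-c) z^(c+1)\<close> and \<open>x^(i-c) y^(j-i-c) z^c\<close>;
  hence the monomials of weight \<open>j\<close> split into \<open>j + 1\<close> chains, one for each \<open>i\<close>, and on each chain
  invariance is the two-term recurrence for \<open>l\<close>.\<close>

lemma taylor_chain_pde:
  assumes K: "C_inf UNIV K" and i: "i \<le> j" and L: "L = min i (j - i)"
    and l: "\<And>c. c < L \<Longrightarrow> (of_nat (j - c - 2) + s) * l (Suc c) = (of_nat (j - i - c - 1) + t) * l c"
  shows "(\<Sum>c\<le>L. l c * taylor (i - c) (j - i - c) c (\<lambda>p. - (cz p *\<^sub>R (cx p *\<^sub>R dird e\<^sub>x K p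
        + cy p *\<^sub>R dird e\<^sub>y K p + cz p *\<^sub>R dird e\<^sub>z K p + s * K p))
      + cx p *\<^sub>R (cy p *\<^sub>R (cy p *\<^sub>R dird e\<^sub>y K p + t * K p))) \<beta>) = 0"
proof -
  \<comment> \<open>A coefficient of weight j - 2. It is reached by the z term from index c + 1 and
    by the x y term from index c, so the whole sum is regrouped by \<open>\<tau>\<close>.\<close>
  define \<tau> where "\<tau> c = taylor (i - Suc c) (j - i - Suc c) c K \<beta>" for c
  define X where "X c = l c * (if c = 0 then 0 else (of_nat (i - c + (j - i - c) + (c - 1)) + s)
    * taylor (i - c) (j - i - c) (c - 1) K \<beta>)" for c
  define Y where "Y c = l c * (if i - c = 0 \<or> j - i - c = 0 then 0 else (of_nat (j - i - c - 1) + t)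
    * taylor (i - c - 1) (j - i - c - 1) c K \<beta>)" for c
  have "(\<Sum>c\<le>L. X c) = X 0 + (\<Sum>c<L. X (Suc c))" by (rule sum.atMost_shift)
  also have "\<dots> = (\<Sum>c<L. (of_nat (j - c - 2) + s) * l (Suc c) * \<tau> c)"
  proof -
    have "X (Suc c) = (of_nat (j - c - 2) + s) * l (Suc c) * \<tau> c" if "c < L" for c
    proof -
      have "i - Suc c + (j - i - Suc c) + (Suc c - 1) = j - c - 2"
      proof -
        have "c < i" "c < j - i" using that L by auto
        then show ?thesis by arith
      qed
      then show ?thesis by (simp only: X_def \<tau>_def) simp
    qed
    then have "(\<Sum>c<L. X (Suc c)) = (\<Sum>c<L. (of_nat (j - c - 2) + s) * l (Suc c) * \<tau> c)"
      by (intro sum.cong refl) simp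
    moreover have "X 0 = 0" by (simp add: X_def)
    ultimately show ?thesis by (simp only: add_0)
  qed
  finally have X: "(\<Sum>c\<le>L. X c) = (\<Sum>c<L. (of_nat (j - c - 2) + s) * l (Suc c) * \<tau> c)" .
  have "(\<Sum>c\<le>L. Y c) = (\<Sum>c<L. Y c) + Y L"
    by (metis lessThan_Suc_atMost sum.lessThan_Suc)
  also have "\<dots> = (\<Sum>c<L. (of_nat (j - i - c - 1) + t) * l c * \<tau> c)"
  proof -
    \<comment> \<open>At c = L = min i (j - i) the exponent of x or of y has run out, so the x y
      term contributes nothing.\<close>
    have "Y L = 0" unfolding Y_def using L by auto
    moreover have "Y c = (of_nat (j - i - c - 1) + t) * l c * \<tau> c" if "c < L" for c
      using that L unfolding Y_def \<tau>_def by auto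
    ultimately show ?thesis by simp
  qed
  finally have Y: "(\<Sum>c\<le>L. Y c) = (\<Sum>c<L. (of_nat (j - i - c - 1) + t) * l c * \<tau> c)" .
  have "(\<Sum>c\<le>L. - X c + Y c) = - (\<Sum>c\<le>L. X c) + (\<Sum>c\<le>L. Y c)"
    by (simp only: sum.distrib sum_negf)
  also have "\<dots> = 0" unfolding X Y using l by simp
  finally show ?thesis
    unfolding taylor_pde[OF K] X_def Y_def by (simp only: ring_distribs mult_minus_right)
qed

lemma taylor_has_vector_derivative:
  assumes K: "C_inf UNIV K"
  shows "((\<lambda>\<beta>. taylor a b c K \<beta>) has_vector_derivative taylor a b c (dird e\<^sub>b K) \<beta>) (at \<beta>)"
proof -
  have "((\<lambda>\<beta>. pderivs a b c K (\<beta>, 0, 0, 0)) has_vector_derivative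
      pderivs a b c (dird e\<^sub>b K) (\<beta>, 0, 0, 0)) (at \<beta>)"
    using has_vector_derivative_along_line[OF C_inf_pderivs[OF K], of a b c 0 e\<^sub>b \<beta>]
    by (simp add: pderivs_dird[OF K])
  then show ?thesis unfolding taylor_def by (rule has_vector_derivative_divide)
qed

text \<open>The derivative in \<beta> vanishes by \<open>Kfun_pde\<close> and the chain relations:
  infinitesimal invariance integrates to invariance under the unipotent subgroup.\<close>

lemma taylor_chain_const:
  assumes f: "f \<in> I_SL \<delta> u" and g: "g \<in> SL" and i: "i \<le> j" and L: "L = min i (j - i)"
    and l: "\<And>c. c < L \<Longrightarrow>
      (of_nat (j - c - 2) + (fst u + snd u)) * l (Suc c) = (of_nat (j - i - c - 1) + snd u) * l c"
  shows "(\<Sum>c\<le>L. l c * taylor (i - c) (j - i - c) c (Kfun f g) \<beta>)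
    = (\<Sum>c\<le>L. l c * taylor (i - c) (j - i - c) c (Kfun f g) 0)"
proof -
  have K: "C_inf UNIV (Kfun f g)" by (rule C_inf_Kfun[OF I_SL_D(1)[OF f] g])
  let ?\<phi> = "\<lambda>\<beta>. \<Sum>c\<le>L. l c * taylor (i - c) (j - i - c) c (Kfun f g) \<beta>"
  have "(?\<phi> has_vector_derivative
      (\<Sum>c\<le>L. l c * taylor (i - c) (j - i - c) c (dird e\<^sub>b (Kfun f g)) \<beta>)) (at \<beta>)" for \<beta>
    by (intro has_vector_derivative_sum has_vector_derivative_mult_right taylor_has_vector_derivative K)
  moreover have "(\<Sum>c\<le>L. l c * taylor (i - c) (j - i - c) c (dird e\<^sub>b (Kfun f g)) \<beta>) = 0" for \<beta>
    unfolding Kfun_pde[OF f g, abs_def] by (rule taylor_chain_pde[OF K i L l])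
  ultimately have d: "(?\<phi> has_vector_derivative 0) (at \<beta>)" for \<beta> by simp
  show ?thesis
  proof (rule has_vector_derivative_zero_constant[OF convex_UNIV, of ?\<phi>])
    show "(?\<phi> has_vector_derivative 0) (at x)" for x by (rule d)
  next
    fix k assume "\<And>x. x \<in> UNIV \<Longrightarrow> ?\<phi> x = k"
    from this[OF UNIV_I, of \<beta>] this[OF UNIV_I, of 0] show ?thesis by (simp only:)
  qed
qed

text \<open>The coordinate directions are eigenvectors of the dilation with weights 1, 1, 2, so
  every derivative contributes its eigenvalue. The factor k will be a character value.\<close>

lemma taylor_scaling:
  assumes K: "C_inf UNIV K"
  shows "taylor a b c (\<lambda>(b, x, y, z). k * K (b, r * x, r * y, r ^ 2 * z)) 0
    = k * of_real r ^ (a + b + 2 * c) * taylor a b c K 0"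
proof -
  define M :: "V \<Rightarrow> V" where "M = (\<lambda>(b, x, y, z). (b, r * x, r * y, r ^ 2 * z))"
  have M: "bounded_linear M"
    unfolding M_def linear_conv_bounded_linear[symmetric] by (auto simp: linear_iff algebra_simps)
  have C: "C_inf UNIV (\<lambda>p. F (M p))" if "C_inf UNIV F" for F :: "V \<Rightarrow> complex"
    by (rule C_inf_compose[OF open_UNIV open_UNIV C_inf_linear[OF M] that]) simp
  have d: "dird v (\<lambda>p. F (M p)) = (\<lambda>p. of_real m * dird v F (M p))"
    if F: "C_inf UNIV F" and v: "M v = m *\<^sub>R v" for F :: "V \<Rightarrow> complex" and v m
  proof
    fix p
    have "((\<lambda>p. F (M p)) has_derivative (\<lambda>h. frechet_derivative F (at (M p)) (M h))) (at p)"
      by (rule has_derivative_compose[OF bounded_linear_imp_has_derivative[OF M]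
            C_inf_has_derivative[OF F UNIV_I]])
    from dird_eq[OF this, of v] show "dird v (\<lambda>p. F (M p)) p = of_real m * dird v F (M p)"
      unfolding v linear_scale[OF has_derivative_linear[OF C_inf_has_derivative[OF F UNIV_I]]]
      by (simp add: dird_def scaleR_conv_of_real)
  qed
  have dn: "(dird v ^^ n) (\<lambda>p. F (M p)) = (\<lambda>p. of_real m ^ n * (dird v ^^ n) F (M p))"
    if F: "C_inf UNIV F" and v: "M v = m *\<^sub>R v" for F :: "V \<Rightarrow> complex" and v m n
  proof (induction n)
    case (Suc n)
    have "(dird v ^^ Suc n) (\<lambda>p. F (M p)) = dird v (\<lambda>p. of_real m ^ n * (dird v ^^ n) F (M p))"
      by (simp add: Suc)
    also have "\<dots> = (\<lambda>p. of_real m ^ Suc n * (dird v ^^ Suc n) F (M p))"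
      by (simp add: dird_mult_const C C_inf_dird_funpow F d[OF C_inf_dird_funpow[OF F] v] mult_ac)
    finally show ?case .
  qed simp
  have eig: "M e\<^sub>x = r *\<^sub>R e\<^sub>x" "M e\<^sub>y = r *\<^sub>R e\<^sub>y" "M e\<^sub>z = r ^ 2 *\<^sub>R e\<^sub>z" by (auto simp: M_def)
  have "pderivs a b c (\<lambda>p. K (M p)) = (\<lambda>p. of_real r ^ (a + b + 2 * c) * pderivs a b c K (M p))"
    unfolding pderivs_def
    by (simp add: dn[OF _ eig(1)] dn[OF _ eig(2)] dn[OF _ eig(3)] K C C_inf_dird_funpow
        dird_funpow_mult_const C_inf_mult_const power_add mult_ac del: of_real_power)
       (simp add: power_mult power2_eq_square power_mult_distrib)
  moreover have "(\<lambda>(b, x, y, z). k * K (b, r * x, r * y, r ^ 2 * z)) = (\<lambda>p. k * K (M p))"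
    by (auto simp: M_def)
  moreover have "M (0, 0, 0, 0) = (0, 0, 0, 0)" by (simp add: M_def)
  ultimately show ?thesis by (simp add: taylor_mult_const C K) (simp add: taylor_def)
qed

section \<open>Taylor coefficients as left-invariant derivatives\<close>

definition E21 :: "real^3^3" where "E21 = vector [vector [0, 0, 0], vector [1, 0, 0], vector [0, 0, 0]]"
definition E31 :: "real^3^3" where "E31 = vector [vector [0, 0, 0], vector [0, 0, 0], vector [1, 0, 0]]"
definition E32 :: "real^3^3" where "E32 = vector [vector [0, 0, 0], vector [0, 0, 0], vector [0, 1, 0]]"

lemma trace_E [simp]: "trace E21 = 0" "trace E31 = 0" "trace E32 = 0"
  by (simp_all add: trace_def sum_3 E21_def E31_def E32_def)

lemma mat_exp_E:
  "mat_exp (t *\<^sub>R E21) = mat 1 + t *\<^sub>R E21" "mat_exp (t *\<^sub>R E31) = mat 1 + t *\<^sub>R E31"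
  "mat_exp (t *\<^sub>R E32) = mat 1 + t *\<^sub>R E32"
  by (rule mat_exp_square_zero; simp add: mat3_simps E21_def E31_def E32_def)+

text \<open>At nonzero y, translation along \<open>E21\<close> would also move z by t y. Hence the
  derivatives in x are taken at y = 0, after those in y.\<close>

lemma lower3_mat_exp:
  "lower3 x y z ** mat_exp (t *\<^sub>R E32) = lower3 x (y + t) z"
  "lower3 x 0 z ** mat_exp (t *\<^sub>R E31) = lower3 x 0 (z + t)"
  "lower3 x 0 z ** mat_exp (t *\<^sub>R E21) = lower3 (x + t) 0 z"
  unfolding mat_exp_E by (simp_all add: mat3_simps E21_def E31_def E32_def lower3_def mat_def)

text \<open>The order matters: the three one-parameter groups multiply in it to
  \<open>lower3 x 0 z ** lower3 0 y 0 = lower3 x y z\<close>.\<close>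

definition word :: "nat \<Rightarrow> nat \<Rightarrow> nat \<Rightarrow> (real^3^3) list" where
  "word a b c = replicate a E21 @ replicate c E31 @ replicate b E32"

definition coef :: "nat \<Rightarrow> nat \<Rightarrow> nat \<Rightarrow> (real^3^3 \<Rightarrow> complex) \<Rightarrow> real^3^3 \<Rightarrow> complex" where
  "coef a b c f g = foldr right_deriv (word a b c) f g / (fact a * fact b * fact c)"

text \<open>F may be any smooth expression of f on the translate of the cell by g. This covers base
  points with \<beta> nonzero, the cell rescaled by the torus, and explicit test functions. The
  inductions peel \<open>word\<close> from the inside: y, then z at y = 0, then x.\<close>

lemma coef_eq_taylor:
  assumes F: "C_inf UNIV F" and eq: "\<And>x y z. f (g ** lower3 x y z) = F (\<beta>, x, y, z)"
  shows "coef a b c f g = taylor a b c F \<beta>"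
proof -
  have step: "right_deriv X \<psi> h = dird v G p"
    if "C_inf UNIV G" "\<And>t. \<psi> (h ** mat_exp (t *\<^sub>R X)) = G (p + t *\<^sub>R v)" for X \<psi> h G p v
    unfolding right_deriv_def that(2)
    using vector_derivative_at[OF has_vector_derivative_along_line[OF that(1), of p v 0]] by simp
  have 1: "foldr right_deriv (replicate b E32) f (g ** lower3 x y z) = (dird e\<^sub>y ^^ b) F (\<beta>, x, y, z)" for x y z
  proof (induction b arbitrary: x y z)
    case (Suc b)
    have "foldr right_deriv (replicate (Suc b) E32) f (g ** lower3 x y z)
      = dird e\<^sub>y ((dird e\<^sub>y ^^ b) F) (\<beta>, x, y, z)"
      unfolding replicate_Suc foldr.simps o_apply
      by (rule step) (simp_all add: C_inf_dird_funpow F Suc lower3_mat_exp del: foldr_replicate foldr_append flip: matrix_mul_assoc)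
    then show ?case by simp
  qed (simp add: eq)
  have 2: "foldr right_deriv (replicate c E31 @ replicate b E32) f (g ** lower3 x 0 z)
      = (dird e\<^sub>z ^^ c) ((dird e\<^sub>y ^^ b) F) (\<beta>, x, 0, z)" for x z
  proof (induction c arbitrary: x z)
    case (Suc c)
    have "foldr right_deriv (replicate (Suc c) E31 @ replicate b E32) f (g ** lower3 x 0 z)
      = dird e\<^sub>z ((dird e\<^sub>z ^^ c) ((dird e\<^sub>y ^^ b) F)) (\<beta>, x, 0, z)"
      unfolding replicate_Suc append_Cons foldr.simps o_apply
      by (rule step) (simp_all add: C_inf_dird_funpow F Suc lower3_mat_exp del: foldr_replicate foldr_append flip: matrix_mul_assoc)
    then show ?case by simp
  qed (simp add: 1 del: foldr_replicate foldr_append)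
  have 3: "foldr right_deriv (word a b c) f (g ** lower3 x 0 z) = pderivs a b c F (\<beta>, x, 0, z)" for x z
    unfolding word_def pderivs_def
  proof (induction a arbitrary: x z)
    case (Suc a)
    have "foldr right_deriv (replicate (Suc a) E21 @ replicate c E31 @ replicate b E32) f (g ** lower3 x 0 z)
      = dird e\<^sub>x ((dird e\<^sub>x ^^ a) ((dird e\<^sub>z ^^ c) ((dird e\<^sub>y ^^ b) F))) (\<beta>, x, 0, z)"
      unfolding replicate_Suc append_Cons foldr.simps o_apply
      by (rule step) (simp_all add: C_inf_dird_funpow F Suc lower3_mat_exp del: foldr_replicate foldr_append flip: matrix_mul_assoc)
    then show ?case by simp
  qed (simp add: 2 del: foldr_replicate foldr_append)
  show ?thesis
    using 3[of 0 0] by (simp add: coef_def taylor_def lower3_0)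
qed

lemma coef_Kfun:
  assumes "smooth_on SL f" "g \<in> SL"
  shows "coef a b c f (g ** iota3 (upper2 \<beta>)) = taylor a b c (Kfun f g) \<beta>"
  by (rule coef_eq_taylor[OF C_inf_Kfun[OF assms]]) (simp add: Kfun_def)

lemma coef_Kfun_0:
  assumes "smooth_on SL f" "g \<in> SL"
  shows "coef a b c f g = taylor a b c (Kfun f g) 0"
  using coef_Kfun[OF assms, of a b c 0] by (simp add: upper2_0 iota3_1)

lemma foldr_right_deriv_translate:
  "foldr right_deriv Xs (\<lambda>x. f (A ** x)) = (\<lambda>x. foldr right_deriv Xs f (A ** x))"
  by (induction Xs) (simp_all add: right_deriv_def[abs_def] matrix_mul_assoc)

text \<open>Moving diag (s, 1, 1/s) through \<open>lower3 x y z\<close> to the right divides x and y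
  by s and z by s^2; then equivariance gives the character value, with both arguments equal to
  s.\<close>

lemma coef_diagonal:
  assumes f: "f \<in> I_SL \<delta> u" and g: "g \<in> SL" and s: "s \<noteq> 0"
  shows "coef a b c f (g ** iota3 (diag2 s (1 / s)))
    = inverse (chi \<delta> u s s * of_real s ^ (a + b + 2 * c)) * coef a b c f g"
proof -
  let ?q = "iota3 (diag2 s (1 / s))"
  let ?r = "1 / s"
  have K: "C_inf UNIV (Kfun f g)" by (rule C_inf_Kfun[OF I_SL_D(1)[OF f] g])
  have q: "?q \<in> SL" "?q $ 2 $ 1 = 0" "?q $ 3 $ 1 = 0" "?q $ 3 $ 2 = 0" "?q $ 1 $ 1 = s" "minor12 ?q = s"
    using s by (simp_all add: SL_def det_3 iota3_def diag2_def minor12_def)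
  have comm: "?q ** lower3 x y z = lower3 (?r * x) (?r * y) (?r ^ 2 * z) ** ?q" for x y z
    using s by (simp add: mat3_simps iota3_def diag2_def lower3_def power2_eq_square)
  have C: "C_inf UNIV (\<lambda>(b, x, y, z). inverse (chi \<delta> u s s) * Kfun f g (b, ?r * x, ?r * y, ?r ^ 2 * z))"
  proof -
    have "bounded_linear (\<lambda>(b, x, y, z). (b, ?r * x, ?r * y, ?r ^ 2 * z) :: V)"
      unfolding linear_conv_bounded_linear[symmetric] by (auto simp: linear_iff algebra_simps add_divide_distrib)
    from C_inf_mult_const[OF C_inf_compose[OF open_UNIV open_UNIV C_inf_linear[OF this] K subset_UNIV]]
    show ?thesis by (simp only: case_prod_unfold prod.sel)
  qed
  have "coef a b c f (g ** ?q)
    = taylor a b c (\<lambda>(b, x, y, z). inverse (chi \<delta> u s s) * Kfun f g (b, ?r * x, ?r * y, ?r ^ 2 * z)) 0"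
  proof (rule coef_eq_taylor[OF C])
    fix x y z
    have "f (g ** ?q ** lower3 x y z) = f ((g ** lower3 (?r * x) (?r * y) (?r ^ 2 * z)) ** ?q)"
      by (metis comm matrix_mul_assoc)
    also have "\<dots> = inverse (chi \<delta> u s s) * f (g ** lower3 (?r * x) (?r * y) (?r ^ 2 * z))"
      using I_SL_D(3)[OF f SL_mult[OF g lower3_in_SL] q(1-4)] by (simp only: q(5,6))
    finally show "f (g ** ?q ** lower3 x y z) = (case (0, x, y, z) of (b, x, y, z) \<Rightarrow>
        inverse (chi \<delta> u s s) * Kfun f g (b, ?r * x, ?r * y, ?r ^ 2 * z))"
      by (simp add: Kfun_def upper2_0 iota3_1)
  qed
  also have "\<dots> = inverse (chi \<delta> u s s) * of_real ?r ^ (a + b + 2 * c) * coef a b c f g"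
    unfolding taylor_scaling[OF K] coef_Kfun_0[OF I_SL_D(1)[OF f] g] ..
  finally show ?thesis
    by (simp add: power_divide divide_inverse power_inverse)
qed

section \<open>Parity and the support condition\<close>

lemma sign_pow_add: "m \<in> {1, -1} \<Longrightarrow> sign_pow m (d + e) = sign_pow m d * sign_pow m e"
  by (cases d; cases e) (auto simp: sign_pow_def)

lemma sign_pow_of_nat: "m \<in> {1, -1} \<Longrightarrow> sign_pow m (of_nat n) = of_real m ^ n"
proof (induction n)
  case (Suc n)
  then have "sign_pow m (of_nat (Suc n)) = sign_pow m 1 * sign_pow m (of_nat n)"
    by (simp only: of_nat_Suc sign_pow_add)
  then show ?case using Suc by (simp add: sign_pow_def)
qed (simp add: sign_pow_def)

text \<open>Here j is -k; modulo 2 neither the sign of k nor the side on which \<sigma> stands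
  matters.\<close>

lemma Supp_SL3_iff:
  "(\<delta>, \<sigma>, u, v) \<in> Supp_SL3 \<longleftrightarrow>
    (\<exists>j::nat. v = fst u + snd u + of_nat j \<and> \<sigma> = fst \<delta> + snd \<delta> + of_nat j)"
proof -
  have bit: "x + y = z \<longleftrightarrow> y = x + z" for x y z :: bit
    by (cases x; cases y; cases z) auto
  have neg: "of_int (- int j) = (of_nat j :: bit)" for j
  proof -
    have "- x = x" for x :: bit by (cases x) simp_all
    then show ?thesis by simp
  qed
  show ?thesis
  proof
    assume "(\<delta>, \<sigma>, u, v) \<in> Supp_SL3"
    then obtain k :: int where k: "k \<le> 0" "fst u + snd u - v = of_int k" "fst \<delta> + snd \<delta> + \<sigma> = of_int k"
      unfolding Supp_SL3_def by auto
    have k': "k = - int (nat (- k))" using k(1) by simp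
    have "v = fst u + snd u + of_nat (nat (- k))"
      using k(2) k' by (metis add_diff_cancel_left' diff_add_cancel diff_minus_eq_add of_int_minus of_int_of_nat_eq)
    moreover have "\<sigma> = fst \<delta> + snd \<delta> + of_nat (nat (- k))"
      using k(3) k' neg bit by metis
    ultimately show "\<exists>j::nat. v = fst u + snd u + of_nat j \<and> \<sigma> = fst \<delta> + snd \<delta> + of_nat j" by blast
  next
    assume "\<exists>j::nat. v = fst u + snd u + of_nat j \<and> \<sigma> = fst \<delta> + snd \<delta> + of_nat j"
    then obtain j :: nat where j: "v = fst u + snd u + of_nat j" "\<sigma> = fst \<delta> + snd \<delta> + of_nat j" by blast
    have "- int j \<le> 0" "fst u + snd u - v = of_int (- int j)" using j(1) by simp_all
    moreover have "fst \<delta> + snd \<delta> + \<sigma> = of_int (- int j)" unfolding neg bit by (rule j(2))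
    ultimately show "(\<delta>, \<sigma>, u, v) \<in> Supp_SL3" unfolding Supp_SL3_def by blast
  qed
qed

section \<open>The operator attached to a chain\<close>

lemma smooth_on_cong: "(\<And>x. x \<in> S \<Longrightarrow> f x = g x) \<Longrightarrow> smooth_on S f \<Longrightarrow> smooth_on S g"
  unfolding smooth_on_def by simp

text \<open>The constant entry 1 makes \<open>iota3\<close> affine; subtracting
  \<open>iota3 0\<close> leaves its linear part.\<close>

lemma bounded_linear_iota3_diff: "bounded_linear (\<lambda>g. iota3 g - iota3 0)"
  unfolding linear_conv_bounded_linear[symmetric]
  by (simp add: linear_iff mat3_simps iota3_def algebra_simps)

lemma C_inf_iota3: "C_inf UNIV iota3"
  using C_inf_add[OF open_UNIV C_inf_linear[OF bounded_linear_iota3_diff] C_inf_const[of _ "iota3 0"]]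
  by simp

text \<open>For i \<le> j, j is the weight and i the chain of the monomials x^(i-c) y^(j-i-c) z^c,
  that is, the sum of the exponents of x and z. The value 0 elsewhere follows the conventions for
  operators and for functions on the group.\<close>

definition chain_op ::
  "bit \<times> bit \<Rightarrow> complex \<times> complex \<Rightarrow> nat \<Rightarrow> nat \<Rightarrow> (nat \<Rightarrow> complex) \<Rightarrow>
    (real^3^3 \<Rightarrow> complex) \<Rightarrow> (real^2^2 \<Rightarrow> complex)" where
  "chain_op \<delta> u i j l f y = (if f \<in> I_SL \<delta> u \<and> y \<in> SL
     then \<Sum>c\<le>min i (j - i). l c * coef (i - c) (j - i - c) c f (iota3 y) else 0)"

lemma coef_add:
  assumes "f \<in> I_SL \<delta> u" "f' \<in> I_SL \<delta> u" "g \<in> SL"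
  shows "coef a b c (f + f') g = coef a b c f g + coef a b c f' g"
proof -
  have "Kfun (f + f') g = (\<lambda>p. Kfun f g p + Kfun f' g p)"
    by (auto simp: Kfun_def plus_fun_def)
  then show ?thesis
    unfolding coef_Kfun_0[OF I_SL_D(1)[OF I_SL_add[OF assms(1,2)]] assms(3)]
      coef_Kfun_0[OF I_SL_D(1)[OF assms(1)] assms(3)] coef_Kfun_0[OF I_SL_D(1)[OF assms(2)] assms(3)]
    using taylor_add[OF C_inf_Kfun[OF I_SL_D(1)[OF assms(1)] assms(3)]
        C_inf_Kfun[OF I_SL_D(1)[OF assms(2)] assms(3)]] by simp
qed

lemma coef_scale:
  assumes "f \<in> I_SL \<delta> u" "g \<in> SL"
  shows "coef a b c (\<lambda>x. k * f x) g = k * coef a b c f g"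
proof -
  have "Kfun (\<lambda>x. k * f x) g = (\<lambda>p. k * Kfun f g p)"
    by (auto simp: Kfun_def)
  then show ?thesis
    unfolding coef_Kfun_0[OF I_SL_D(1)[OF I_SL_scale[OF assms(1)]] assms(2)]
      coef_Kfun_0[OF I_SL_D(1)[OF assms(1)] assms(2)]
    using taylor_mult_const[OF C_inf_Kfun[OF I_SL_D(1)[OF assms(1)] assms(2)]] by simp
qed

lemma smooth_on_coef: "smooth_on SL f \<Longrightarrow> smooth_on SL (coef a b c f)"
  unfolding coef_def[abs_def] divide_inverse mult.commute[of _ "inverse x" for x]
  by (intro smooth_on_mult_const smooth_on_foldr_right_deriv) (auto simp: word_def)

text \<open>An upper triangular p in SL(2) is a torus element times a unipotent one. The unipotent
  factor has no effect by \<open>taylor_chain_const\<close>; the torus factor acts by one scalar, as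
  the whole chain has weight j.\<close>

lemma chain_op_in_J:
  assumes f: "f \<in> I_SL \<delta> u" and i: "i \<le> j"
    and v: "v = fst u + snd u + of_nat j" and \<sigma>: "\<sigma> = fst \<delta> + snd \<delta> + of_nat j"
    and l: "\<And>c. c < min i (j - i) \<Longrightarrow>
      (of_nat (j - c - 2) + (fst u + snd u)) * l (Suc c) = (of_nat (j - i - c - 1) + snd u) * l c"
  shows "chain_op \<delta> u i j l f \<in> J_SL \<sigma> v"
proof -
  let ?S = "\<lambda>g. \<Sum>c\<le>min i (j - i). l c * coef (i - c) (j - i - c) c f g"
  have "smooth_on SL (\<lambda>y. ?S (iota3 y))"
    by (rule smooth_on_compose[OF _ C_inf_iota3])
      (auto intro!: smooth_on_sum smooth_on_mult_const smooth_on_coef I_SL_D(1)[OF f] iota3_in_SL)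
  then have sm: "smooth_on SL (chain_op \<delta> u i j l f)"
    by (rule smooth_on_cong[rotated]) (simp add: chain_op_def f)
  have "chain_op \<delta> u i j l f (y ** p) = inverse k * chain_op \<delta> u i j l f y"
    if y: "y \<in> SL" and pk: "(p, k) \<in> char_SL2 \<sigma> v" for y p k
  proof -
    define s where "s = p $ 1 $ 1"
    have p: "p $ 2 $ 1 = 0" "p \<in> SL" and k: "k = sign_pow (sgn s) \<sigma> * cpow v \<bar>s\<bar>"
      using pk unfolding char_SL2_iff s_def by auto
    have sd: "s * p $ 2 $ 2 = 1" using p by (simp add: SL_def det_2 s_def)
    then have s: "s \<noteq> 0" by auto
    have p22: "p $ 2 $ 2 = 1 / s" using sd s by (simp add: nonzero_eq_divide_eq mult.commute)
    let ?d = "diag2 s (1 / s)" and ?n = "upper2 (p $ 1 $ 2 / s)"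
    have pdn: "p = ?d ** ?n"
      using s p(1) p22 by (simp add: mat2_simps diag2_def upper2_def s_def)
    have d: "?d \<in> SL" using s by (simp add: SL_def det_2 diag2_def)
    have yd: "iota3 (y ** ?d) \<in> SL" by (intro iota3_in_SL SL_mult y d)
    have "iota3 (y ** p) = iota3 (y ** ?d) ** iota3 ?n"
      using arg_cong[OF pdn, of "\<lambda>q. iota3 (y ** q)"] unfolding iota3_mult matrix_mul_assoc .
    then have "?S (iota3 (y ** p)) = ?S (iota3 (y ** ?d) ** iota3 ?n)"
      by (simp only:)
    also have "\<dots> = ?S (iota3 (y ** ?d))"
      unfolding coef_Kfun[OF I_SL_D(1)[OF f] yd] coef_Kfun_0[OF I_SL_D(1)[OF f] yd]
      by (rule taylor_chain_const[OF f yd i refl l])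
    also have "\<dots> = (\<Sum>c\<le>min i (j - i). inverse (chi \<delta> u s s * of_real s ^ j)
        * (l c * coef (i - c) (j - i - c) c f (iota3 y)))"
    proof (rule sum.cong[OF refl])
      fix c assume "c \<in> {..min i (j - i)}"
      then have "i - c + (j - i - c) + 2 * c = j" using i by auto
      then show "l c * coef (i - c) (j - i - c) c f (iota3 (y ** ?d))
        = inverse (chi \<delta> u s s * of_real s ^ j) * (l c * coef (i - c) (j - i - c) c f (iota3 y))"
        unfolding iota3_mult coef_diagonal[OF f iota3_in_SL[OF y] s] by simp
    qed
    also have "\<dots> = inverse (chi \<delta> u s s * of_real s ^ j) * ?S (iota3 y)"
      by (simp add: sum_distrib_left)
    \<comment> \<open>The conditions on v and \<sigma> enter here: s^j contributes the j-th powers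
      of \<bar>s\<bar> and of sgn s.\<close>
    also have "chi \<delta> u s s * of_real s ^ j = k"
    proof -
      have m: "sgn s \<in> {1, -1}" using s by (auto simp: sgn_if)
      have "complex_of_real s ^ j = of_real (sgn s) ^ j * cpow (of_nat j) \<bar>s\<bar>"
        using s by (simp add: cpow_of_nat flip: power_mult_distrib of_real_mult)
          (simp add: sgn_mult_abs)
      moreover have "sign_pow (sgn s) \<sigma>
          = sign_pow (sgn s) (fst \<delta>) * sign_pow (sgn s) (snd \<delta>) * of_real (sgn s) ^ j"
        unfolding \<sigma> sign_pow_add[OF m] sign_pow_of_nat[OF m] ..
      ultimately show ?thesis by (simp add: k v chi_def cpow_add mult_ac)
    qed
    finally show ?thesis using y p(2) by (simp add: chain_op_def f SL_mult)
  qed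
  then show ?thesis
    unfolding J_SL_def smooth_Ind_def using sm by (auto simp: chain_op_def)
qed

text \<open>Coefficients of a differential operator are indexed by words, those of the chain by c.
  The length of the word drops by one when c grows by one, so words determine c and the sum can be
  reindexed.\<close>

lemma chain_op_differential: "differential_operator_on (I_SL \<delta> u) (chain_op \<delta> u i j l)"
proof -
  define L where "L = min i (j - i)"
  define w where "w c = word (i - c) (j - i - c) c" for c
  have len: "length (w c) = i + (j - i) - c" if "c \<le> L" for c
  proof -
    have "c \<le> i" "c \<le> j - i" using that by (auto simp: L_def)
    then have "i - c + (c + (j - i - c)) = i + (j - i) - c" by arith
    then show ?thesis by (simp add: w_def word_def)
  qed
  have inj: "inj_on w {..L}"
  proof (rule inj_onI)
    fix c d assume "c \<in> {..L}" "d \<in> {..L}" "w c = w d"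
    then have "i + (j - i) - c = i + (j - i) - d" "c \<le> L" "d \<le> L" using len by (metis atMost_iff)+
    then show "c = d" unfolding L_def by auto
  qed
  define k where "k Xs = (let c = the_inv_into {..L} w Xs in
    l c / (fact (i - c) * fact (j - i - c) * fact c))" for Xs
  have "chain_op \<delta> u i j l f y = (\<Sum>Xs\<in>w ` {..L}. k Xs * foldr right_deriv Xs f (iota3 y))"
    if "f \<in> I_SL \<delta> u" "y \<in> SL" for f y
    using that unfolding chain_op_def L_def[symmetric]
    by (simp add: sum.reindex[OF inj] k_def the_inv_into_f_f[OF inj] coef_def Let_def)
      (simp add: w_def)
  moreover have "\<forall>Xs\<in>w ` {..L}. \<forall>X\<in>set Xs. trace X = 0"
    by (auto simp: w_def word_def)
  ultimately show ?thesis
    unfolding differential_operator_on_def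
    by (intro ballI exI[of _ UNIV] exI[of _ "w ` {..L}"] exI[of _ "\<lambda>Xs y. k Xs"])
      (simp add: smooth_on_const)
qed

lemma chain_op_in_Diff:
  assumes i: "i \<le> j" and v: "v = fst u + snd u + of_nat j" and \<sigma>: "\<sigma> = fst \<delta> + snd \<delta> + of_nat j"
    and l: "\<And>c. c < min i (j - i) \<Longrightarrow>
      (of_nat (j - c - 2) + (fst u + snd u)) * l (Suc c) = (of_nat (j - i - c - 1) + snd u) * l c"
  shows "chain_op \<delta> u i j l \<in> Diff_SL3 \<delta> u \<sigma> v"
proof -
  have tr: "left_translate (iota3 h) f \<in> I_SL \<delta> u" if "h \<in> SL" "f \<in> I_SL \<delta> u" for h f
    unfolding left_translate_def
    by (intro I_SL_translate that SL_matrix_inv iota3_in_SL)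
  have inter: "chain_op \<delta> u i j l (left_translate (iota3 h) f) = left_translate h (chain_op \<delta> u i j l f)"
    if h: "h \<in> SL" and f: "f \<in> I_SL \<delta> u" for h f
  proof
    fix y
    have "coef a b c (left_translate (iota3 h) f) (iota3 y) = coef a b c f (iota3 (matrix_inv h ** y))" for a b c
      unfolding left_translate_def coef_def foldr_right_deriv_translate iota3_matrix_inv[OF h] iota3_mult ..
    then show "chain_op \<delta> u i j l (left_translate (iota3 h) f) y
        = left_translate h (chain_op \<delta> u i j l f) y"
      using tr[OF h f] f SL_mult_iff[OF SL_matrix_inv(1)[OF h], of y]
      by (simp add: chain_op_def left_translate_def[of h])
  qed
  have add: "chain_op \<delta> u i j l (f + g) = chain_op \<delta> u i j l f + chain_op \<delta> u i j l g"
    if "f \<in> I_SL \<delta> u" "g \<in> I_SL \<delta> u" for f g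
    using that by (auto simp: fun_eq_iff chain_op_def I_SL_add coef_add[OF that] iota3_in_SL
        distrib_left sum.distrib)
  have scale: "chain_op \<delta> u i j l (\<lambda>x. k * f x) = (\<lambda>y. k * chain_op \<delta> u i j l f y)"
    if "f \<in> I_SL \<delta> u" for f k
    using that by (auto simp: fun_eq_iff chain_op_def I_SL_scale coef_scale[OF that] iota3_in_SL
        sum_distrib_left mult_ac intro!: sum.cong)
  have zero: "chain_op \<delta> u i j l f = 0" if "f \<notin> I_SL \<delta> u" for f
    using that by (auto simp: chain_op_def)
  show ?thesis
    unfolding Diff_SL3_def
    using chain_op_in_J[OF _ i v \<sigma> l] chain_op_differential inter add scale zero by blast
qed

section \<open>Test functions\<close>

text \<open>The left side is sgn(x)^n \<bar>x\<bar>^(-s), and a sign is its own inverse. The square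
  appears because the test functions use powers of sums of squares, which are smooth where
  positive.\<close>

lemma homogeneous_cpow:
  assumes x: "x \<noteq> 0" and d: "of_nat n = d"
  shows "of_real x ^ n * cpow (- (s + of_nat n) / 2) (x ^ 2) = inverse (sign_pow (sgn x) d * cpow s \<bar>x\<bar>)"
proof -
  have m: "sgn x \<in> {1, -1}" using x by (auto simp: sgn_if)
  have "ln (x ^ 2) = 2 * ln \<bar>x\<bar>" using x ln_realpow[of "\<bar>x\<bar>" 2] by simp
  moreover have "- (s + of_nat n) / 2 * (2 * y) = (- s - of_nat n) * y" for y
    by (simp add: field_simps)
  ultimately have "cpow (- (s + of_nat n) / 2) (x ^ 2) = cpow (- s - of_nat n) \<bar>x\<bar>"
    by (simp only: cpow_def of_real_mult of_real_numeral)
  also have "\<dots> = cpow (- s) \<bar>x\<bar> * inverse (of_real \<bar>x\<bar> ^ n)"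
    using x cpow_add[of "- s" "- of_nat n" "\<bar>x\<bar>"] by (simp add: cpow_minus cpow_of_nat)
  finally have eq: "cpow (- (s + of_nat n) / 2) (x ^ 2) = cpow (- s) \<bar>x\<bar> * inverse (of_real \<bar>x\<bar> ^ n)" .
  have "of_real x ^ n * cpow (- (s + of_nat n) / 2) (x ^ 2)
      = (of_real x / of_real \<bar>x\<bar>) ^ n * cpow (- s) \<bar>x\<bar>"
    unfolding eq unfolding power_divide unfolding divide_inverse by (simp only: mult_ac)
  also have "of_real x / of_real \<bar>x\<bar> = complex_of_real (sgn x)"
    using x by (simp add: sgn_if)
  also have "of_real (sgn x) ^ n = sign_pow (sgn x) d"
    unfolding d[symmetric] sign_pow_of_nat[OF m] ..
  also have "sign_pow (sgn x) d = inverse (sign_pow (sgn x) d)"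
    using m by (auto simp: sign_pow_def)
  finally show ?thesis by (simp add: cpow_minus mult.commute)
qed

definition col_norm2 :: "real^3^3 \<Rightarrow> real" where
  "col_norm2 g = (g $ 1 $ 1)\<^sup>2 + (g $ 2 $ 1)\<^sup>2 + (g $ 3 $ 1)\<^sup>2"

definition minor_norm2 :: "real^3^3 \<Rightarrow> real" where
  "minor_norm2 g = (minor12 g)\<^sup>2 + (minor13 g)\<^sup>2 + (minor23 g)\<^sup>2"

lemma sum_squares_pos: "x \<noteq> 0 \<or> y \<noteq> 0 \<or> z \<noteq> 0 \<Longrightarrow> x\<^sup>2 + y\<^sup>2 + z\<^sup>2 > (0::real)"
  by (metis add_nonneg_nonneg add_nonneg_pos add_pos_nonneg zero_le_power2 zero_less_power2)

text \<open>Expanding det g = 1 along the first column, and along the third by the minors of the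
  first two, shows that neither the column nor the minors vanish altogether.\<close>

lemma norms_pos:
  assumes "g \<in> SL"
  shows "col_norm2 g > 0" "minor_norm2 g > 0"
proof -
  have d: "g $ 1 $ 1 * (g $ 2 $ 2 * g $ 3 $ 3 - g $ 2 $ 3 * g $ 3 $ 2)
      - g $ 2 $ 1 * (g $ 1 $ 2 * g $ 3 $ 3 - g $ 1 $ 3 * g $ 3 $ 2)
      + g $ 3 $ 1 * (g $ 1 $ 2 * g $ 2 $ 3 - g $ 1 $ 3 * g $ 2 $ 2) = 1"
    "g $ 1 $ 3 * minor23 g - g $ 2 $ 3 * minor13 g + g $ 3 $ 3 * minor12 g = 1"
    using assms by (simp_all add: SL_def det_3 minor_defs algebra_simps)
  have "g $ 1 $ 1 \<noteq> 0 \<or> g $ 2 $ 1 \<noteq> 0 \<or> g $ 3 $ 1 \<noteq> 0" using d(1) by auto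
  then show "col_norm2 g > 0" unfolding col_norm2_def by (rule sum_squares_pos)
  have "minor12 g \<noteq> 0 \<or> minor13 g \<noteq> 0 \<or> minor23 g \<noteq> 0" using d(2) by auto
  then show "minor_norm2 g > 0" unfolding minor_norm2_def by (rule sum_squares_pos)
qed

lemma C_inf_minors:
  fixes U :: "(real^3^3) set"
  assumes "open U"
  shows "C_inf U (\<lambda>g. g $ i $ k)" "C_inf U minor12" "C_inf U minor13" "C_inf U minor23"
    "C_inf U col_norm2" "C_inf U minor_norm2"
proof -
  show e: "C_inf U (\<lambda>g. g $ i $ k)" for i k by (intro C_inf_nth assms C_inf_ident)
  show m: "C_inf U minor12" "C_inf U minor13" "C_inf U minor23"
    unfolding minor_defs[abs_def] by (intro C_inf_diff C_inf_mult e assms)+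
  show "C_inf U col_norm2" "C_inf U minor_norm2"
    unfolding col_norm2_def[abs_def] minor_norm2_def[abs_def]
    by (intro C_inf_add C_inf_power e m assms)+
qed

text \<open>On the cell the first column is (1, x, z) and the minors are (1, y, x y - z), so the
  monomial part is x^a y^b z^c. The exponents m and n belong to quantities equal to 1 there and
  adjust the parity; the powers of the norms correct the degree of homogeneity.\<close>

definition test_fun ::
  "nat \<Rightarrow> nat \<Rightarrow> nat \<Rightarrow> nat \<Rightarrow> nat \<Rightarrow> complex \<times> complex \<Rightarrow> real^3^3 \<Rightarrow> complex" where
  "test_fun m n a b c u g = (if g \<in> SL then
     of_real (g $ 1 $ 1 ^ m * g $ 2 $ 1 ^ a * g $ 3 $ 1 ^ c)
       * cpow (- (fst u + of_nat (m + a + c)) / 2) (col_norm2 g)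
     * (of_real (minor12 g ^ n * minor13 g ^ b)
       * cpow (- (snd u + of_nat (n + b)) / 2) (minor_norm2 g)) else 0)"

lemma test_fun_in_I:
  assumes "of_nat (m + a + c) = fst \<delta>" "of_nat (n + b) = snd \<delta>"
  shows "test_fun m n a b c u \<in> I_SL \<delta> u"
proof (rule I_SL_I)
  let ?U = "{g. col_norm2 g > 0} \<inter> {g. minor_norm2 g > 0}"
  have U: "open ?U"
    using C_inf_continuous_on[OF C_inf_minors(5)[OF open_UNIV]] C_inf_continuous_on[OF C_inf_minors(6)[OF open_UNIV]]
    by (intro open_Int open_Collect_less continuous_on_const) auto
  have "C_inf ?U (\<lambda>g. of_real (g $ 1 $ 1 ^ m * g $ 2 $ 1 ^ a * g $ 3 $ 1 ^ c)
       * cpow (- (fst u + of_nat (m + a + c)) / 2) (col_norm2 g)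
     * (of_real (minor12 g ^ n * minor13 g ^ b)
       * cpow (- (snd u + of_nat (n + b)) / 2) (minor_norm2 g)))"
    by (intro C_inf_mult C_inf_compose_linear[OF bounded_linear_of_real] C_inf_power C_inf_minors
        C_inf_cpow_compose U) auto
  then show "smooth_on SL (test_fun m n a b c u)"
    by (rule smooth_on_of_C_inf[OF U]) (auto simp: test_fun_def norms_pos)
  show "test_fun m n a b c u g = 0" if "g \<notin> SL" for g using that by (simp add: test_fun_def)
  fix g p :: "real^3^3"
  assume g: "g \<in> SL" and p: "p \<in> SL" "p $ 2 $ 1 = 0" "p $ 3 $ 1 = 0" "p $ 3 $ 2 = 0"
  define s where "s = p $ 1 $ 1"
  define t where "t = minor12 p"
  have "s * p $ 2 $ 2 * p $ 3 $ 3 = 1" "t = s * p $ 2 $ 2"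
    using p by (auto simp: SL_def det_3 s_def t_def minor12_def)
  then have nz: "s \<noteq> 0" "t \<noteq> 0" by auto
  have c: "(g ** p) $ k $ 1 = g $ k $ 1 * s" for k
    using p by (simp add: matrix_matrix_mult_def sum_3 s_def)
  have m: "minor12 (g ** p) = minor12 g * t" "minor13 (g ** p) = minor13 g * t"
    "minor23 (g ** p) = minor23 g * t"
    using p by (simp_all add: minor_defs matrix_matrix_mult_def sum_3 t_def algebra_simps)
  have N: "col_norm2 (g ** p) = s\<^sup>2 * col_norm2 g" "minor_norm2 (g ** p) = t\<^sup>2 * minor_norm2 g"
    unfolding col_norm2_def minor_norm2_def c m by (simp_all add: power_mult_distrib algebra_simps)
  have "test_fun m n a b c u (g ** p)
    = (of_real s ^ (m + a + c) * cpow (- (fst u + of_nat (m + a + c)) / 2) (s\<^sup>2))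
      * (of_real t ^ (n + b) * cpow (- (snd u + of_nat (n + b)) / 2) (t\<^sup>2)) * test_fun m n a b c u g"
    unfolding test_fun_def N c m
    using g SL_mult[OF g p(1)] nz
    by (simp add: cpow_mult norms_pos power_mult_distrib power_add mult_ac del: of_nat_add)
  also have "\<dots> = inverse (chi \<delta> u s t) * test_fun m n a b c u g"
    unfolding homogeneous_cpow[OF nz(1) assms(1)] homogeneous_cpow[OF nz(2) assms(2)] chi_def
    by (simp add: mult_ac)
  finally show "test_fun m n a b c u (g ** p) = inverse (chi \<delta> u (p $ 1 $ 1) (minor12 p)) * test_fun m n a b c u g"
    unfolding s_def t_def .
qed

text \<open>On the cell f is x^a y^b z^c times a smooth factor with value 1 at the origin, hence
  dual to that monomial among those of its weight.\<close>

lemma test_function_exists: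
  obtains f where "f \<in> I_SL \<delta> u"
    "\<And>a' b' c'. a' + b' + 2 * c' = a + b + 2 * c \<Longrightarrow>
      coef a' b' c' f (mat 1) = (if a' = a \<and> b' = b \<and> c' = c then 1 else 0)"
proof -
  have par: "\<exists>m. of_nat (m + k) = (d :: bit)" for k d
  proof (cases "of_nat k = d")
    case False
    then have "of_nat (1 + k) = d" by (cases d) auto
    then show ?thesis by blast
  qed (metis add_0)
  obtain m where m: "of_nat (m + (a + c)) = fst \<delta>" using par by blast
  obtain n where n: "of_nat (n + b) = snd \<delta>" using par by blast
  define f where "f = test_fun m n a b c u"
  have f: "f \<in> I_SL \<delta> u" unfolding f_def using m n by (intro test_fun_in_I) (simp_all add: add.assoc)
  define W :: "V \<Rightarrow> complex" where "W p =
    cpow (- (fst u + of_nat (m + a + c)) / 2) (1 + cx p ^ 2 + cz p ^ 2)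
    * cpow (- (snd u + of_nat (n + b)) / 2) (1 + cy p ^ 2 + (cx p * cy p - cz p) ^ 2)" for p
  have W: "C_inf UNIV W"
    unfolding W_def[abs_def]
    by (intro C_inf_mult C_inf_cpow_compose C_inf_add C_inf_power C_inf_diff C_inf_const C_inf_coords open_UNIV)
      (auto intro!: add_pos_nonneg)
  have S: "C_inf UNIV (\<lambda>p. L p ^ k *\<^sub>R F p)" if "bounded_linear L" "C_inf UNIV F"
    for L :: "V \<Rightarrow> real" and F :: "V \<Rightarrow> complex" and k
    by (intro C_inf_scaleR C_inf_power C_inf_linear that open_UNIV)
  define F where "F = (\<lambda>p. cx p ^ a *\<^sub>R (cy p ^ b *\<^sub>R (cz p ^ c *\<^sub>R W p)))"
  note SF = S[OF bounded_linear_coords(3) W] S[OF bounded_linear_coords(2) S[OF bounded_linear_coords(3) W]]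
    S[OF bounded_linear_coords(1) S[OF bounded_linear_coords(2) S[OF bounded_linear_coords(3) W]]]
  have "coef a' b' c' f (mat 1) = taylor a' b' c' F 0" for a' b' c'
  proof (rule coef_eq_taylor)
    show "C_inf UNIV F" unfolding F_def by (rule SF)
    have "lower3 x y z $ 1 $ 1 = 1" "lower3 x y z $ 2 $ 1 = x" "lower3 x y z $ 3 $ 1 = z"
      "minor12 (lower3 x y z) = 1" "minor13 (lower3 x y z) = y" "minor23 (lower3 x y z) = x * y - z" for x y z
      by (simp_all add: lower3_def minor_defs)
    then show "f (mat 1 ** lower3 x y z) = F (0, x, y, z)" for x y z
      by (simp add: f_def test_fun_def F_def W_def lower3_in_SL col_norm2_def minor_norm2_def
          scaleR_conv_of_real mult_ac)
  qed
  moreover have "taylor a' b' c' F 0 = (if a' = a \<and> b' = b \<and> c' = c then 1 else 0)"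
    if eq: "a' + b' + 2 * c' = a + b + 2 * c" for a' b' c'
  proof -
    have "taylor 0 0 0 W 0 = 1" by (simp add: taylor_def pderivs_def W_def)
    \<comment> \<open>With equal weights, exponents at least a, b, c would have to equal them; any
      other monomial has a smaller exponent and coefficient 0.\<close>
    moreover have "a' < a \<or> b' < b \<or> c' < c \<or> (a' = a \<and> b' = b \<and> c' = c)"
      using eq by linarith
    ultimately show ?thesis
      unfolding F_def taylor_x_power_mult[OF SF(2)] taylor_y_power_mult[OF SF(1)] taylor_z_power_mult[OF W]
      by auto
  qed
  ultimately show ?thesis using f that by simp
qed

section \<open>Linear independence of the chain operators\<close>

lemma sum_op_apply: "(\<Sum>a\<in>A. F a) f y = (\<Sum>a\<in>A. F a f y)"
  for F :: "'c \<Rightarrow> ('a \<Rightarrow> complex) \<Rightarrow> 'b \<Rightarrow> complex"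
  by (induction A rule: infinite_finite_induct) auto

text \<open>The pairings form a diagonal matrix with nonzero diagonal, so evaluating a linear
  relation at \<open>t i\<close> and y isolates the coefficient of \<open>T i\<close>.\<close>

lemma op_dim_ge:
  fixes T :: "nat \<Rightarrow> ('a \<Rightarrow> complex) \<Rightarrow> ('b \<Rightarrow> complex)"
  assumes T: "\<And>i. i \<le> j \<Longrightarrow> T i \<in> V"
    and dual: "\<And>i i'. i \<le> j \<Longrightarrow> i' \<le> j \<Longrightarrow> T i' (t i) y = 0 \<longleftrightarrow> i' \<noteq> i"
  shows "enat (j + 1) \<le> op_dim V"
proof -
  have inj: "inj_on T {..j}"
  proof (rule inj_onI)
    fix i i' assume "i \<in> {..j}" "i' \<in> {..j}" "T i = T i'"
    then show "i = i'" by (metis atMost_iff dual)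
  qed
  have "op_space.independent (T ` {..j})"
  proof
    assume "op_space.dependent (T ` {..j})"
    then obtain k where k: "\<exists>D\<in>T ` {..j}. k D \<noteq> 0" "(\<Sum>D\<in>T ` {..j}. (\<lambda>f y. k D * D f y)) = 0"
      using op_space.dependent_finite[of "T ` {..j}"] by auto
    then obtain i where i: "i \<le> j" "k (T i) \<noteq> 0" by auto
    have "0 = (\<Sum>D\<in>T ` {..j}. (\<lambda>f y. k D * D f y)) (t i) y" unfolding k(2) by simp
    also have "\<dots> = (\<Sum>D\<in>T ` {..j}. k D * D (t i) y)" by (rule sum_op_apply)
    also have "\<dots> = (\<Sum>i'\<le>j. k (T i') * T i' (t i) y)" by (simp add: sum.reindex[OF inj])
    also have "\<dots> = (\<Sum>i'\<in>{i}. k (T i') * T i' (t i) y)"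
      using i(1) dual by (intro sum.mono_neutral_right) auto
    finally show False using i dual[of i i] by simp
  qed
  moreover have "card (T ` {..j}) = j + 1" using card_image[OF inj] by simp
  moreover have "T ` {..j} \<subseteq> V" "finite (T ` {..j})" using T by auto
  ultimately show ?thesis
    unfolding op_dim_def by (intro Sup_upper) (metis (mono_tags, lifting) mem_Collect_eq)
qed

lemma Diff_SL3_dual_family:
  assumes v: "v = fst u + snd u + of_nat j" and \<sigma>: "\<sigma> = fst \<delta> + snd \<delta> + of_nat j"
  shows "\<exists>T t. (\<forall>i\<le>j. T i \<in> Diff_SL3 \<delta> u \<sigma> v) \<and>
    (\<forall>i\<le>j. \<forall>i'\<le>j. T i' (t i) (mat 1) = 0 \<longleftrightarrow> i' \<noteq> i)"
proof -
  have "\<forall>i. \<exists>l. (\<exists>c\<le>min i (j - i). l c \<noteq> 0) \<and> (\<forall>c<min i (j - i).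
      (of_nat (j - c - 2) + (fst u + snd u)) * l (Suc c) = (of_nat (j - i - c - 1) + snd u) * l c)"
    by (intro allI first_order_recurrence_solution)
  then obtain l where nz: "\<And>i. \<exists>c\<le>min i (j - i). l i c \<noteq> 0"
    and l: "\<And>i c. c < min i (j - i) \<Longrightarrow>
      (of_nat (j - c - 2) + (fst u + snd u)) * l i (Suc c) = (of_nat (j - i - c - 1) + snd u) * l i c"
    by metis
  \<comment> \<open>A position on chain i where the solution is nonzero; \<open>t i\<close> is
    chosen dual to the monomial there.\<close>
  obtain c where c: "\<And>i. c i \<le> min i (j - i)" "\<And>i. l i (c i) \<noteq> 0" using nz by metis
  have "\<forall>i. \<exists>f\<in>I_SL \<delta> u. \<forall>a' b' c'. a' + b' + 2 * c' = i - c i + (j - i - c i) + 2 * c i \<longrightarrow>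
      coef a' b' c' f (mat 1) = (if a' = i - c i \<and> b' = j - i - c i \<and> c' = c i then 1 else 0)"
    by (metis test_function_exists)
  then obtain t where t: "\<And>i. t i \<in> I_SL \<delta> u"
    "\<And>i a' b' c'. a' + b' + 2 * c' = i - c i + (j - i - c i) + 2 * c i \<Longrightarrow>
      coef a' b' c' (t i) (mat 1) = (if a' = i - c i \<and> b' = j - i - c i \<and> c' = c i then 1 else 0)"
    by metis
  have "chain_op \<delta> u i' j (l i') (t i) (mat 1) = (if i' = i then l i (c i) else 0)"
    if i: "i \<le> j" "i' \<le> j" for i i'
  proof -
    have m1: "(mat 1 :: real^2^2) \<in> SL" by (simp add: SL_def)
    have "chain_op \<delta> u i' j (l i') (t i) (mat 1)
        = (\<Sum>d\<le>min i' (j - i'). l i' d * coef (i' - d) (j - i' - d) d (t i) (mat 1))"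
      by (simp add: chain_op_def t(1) m1 iota3_1)
    also have "\<dots> = (\<Sum>d\<le>min i' (j - i'). if d = c i then if i' = i then l i' d else 0 else 0)"
    proof (rule sum.cong[OF refl])
      fix d assume "d \<in> {..min i' (j - i')}"
      then have d: "d \<le> i'" "d \<le> j - i'" by auto
      have ci: "c i \<le> i" "c i \<le> j - i" using c(1)[of i] by auto
      have "i' - d + (j - i' - d) + 2 * d = i - c i + (j - i - c i) + 2 * c i"
        using d ci i by arith
      \<comment> \<open>The exponents of x and z add up to the index of the chain, so a monomial
        lies on one chain only.\<close>
      moreover have "i' - d = i - c i \<and> j - i' - d = j - i - c i \<and> d = c i \<longleftrightarrow> i' = i \<and> d = c i"
        using d ci i by auto
      ultimately show "l i' d * coef (i' - d) (j - i' - d) d (t i) (mat 1) =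
          (if d = c i then if i' = i then l i' d else 0 else 0)"
        by (simp only: t(2)) simp
    qed
    also have "\<dots> = (if i' = i then l i (c i) else 0)"
      using c(1)[of i] by (auto simp: sum.delta)
    finally show ?thesis .
  qed
  then show ?thesis
    using chain_op_in_Diff[OF _ v \<sigma> l] c(2) 
    by (intro exI[of _ "\<lambda>i. chain_op \<delta> u i j (l i)"] exI[of _ t]) simp
qed

section \<open>Necessity of the support condition\<close>

text \<open>Differentiating lowers the exponent \<open>s\<close> by one, until it is \<open>0\<close> or has negative real part, where
  continuity at \<open>0\<close> decides.\<close>

lemma tendsto_cpow_at_right_0:
  assumes "Re s > 0"
  shows "(cpow s \<longlongrightarrow> 0) (at_right 0)"
proof (rule tendsto_norm_zero_cancel)
  have "((\<lambda>x. x powr Re s) \<longlongrightarrow> 0) (at_right 0)"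
    using assms by (intro tendsto_zero_powrI[where b = "Re s"] tendsto_ident_at tendsto_const) 
      (auto simp: eventually_at_filter)
  moreover have "\<forall>\<^sub>F x in at_right 0. x powr Re s = norm (cpow s x)"
    by (auto simp: eventually_at_filter cpow_def powr_def norm_exp_eq_Re mult.commute)
  ultimately show "((\<lambda>x. norm (cpow s x)) \<longlongrightarrow> 0) (at_right 0)"
    by (rule Lim_transform_eventually)
qed

lemma smooth_signed_power:
  fixes G :: "real \<Rightarrow> complex"
  assumes "C_inf UNIV G" "\<And>r. r > 0 \<Longrightarrow> G r = C * cpow s r" "\<And>r. r > 0 \<Longrightarrow> G (- r) = e * C * cpow s r"
    "C \<noteq> 0" "Re s < real n"
  shows "\<exists>j::nat. s = of_nat j \<and> e = (- 1) ^ j"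
  using assms
proof (induction n arbitrary: G C s e)
  case 0
  have G: "(G \<longlongrightarrow> G 0) (at_right 0)"
    using C_inf_continuous_on[OF "0.prems"(1)]
    by (simp add: continuous_on_eq_continuous_at isCont_def filterlim_at_split)
  \<comment> \<open>Now Re s < 0, so the factor \<open>cpow (- s) r\<close> tends to 0 while its
    product with G is the nonzero constant C: a contradiction.\<close>
  have "((\<lambda>r. cpow (- s) r * G r) \<longlongrightarrow> 0 * G 0) (at_right 0)"
    using "0.prems"(5) by (intro tendsto_mult tendsto_cpow_at_right_0 G) simp
  moreover have "\<forall>\<^sub>F r in at_right 0. cpow (- s) r * G r = C"
    using "0.prems"(2) by (auto simp: eventually_at_filter cpow_minus)
  ultimately have "((\<lambda>_. C) \<longlongrightarrow> 0 * G 0) (at_right (0::real))"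
    by (rule Lim_transform_eventually)
  then show ?case using "0.prems"(4) by (simp add: tendsto_const_iff)
next
  case (Suc n)
  have contr: "(G \<longlongrightarrow> G 0) (at_right 0)" "((\<lambda>r. G (- r)) \<longlongrightarrow> G 0) (at_right 0)"
  proof -
    have "isCont G 0" using C_inf_continuous_on[OF Suc.prems(1)] by (simp add: continuous_on_eq_continuous_at)
    then have 1: "(G \<longlongrightarrow> G 0) (at 0)" by (simp add: isCont_def)
    then show "(G \<longlongrightarrow> G 0) (at_right 0)" by (simp add: filterlim_at_split)
    have "((\<lambda>r. G (- r)) \<longlongrightarrow> G (- 0)) (at 0)"
      using \<open>isCont G 0\<close> by (intro isCont_tendsto_compose[of _ G] tendsto_minus tendsto_ident_at) simp
    then show "((\<lambda>r. G (- r)) \<longlongrightarrow> G 0) (at_right 0)" by (simp add: filterlim_at_split)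
  qed
  show ?case
  proof (cases "s = 0")
    \<comment> \<open>The one-sided limits of G at 0 are C and e C; continuity gives e = 1, with j =
      0.\<close>
    case True
    have "\<forall>\<^sub>F r in at_right 0. G r = C" "\<forall>\<^sub>F r in at_right 0. G (- r) = e * C"
      using Suc.prems(2,3) True by (auto simp: eventually_at_filter)
    from Lim_transform_eventually[OF contr(1) this(1)] Lim_transform_eventually[OF contr(2) this(2)]
    have "((\<lambda>_. C) \<longlongrightarrow> G 0) (at_right (0::real))" "((\<lambda>_. e * C) \<longlongrightarrow> G 0) (at_right (0::real))" .
    then have "C = G 0" "e * C = G 0" by (simp_all add: tendsto_const_iff)
    then show ?thesis using Suc.prems(4) True by (intro exI[of _ 0]) simp
  next
    case False
    \<comment> \<open>The derivative satisfies the hypotheses with C s, s - 1 and - e; the sign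
      comes from differentiating \<open>G (- r)\<close>, and C s is nonzero since s is.\<close>
    let ?G' = "dird 1 G"
    have G': "(G has_vector_derivative ?G' r) (at r)" for r
      using has_vector_derivative_along_line[OF Suc.prems(1), of 0 1 r] by simp
    have pos: "?G' r = (C * s) * cpow (s - 1) r" if r: "r > 0" for r
    proof -
      have "((\<lambda>r. C * cpow s r) has_vector_derivative C * (s * cpow (s - 1) r)) (at r)"
        by (intro has_vector_derivative_mult_right has_vector_derivative_cpow r)
      then have "(G has_vector_derivative C * (s * cpow (s - 1) r)) (at r)"
        by (rule has_vector_derivative_transform_within_open[where S = "{0<..}"]) (use r Suc.prems(2) in auto)
      then show ?thesis using vector_derivative_unique_at[OF G'] by (simp add: mult.assoc)
    qed
    have neg: "?G' (- r) = (- e) * (C * s) * cpow (s - 1) r" if r: "r > 0" for r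
    proof -
      have "((\<lambda>r. G (- r)) has_vector_derivative - ?G' (- r)) (at r)"
        using vector_diff_chain_at[of uminus "-1" r G "?G' (- r)"] G'[of "- r"]
        by (simp add: o_def has_vector_derivative_minus[OF has_vector_derivative_id, simplified])
      moreover have "((\<lambda>r. e * C * cpow s r) has_vector_derivative e * C * (s * cpow (s - 1) r)) (at r)"
        by (intro has_vector_derivative_mult_right has_vector_derivative_cpow r)
      then have "((\<lambda>r. G (- r)) has_vector_derivative e * C * (s * cpow (s - 1) r)) (at r)"
        by (rule has_vector_derivative_transform_within_open[where S = "{0<..}"]) (use r Suc.prems(3) in auto)
      ultimately have "- ?G' (- r) = e * C * (s * cpow (s - 1) r)" by (rule vector_derivative_unique_at)
      then show ?thesis by (metis (no_types, lifting) minus_minus minus_mult_left mult.assoc)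
    qed
    have "\<exists>j::nat. s - 1 = of_nat j \<and> - e = (- 1) ^ j"
      by (rule Suc.IH[OF C_inf_dird[OF Suc.prems(1)] pos neg]) (use Suc.prems(4,5) False in auto)
    then obtain j :: nat where "s - 1 = of_nat j" "- e = (- 1) ^ j" by blast
    then have "s = of_nat (Suc j)" "- (- e) = (- 1) ^ Suc j" by (simp_all add: algebra_simps)
    then have "s = of_nat (Suc j) \<and> e = (- 1) ^ Suc j" by simp
    then show ?thesis by blast
  qed
qed

section \<open>Contraction of the big cell by the torus\<close>

lemma chi_mult:
  assumes "a > 0" "b > 0" "r \<noteq> 0"
  shows "chi \<delta> u (a * r) (b * r) = cpow (fst u) a * cpow (snd u) b * chi \<delta> u r r"
  using assms by (simp add: chi_def sgn_mult abs_mult cpow_mult mult_ac)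

text \<open>The parameter r is unrestricted and the second component is any matrix with positive
  pivots, not only one in the group, so the set is open. It contains the identity matrix at every r,
  including 0, and positivity keeps \<open>contracted\<close> smooth.\<close>

definition pos_cell :: "(real \<times> (real^3^3)) set" where
  "pos_cell = {q. snd q $ 1 $ 1 > 0 \<and> minor12 (snd q) > 0}"

text \<open>Up to a character value this is \<open>f\<close> translated by \<open>diag (1/r, 1, r)\<close>, but it stays smooth at
  \<open>r = 0\<close>.\<close>

definition contracted :: "complex \<times> complex \<Rightarrow> (real^3^3 \<Rightarrow> complex) \<Rightarrow> real \<times> (real^3^3) \<Rightarrow> complex" where
  "contracted u f q = cpow (- fst u) (snd q $ 1 $ 1) * cpow (- snd u) (minor12 (snd q))
    * f (lower3 (fst q * (snd q $ 2 $ 1 / snd q $ 1 $ 1)) (fst q * (minor13 (snd q) / minor12 (snd q)))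
        ((fst q)\<^sup>2 * (snd q $ 3 $ 1 / snd q $ 1 $ 1)))"

text \<open>The direction extends the left-invariant field of X to \<open>pos_cell\<close> with r
  held fixed.\<close>

definition param_deriv :: "real^3^3 \<Rightarrow> (real \<times> (real^3^3) \<Rightarrow> complex) \<Rightarrow> real \<times> (real^3^3) \<Rightarrow> complex" where
  "param_deriv X \<Phi> q = frechet_derivative \<Phi> (at q) (0, snd q ** X)"

lemma C_inf_snd_compose: "C_inf UNIV (g :: real^3^3 \<Rightarrow> real) \<Longrightarrow> C_inf U (\<lambda>q :: real \<times> (real^3^3). g (snd q))"
  by (rule C_inf_subset[OF C_inf_compose[OF open_UNIV open_UNIV C_inf_linear[OF bounded_linear_snd] _ subset_UNIV]
        subset_UNIV])

lemma open_pos_cell: "open pos_cell"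
proof -
  have "continuous_on UNIV (\<lambda>q :: real \<times> (real^3^3). snd q $ 1 $ 1)"
    "continuous_on UNIV (\<lambda>q :: real \<times> (real^3^3). minor12 (snd q))"
    by (intro C_inf_continuous_on C_inf_snd_compose C_inf_minors open_UNIV)+
  then have "open ({q :: real \<times> (real^3^3). 0 < snd q $ 1 $ 1} \<inter> {q. 0 < minor12 (snd q)})"
    by (intro open_Int open_Collect_less continuous_on_const)
  then show ?thesis by (simp add: pos_cell_def Collect_conj_eq)
qed

lemma C_inf_contracted:
  assumes "smooth_on SL f"
  shows "C_inf pos_cell (contracted u f)"
proof -
  have r: "C_inf pos_cell (fst :: real \<times> (real^3^3) \<Rightarrow> real)"
    by (rule C_inf_linear[OF bounded_linear_fst])
  have e: "C_inf pos_cell (\<lambda>q. snd q $ i $ k)" "C_inf pos_cell (\<lambda>q. minor12 (snd q))"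
    "C_inf pos_cell (\<lambda>q. minor13 (snd q))" for i k
    by (intro C_inf_snd_compose C_inf_minors open_UNIV)+
  have "C_inf pos_cell (\<lambda>q. lower3 (fst q * (snd q $ 2 $ 1 / snd q $ 1 $ 1))
      (fst q * (minor13 (snd q) / minor12 (snd q))) ((fst q)\<^sup>2 * (snd q $ 3 $ 1 / snd q $ 1 $ 1)))"
    by (rule C_inf_lower3; intro C_inf_mult C_inf_divide C_inf_power r e open_pos_cell)
      (auto simp: pos_cell_def)
  then have "C_inf pos_cell (\<lambda>q. f (lower3 (fst q * (snd q $ 2 $ 1 / snd q $ 1 $ 1))
      (fst q * (minor13 (snd q) / minor12 (snd q))) ((fst q)\<^sup>2 * (snd q $ 3 $ 1 / snd q $ 1 $ 1))))"
    by (rule C_inf_smooth_on_compose[OF assms open_pos_cell]) (auto simp: lower3_in_SL)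
  then show ?thesis
    unfolding contracted_def[abs_def]
    by (intro C_inf_mult C_inf_cpow_compose e open_pos_cell)
      (auto simp: pos_cell_def)
qed

lemma C_inf_param_deriv: "C_inf pos_cell \<Phi> \<Longrightarrow> C_inf pos_cell (param_deriv X \<Phi>)"
proof -
  assume \<Phi>: "C_inf pos_cell \<Phi>"
  have "C_inf pos_cell (\<lambda>q :: real \<times> (real^3^3). (0 :: real, snd q ** X))"
    by (intro C_inf_compose_linear[of "\<lambda>M. (0, M)"] bounded_linear_Pair bounded_linear_zero
        bounded_linear_ident C_inf_matrix_mult C_inf_linear[OF bounded_linear_snd] C_inf_const open_pos_cell)
  from C_inf_frechet_derivative_field[OF open_pos_cell \<Phi> this]
  show ?thesis by (simp add: param_deriv_def[abs_def])
qed

lemma C_inf_foldr_param_deriv: "C_inf pos_cell \<Phi> \<Longrightarrow> C_inf pos_cell (foldr param_deriv Xs \<Phi>)"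
  by (induction Xs) (auto intro: C_inf_param_deriv)

text \<open>Multiplying g by diag (1/r, 1, r) turns its cell coordinates into r x, r y, r^2 z and
  both character arguments into 1/r times themselves. So the left side, meaningful for nonzero r, is
  a constant times a function smooth across r = 0.\<close>

lemma right_deriv_contracted:
  assumes f: "f \<in> I_SL \<delta> u" and r: "r \<noteq> 0" and Xs: "\<forall>X\<in>set Xs. trace X = 0"
    and g: "g \<in> SL" "(r, g) \<in> pos_cell"
  shows "foldr right_deriv Xs (\<lambda>x. f (iota3 (diag2 (1 / r) r) ** x)) g
    = inverse (chi \<delta> u (1 / r) (1 / r)) * foldr param_deriv Xs (contracted u f) (r, g)"
  using Xs g
proof (induction Xs arbitrary: g)
  case Nil
  let ?g = "iota3 (diag2 (1 / r) r) ** g"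
  have pos: "g $ 1 $ 1 > 0" "minor12 g > 0" using Nil by (auto simp: pos_cell_def)
  have e: "?g $ 1 $ 1 = g $ 1 $ 1 * (1 / r)" "?g $ 2 $ 1 = g $ 2 $ 1" "?g $ 3 $ 1 = r * g $ 3 $ 1"
    "minor12 ?g = minor12 g * (1 / r)" "minor13 ?g = minor13 g"
    using r by (simp_all add: minor_defs matrix_matrix_mult_def sum_3 iota3_def diag2_def field_simps)
  have "?g \<in> SL"
    using r Nil by (intro SL_mult iota3_in_SL) (simp_all add: SL_def det_2 diag2_def)
  then have "f ?g = inverse (chi \<delta> u (g $ 1 $ 1 * (1 / r)) (minor12 g * (1 / r)))
      * f (lower3 (r * (g $ 2 $ 1 / g $ 1 $ 1)) (r * (minor13 g / minor12 g)) (r\<^sup>2 * (g $ 3 $ 1 / g $ 1 $ 1)))"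
    using I_SL_big_cell[OF f, of ?g] pos r unfolding e by (simp add: power2_eq_square mult_ac)
  then show ?case
    unfolding chi_mult[OF pos, of "1 / r", simplified, OF r]
    using pos r chi_mult[OF pos, of "1 / r" \<delta> u] by (simp add: contracted_def cpow_minus mult_ac)
next
  case (Cons X Xs)
  let ?\<Phi> = "foldr param_deriv Xs (contracted u f)"
  let ?U = "{g. (r, g) \<in> pos_cell}"
  have \<Phi>: "C_inf pos_cell ?\<Phi>"
    by (rule C_inf_foldr_param_deriv[OF C_inf_contracted[OF I_SL_D(1)[OF f]]])
  have U: "open ?U"
    using continuous_open_preimage[of UNIV "\<lambda>g. (r, g)" pos_cell] open_pos_cell
    by (simp add: vimage_def continuous_on_Pair continuous_on_const continuous_on_id)
  have "((\<lambda>g. (r, g)) has_derivative (\<lambda>h. (0, h))) (at g)"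
    by (auto intro!: derivative_eq_intros)
  from has_derivative_compose[OF this C_inf_has_derivative[OF \<Phi> Cons.prems(3)]]
  have "((\<lambda>g. inverse (chi \<delta> u (1 / r) (1 / r)) * ?\<Phi> (r, g)) has_derivative
      (\<lambda>h. inverse (chi \<delta> u (1 / r) (1 / r)) * frechet_derivative ?\<Phi> (at (r, g)) (0, h))) (at g)"
    by (rule has_derivative_mult_right)
  from right_deriv_eq[OF _ U _ Cons.prems(2) this, of X
      "foldr right_deriv Xs (\<lambda>x. f (iota3 (diag2 (1 / r) r) ** x))"]
  show ?case using Cons by (simp add: param_deriv_def[of X ?\<Phi>])
qed

lemma Diff_SL3_nonzero_imp:
  assumes D: "D \<in> Diff_SL3 \<delta> u \<sigma> v" and nz: "D \<noteq> 0"
  shows "\<exists>j::nat. v = fst u + snd u + of_nat j \<and> \<sigma> = fst \<delta> + snd \<delta> + of_nat j"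
proof -
  have D_zero: "D f = 0" if "f \<notin> I_SL \<delta> u" for f using D that by (simp add: Diff_SL3_def)
  have D_J: "D f \<in> J_SL \<sigma> v" if "f \<in> I_SL \<delta> u" for f using D that by (simp add: Diff_SL3_def)
  have D_inter: "D (left_translate (iota3 h) f) = left_translate h (D f)"
    if "f \<in> I_SL \<delta> u" "h \<in> SL" for f h using D that by (simp add: Diff_SL3_def)
  have D_diff: "differential_operator_on (I_SL \<delta> u) D" using D by (simp add: Diff_SL3_def)
  have inv_inv: "matrix_inv (matrix_inv h) = h" if "h \<in> SL" for h :: "real^2^2"
    by (rule matrix_inv_unique) (use that SL_matrix_inv in auto)
  have shift: "D (\<lambda>x. f (iota3 h ** x)) (mat 1) = D f h" "(\<lambda>x. f (iota3 h ** x)) \<in> I_SL \<delta> u"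
    if f: "f \<in> I_SL \<delta> u" and h: "h \<in> SL" for f h
  proof -
    have "left_translate (iota3 (matrix_inv h)) f = (\<lambda>x. f (iota3 h ** x))"
      unfolding left_translate_def iota3_matrix_inv[OF SL_matrix_inv(1)[OF h]] inv_inv[OF h] ..
    then show "D (\<lambda>x. f (iota3 h ** x)) (mat 1) = D f h"
      using D_inter[OF f SL_matrix_inv(1)[OF h]] inv_inv[OF h] by (simp add: left_translate_def)
    show "(\<lambda>x. f (iota3 h ** x)) \<in> I_SL \<delta> u" by (intro I_SL_translate f iota3_in_SL h)
  qed
  obtain f\<^sub>1 where "D f\<^sub>1 \<noteq> 0" using nz by (metis ext zero_fun_def)
  then obtain y where y0: "D f\<^sub>1 y \<noteq> 0" by (metis ext zero_fun_def)
  have f1: "f\<^sub>1 \<in> I_SL \<delta> u" using D_zero \<open>D f\<^sub>1 \<noteq> 0\<close> by blast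
  have y: "y \<in> SL" using D_J[OF f1] y0 by (auto simp: J_SL_def smooth_Ind_def)
  \<comment> \<open>Translation by y moves the nonzero value to the identity, so that only the local
    formula at \<open>mat 1\<close> is used below.\<close>
  define f where "f = (\<lambda>x. f\<^sub>1 (iota3 y ** x))"
  define C where "C = D f (mat 1)"
  have f: "f \<in> I_SL \<delta> u" and C: "C \<noteq> 0"
    using shift[OF f1 y] y0 by (simp_all add: f_def C_def)
  have m1: "(mat 1 :: real^2^2) \<in> SL" "(mat 1 :: real^3^3) \<in> SL" by (simp_all add: SL_def)
  obtain U W a where W: "finite (W :: (real^3^3) list set)" "\<forall>Xs\<in>W. \<forall>X\<in>set Xs. trace X = 0"
    and Da: "mat 1 \<in> U" "\<forall>f\<in>I_SL \<delta> u. \<forall>y\<in>U \<inter> SL. D f y = (\<Sum>Xs\<in>W. a Xs y * foldr right_deriv Xs f (iota3 y))"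
    using bspec[OF D_diff[unfolded differential_operator_on_def] m1(1)]
    by (elim exE conjE) (rule that; assumption)
  have D1: "D f (mat 1) = (\<Sum>Xs\<in>W. a Xs (mat 1) * foldr right_deriv Xs f (mat 1))"
    if "f \<in> I_SL \<delta> u" for f
    using Da that m1 by (auto simp: iota3_1)
  \<comment> \<open>For nonzero r this is, up to a character value, D f at diag (1/r, r); as a
    function of r it is smooth on the whole line.\<close>
  define G where "G r = (\<Sum>Xs\<in>W. a Xs (mat 1) * foldr param_deriv Xs (contracted u f) (r, mat 1))" for r
  have cell1: "(r, mat 1) \<in> pos_cell" for r by (simp add: pos_cell_def minor12_def mat_def)
  have lin: "C_inf UNIV (\<lambda>r :: real. (r, mat 1 :: real^3^3))"
  proof -
    have "C_inf UNIV (\<lambda>r :: real. (r, 0 :: real^3^3))"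
      by (intro C_inf_linear bounded_linear_Pair bounded_linear_ident bounded_linear_zero)
    from C_inf_add[OF open_UNIV this C_inf_const[of UNIV "(0, mat 1)"]] show ?thesis by simp
  qed
  have G_smooth: "C_inf UNIV G"
    unfolding G_def[abs_def]
    by (intro C_inf_sum C_inf_mult C_inf_const open_UNIV W(1)
        C_inf_compose[OF open_UNIV open_pos_cell lin C_inf_foldr_param_deriv] C_inf_contracted I_SL_D(1)[OF f])
      (auto simp: cell1)
  \<comment> \<open>D f at diag (1/r, r) is computed twice: by equivariance in \<open>J_SL\<close>,
    and by the local formula at the identity applied to the translate of f.\<close>
  have G_eq: "G r = chi \<delta> u (1 / r) (1 / r) * inverse (sign_pow (sgn (1 / r)) \<sigma> * cpow v \<bar>1 / r\<bar>) * C"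
    if r: "r \<noteq> 0" for r
  proof -
    let ?p = "diag2 (1 / r) r"
    have p: "?p \<in> SL" using r by (simp add: SL_def det_2 diag2_def)
    have "(?p, sign_pow (sgn (1 / r)) \<sigma> * cpow v \<bar>1 / r\<bar>) \<in> char_SL2 \<sigma> v"
      using p by (simp add: char_SL2_iff diag2_def)
    then have "D f (mat 1 ** ?p) = inverse (sign_pow (sgn (1 / r)) \<sigma> * cpow v \<bar>1 / r\<bar>) * C"
      using D_J[OF f] m1(1) unfolding J_SL_def smooth_Ind_def C_def by blast
    moreover have "D f ?p = (\<Sum>Xs\<in>W. a Xs (mat 1) *
        (inverse (chi \<delta> u (1 / r) (1 / r)) * foldr param_deriv Xs (contracted u f) (r, mat 1)))"
      unfolding shift(1)[OF f p, symmetric] D1[OF shift(2)[OF f p]]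
      by (intro sum.cong refl) (simp add: right_deriv_contracted[OF f r _ m1(2) cell1] W(2))
    then have "D f ?p = inverse (chi \<delta> u (1 / r) (1 / r)) * G r"
      by (simp add: G_def sum_distrib_left mult_ac)
    moreover have "chi \<delta> u (1 / r) (1 / r) \<noteq> 0"
      using r by (simp add: chi_def sign_pow_def sgn_if)
    ultimately show ?thesis by (simp add: field_simps)
  qed
  \<comment> \<open>The exponent of G on the positive axis, and the factor between its values at - r
    and r, which compares the characters at -1.\<close>
  let ?s = "v - (fst u + snd u)"
  let ?e = "sign_pow (-1) (fst \<delta> + snd \<delta> + \<sigma>)"
  have cpow_inv: "cpow t (1 / r) = cpow (- t) r" if "r > 0" for t r
    using that by (simp add: cpow_def ln_div)
  have pos: "G r = C * cpow ?s r" if r: "r > 0" for r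
    using r G_eq[of r] cpow_add[of v "- fst u - snd u" r] cpow_add[of "- fst u" "- snd u" r]
    by (simp add: chi_def sign_pow_def cpow_inv cpow_minus[symmetric] algebra_simps)
  have neg: "G (- r) = ?e * C * cpow ?s r" if r: "r > 0" for r
  proof -
    have "sgn (1 / (- r)) = -1" using r by (simp add: sgn_if)
    moreover have "\<bar>1 / (- r)\<bar> = 1 / r" using r by simp
    ultimately have "G (- r) = (sign_pow (-1) (fst \<delta>) * sign_pow (-1) (snd \<delta>)) * inverse (sign_pow (-1) \<sigma>)
        * C * (cpow (- fst u) r * cpow (- snd u) r * cpow v r)"
      using G_eq[of "- r"] r unfolding chi_def by (simp add: cpow_inv cpow_minus mult_ac)
    also have "cpow (- fst u) r * cpow (- snd u) r * cpow v r = cpow ?s r"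
      by (simp add: cpow_add[symmetric] algebra_simps)
    also have "inverse (sign_pow (-1) \<sigma>) = sign_pow (-1) \<sigma>" by (simp add: sign_pow_def)
    also have "sign_pow (-1) (fst \<delta>) * sign_pow (-1) (snd \<delta>) * sign_pow (-1) \<sigma> = ?e"
    proof -
      have "(-1::real) \<in> {1, -1}" by simp
      then show ?thesis by (simp only: sign_pow_add)
    qed
    finally show ?thesis .
  qed
  obtain n :: nat where "Re ?s < real n" using reals_Archimedean2 by blast
  from smooth_signed_power[OF G_smooth pos neg C this]
  obtain j :: nat where j: "?s = of_nat j" "?e = (- 1) ^ j" by blast
  have "sign_pow (-1) (of_nat j) = (- 1) ^ j" using sign_pow_of_nat[of "-1" j] by simp
  then have "fst \<delta> + snd \<delta> + \<sigma> = of_nat j"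
    using j(2) by (auto simp: sign_pow_def split: if_splits)
  then have "\<sigma> = fst \<delta> + snd \<delta> + of_nat j"
    by (cases "fst \<delta>"; cases "snd \<delta>"; cases \<sigma>) auto
  moreover have "v = fst u + snd u + of_nat j" using j(1) by (simp add: algebra_simps)
  ultimately show ?thesis by blast
qed

theorem theoremI:
  fixes \<delta> :: "bit \<times> bit" and \<sigma> :: bit and u :: "complex \<times> complex" and v :: complex
  shows "(Diff_SL3 \<delta> u \<sigma> v \<noteq> {0} \<longleftrightarrow> (\<delta>, \<sigma>, u, v) \<in> Supp_SL3) \<and>
    (\<forall>j::nat. (\<delta>, \<sigma>, u, v) \<in> Supp_SL3 \<and> of_nat j = - (fst u + snd u - v) \<longrightarrow>
       enat (j + 1) \<le> op_dim (Diff_SL3 \<delta> u \<sigma> v))"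
proof (intro conjI iffI allI impI)
  \<comment> \<open>The space contains zero, so differing from {0} means having a nonzero element
    rather than being empty.\<close>
  have "0 \<in> J_SL \<sigma> v"
    by (auto simp: J_SL_def smooth_Ind_def zero_fun_def smooth_on_const)
  moreover have "differential_operator_on (I_SL \<delta> u) 0"
    unfolding differential_operator_on_def
    by (intro ballI exI[of _ UNIV] exI[of _ "{}"]) simp
  ultimately have "0 \<in> Diff_SL3 \<delta> u \<sigma> v"
    by (auto simp: Diff_SL3_def left_translate_def)
  moreover assume "Diff_SL3 \<delta> u \<sigma> v \<noteq> {0}"
  ultimately obtain D where "D \<in> Diff_SL3 \<delta> u \<sigma> v" "D \<noteq> 0" by blast
  then show "(\<delta>, \<sigma>, u, v) \<in> Supp_SL3" unfolding Supp_SL3_iff by (rule Diff_SL3_nonzero_imp)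
next
  assume "(\<delta>, \<sigma>, u, v) \<in> Supp_SL3"
  then obtain j :: nat where j: "v = fst u + snd u + of_nat j" "\<sigma> = fst \<delta> + snd \<delta> + of_nat j"
    unfolding Supp_SL3_iff by blast
  obtain T t where T: "\<forall>i\<le>j. T i \<in> Diff_SL3 \<delta> u \<sigma> v"
    "\<forall>i\<le>j. \<forall>i'\<le>j. T i' (t i) (mat 1) = 0 \<longleftrightarrow> i' \<noteq> i"
    using Diff_SL3_dual_family[OF j] by blast
  have "T 0 \<in> Diff_SL3 \<delta> u \<sigma> v" using T(1) by blast
  moreover have "T 0 (t 0) (mat 1) \<noteq> 0" using T(2) by blast
  then have "T 0 \<noteq> 0" by (metis zero_fun_apply)
  ultimately show "Diff_SL3 \<delta> u \<sigma> v \<noteq> {0}" by blast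
next
  fix j :: nat
  assume "(\<delta>, \<sigma>, u, v) \<in> Supp_SL3 \<and> of_nat j = - (fst u + snd u - v)"
  then obtain j' :: nat where j': "v = fst u + snd u + of_nat j'" "\<sigma> = fst \<delta> + snd \<delta> + of_nat j'"
    and "of_nat j = v - (fst u + snd u)"
    unfolding Supp_SL3_iff by auto
  \<comment> \<open>The weight is determined by u and v, so the given j is the one supplied by the
    support condition.\<close>
  have "complex_of_nat j = of_nat j'" unfolding \<open>of_nat j = v - (fst u + snd u)\<close> j'(1) by simp
  then have "j' = j" by (simp only: of_nat_eq_iff)
  note j = j'[unfolded this]
  obtain T t where T: "\<forall>i\<le>j. T i \<in> Diff_SL3 \<delta> u \<sigma> v"
    "\<forall>i\<le>j. \<forall>i'\<le>j. T i' (t i) (mat 1) = 0 \<longleftrightarrow> i' \<noteq> i"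
    using Diff_SL3_dual_family[OF j] by blast
  then show "enat (j + 1) \<le> op_dim (Diff_SL3 \<delta> u \<sigma> v)"
    using op_dim_ge[of j T _ t "mat 1"] T by blast
qed

end
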